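(* Let $\widetilde{\mathcal H}_{\mathcal T}$ be the specified Feynman graphs bialgebra of a theory $\mathcal T$ and let $$G=\{\varphi\in\widetilde{\mathcal L}(\widetilde{\mathcal H}_{\mathcal T},\mathcal B)\ :\ \varphi(\gamma\gamma')=\varphi(\gamma)\bullet\varphi(\gamma')\ \text{ and }\ \varphi(\mathbf 1)=\mathbf 1_{\mathcal B}\}.$$ Equipped with the convolution product $$(\chi\circledast\eta)(\Gamma,\underline i)=\sum_{(\gamma,\underline j)\subset(\Gamma,\underline i),\ (\Gamma,\underline i)/(\gamma,\underline j)\in\mathcal T}\pi_{\gamma,\Gamma}[\chi(\gamma)]\; i_{\Gamma,\gamma}\big[\eta\big(\Gamma/(\gamma,\underline j)\big)\big]$$ (pointwise product in $V_\Gamma$ on the right-hand side; sum over locally 1PI specified covering subgraphs), the set $G$ is a subgroup of the semigroup of characters of $\widetilde{\mathcal H}_{\mathcal T}$ with values in $\mathcal B$; that is, $G$ is closed under $\circledast$ and $(G,\circledast)$ is a group.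
   Context: Graphs. A (Feynman) graph $\Gamma$ consists of a finite set $\mathcal V(\Gamma)$ of vertices, a finite set $\mathcal E(\Gamma)$ of half-edges, an involution $\sigma_\Gamma:\mathcal E(\Gamma)\to\mathcal E(\Gamma)$ and a map $\partial:\mathcal E(\Gamma)\to\mathcal V(\Gamma)$. For a vertex $v$, $st(v)=\{e:\partial(e)=v\}$. Fixed points of $\sigma_\Gamma$ are the external edges; pairs $\{e,\sigma_\Gamma(e)\}$ with $e\ne\sigma_\Gamma(e)$ are the internal edges. Cutting an internal edge means modifying $\sigma_\Gamma$ so that its two half-edges become fixed points. $\pi_0(\Gamma)$ is the set of connected components. A graph is 1PI if it is connected and remains connected when any one internal edge is cut; it is locally 1PI if each connected component is 1PI (the empty graph is locally 1PI). A covering subgraph $\gamma$ of $\Gamma$ is a graph obtained from $\Gamma$ by cutting some (possibly no, possibly all) internal edges; it has the same vertices and half-edges. The contracted graph $\Gamma/\gamma$ has as vertices the connected components of $\gamma$, as half-edges the fixed points of $\sigma_\gamma$, as involution the restriction of $\sigma_\Gamma$, and a half-edge $e$ is attached to the component of $\gamma$ containing $\partial(e)$. The residue is $\mathrm{res}\,\Gamma=\Gamma/\Gamma$. $\gamma\gamma'$ denotes disjoint union. Theory. Every half-edge carries a type in a set $\mathcal E(\mathcal T)$, and $\sigma_\Gamma$ preserves types. A vertex type is a function $\mathcal E(\mathcal T)\to\mathbb N$ (the number of half-edges of each type at the vertex); $\mathcal V(\mathcal T)$ is a prescribed set of vertex types. $\widetilde{\mathcal V}(\mathcal T)$ is a set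 of pairs $(t,k)$ (refined types) with $t\in\mathcal V(\mathcal T)$ and $k\in\mathbb N$, every $t$ occurring with at least one and only finitely many $k$. In a graph of $\mathcal T$ each vertex $v$ carries a refined type $(t,k)\in\widetilde{\mathcal V}(\mathcal T)$, where $t$ is the type of $v$ determined by the half-edges in $st(v)$. A locally 1PI graph is superficially divergent if the residue of each of its components is a vertex whose type lies in $\mathcal V(\mathcal T)$. Specified graphs. A specified graph of $\mathcal T$ is a pair $\bar\Gamma=(\Gamma,\underline i)$ where $\Gamma$ is a locally 1PI superficially divergent graph of $\mathcal T$ and $\underline i:\pi_0(\Gamma)\to\mathbb N$ is such that for each component $\Gamma_0$, if $t$ is the type of the vertex $\mathrm{res}\,\Gamma_0$, then $(t,\underline i(\Gamma_0))\in\widetilde{\mathcal V}(\mathcal T)$; if $\Gamma_0$ is a single vertex of refined type $(t,k)$ without internal edges, then $\underline i(\Gamma_0)=k$. A specified graph $(\gamma,\underline j)$ is a specified covering subgraph of $(\Gamma,\underline i)$, written $(\gamma,\underline j)\subset(\Gamma,\underline i)$, if $\gamma$ is a covering subgraph of $\Gamma$ (vertices keeping their refined types) and $\underline j(\gamma_0)=\underline i(\gamma_0)$ whenever the component $\gamma_0$ of $\gamma$ is also a full connected component of $\Gamma$; $\bar\gamma=\bar\Gamma$ is allowed. The contracted specified graph is $\bar\Gamma/\bar\gamma=(\Gamma/\bar\gamma,\underline i)$, where $\Gamma/\bar\gamma$ is $\Gamma/\gamma$ with the vertex coming from a component $\gamma_0$ of $\gamma$ given the refined type $(t,\underline j(\gamma_0))$,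 $t$ being the type of $\mathrm{res}\,\gamma_0$. It is in $\mathcal T$ if all its vertices have refined type in $\widetilde{\mathcal V}(\mathcal T)$. $\widetilde{\mathcal H}_{\mathcal T}$ is the $\mathbb C$-vector space with basis the specified graphs, with product disjoint union and unit $\mathbf 1$ the empty graph. Function spaces. Fix an integer $D\ge1$. The momentum space of $\Gamma$ is $$W_\Gamma=\Big\{p:\mathcal E(\Gamma)\to\mathbb R^D\ :\ \sum_{e\in st(v)}p_e=0\ \forall v\in\mathcal V(\Gamma),\ \ p_e+p_{\sigma_\Gamma(e)}=0\ \forall e\in\mathcal E(\Gamma)\text{ with }e\ne\sigma_\Gamma(e)\Big\}.$$ For $\Gamma$ connected, $V_\Gamma=\mathcal C^\infty(W_\Gamma,\mathbb C)$; in general $V_\Gamma=\bigotimes_jV_{\Gamma_j}$ is the (unordered, algebraic) tensor product over the connected components $\Gamma_j$, identified with a subalgebra of $\mathcal C^\infty(W_\Gamma,\mathbb C)$ via $(\bigotimes_jv_j)(p)=\prod_jv_j(p|_{\mathcal E(\Gamma_j)})$. $\mathcal B=\prod_\Gamma V_\Gamma$, product over all graphs, connected or not. The concatenation product $\bullet$ is defined for $v=\bigotimes_{j\in A}v_j\in V_\Gamma$, $v'=\bigotimes_{j\in B}v_j\in V_{\Gamma'}$ (with $A\cap B=\emptyset$) by $v\bullet v'=\bigotimes_{j\in A\sqcup B}v_j\in V_{\Gamma\Gamma'}$, i.e. $(v\bullet v')(p,p')=v(p)v'(p')$ on $W_{\Gamma\Gamma'}=W_\Gamma\times W_{\Gamma'}$,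 extended bilinearly to $\mathcal B$; its unit $\mathbf 1_{\mathcal B}$ is $1\in V_\emptyset=\mathbb C$. For $\gamma$ a covering subgraph of $\Gamma$: $\mathcal F_{\Gamma,\gamma}:W_\Gamma\to W_{\Gamma/\gamma}$ is restriction of $p$ to $\mathcal E(\Gamma/\gamma)\subset\mathcal E(\Gamma)$, and $i_{\Gamma,\gamma}=\mathcal F_{\Gamma,\gamma}^*:V_{\Gamma/\gamma}\to V_\Gamma$ is pullback of functions; $\mathcal G_{\gamma,\Gamma}:W_\Gamma\hookrightarrow W_\gamma$ is the inclusion, and $\pi_{\gamma,\Gamma}=\mathcal G_{\gamma,\Gamma}^*:V_\gamma\to V_\Gamma$ is restriction of functions. $\widetilde{\mathcal L}(\widetilde{\mathcal H}_{\mathcal T},\mathcal B)$ is the set of $\mathbb C$-linear maps $\chi:\widetilde{\mathcal H}_{\mathcal T}\to\mathcal B$ such that (1) $\chi(\Gamma,\underline i)=\chi(\Gamma)$ does not depend on the specification $\underline i$; (2) $\chi(\Gamma)\in V_\Gamma$ for every graph $\Gamma$; (3) $\chi(\Gamma)=\mathbf 1_{V_\Gamma}$ (constant function $1$) if $\Gamma$ has no internal edges. Graphs are considered up to isomorphism preserving half-edge types and refined types; an isomorphism $\Gamma\cong\Gamma'$ induces identifications $W_\Gamma\cong W_{\Gamma'}$, $V_\Gamma\cong V_{\Gamma'}$, and all assignments $\Gamma\mapsto\chi(\Gamma)\in V_\Gamma$ are understood to be compatible with these. *)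

theory Defs
  imports
    "HOL-Analysis.Analysis"
    "HOL-Algebra.Group"
    "HOL-Library.Poly_Mapping"
    "HOL-Library.FuncSet"
begin

section \<open>Graphs\<close>

text \<open>
  Vertices and half-edges are labelled by natural numbers, so every finite graph occurs up to
  isomorphism. Instead of passing to isomorphism classes (which would lose the
  identification of half-edges needed for momentum spaces of graphs with automorphisms), all
  assignments on graphs are required below to be compatible with isomorphisms.
  All structure maps are \<open>extensional\<close>, so that equality of records is equality of graphs.
  The refined type of a vertex \<open>v\<close> is the pair \<open>(vtype \<Gamma> v, vidx \<Gamma> v)\<close>; as its first entry is
  determined by the half-edges at \<open>v\<close>, only the second one is stored.
\<close>

record 'e fgraph =
  verts :: "nat set"
  hedges :: "nat set"
  invol :: "nat \<Rightarrow> nat"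
  att :: "nat \<Rightarrow> nat"
  htype :: "nat \<Rightarrow> 'e"
  vidx :: "nat \<Rightarrow> nat"

record 'e ftheory =
  etypes :: "'e set"
  vtypes :: "('e \<Rightarrow> nat) set"
  rvtypes :: "(('e \<Rightarrow> nat) \<times> nat) set"

text \<open>A function from the set of half-edge types to \<open>nat\<close> is represented by its extension by \<open>0\<close>.\<close>

definition valid_theory :: "'e ftheory \<Rightarrow> bool" where
  "valid_theory T \<longleftrightarrow>
     (\<forall>t\<in>vtypes T. \<forall>e. e \<notin> etypes T \<longrightarrow> t e = 0) \<and>
     rvtypes T \<subseteq> vtypes T \<times> UNIV \<and>
     (\<forall>t\<in>vtypes T. {k. (t, k) \<in> rvtypes T} \<noteq> {} \<and> finite {k. (t, k) \<in> rvtypes T})"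

definition star :: "'e fgraph \<Rightarrow> nat \<Rightarrow> nat set" where
  "star \<Gamma> v = {e \<in> hedges \<Gamma>. att \<Gamma> e = v}"

definition vtype :: "'e fgraph \<Rightarrow> nat \<Rightarrow> 'e \<Rightarrow> nat" where
  "vtype \<Gamma> v = (\<lambda>t. card {e \<in> star \<Gamma> v. htype \<Gamma> e = t})"

definition external :: "'e fgraph \<Rightarrow> nat set" where
  "external \<Gamma> = {e \<in> hedges \<Gamma>. invol \<Gamma> e = e}"

definition no_internal :: "'e fgraph \<Rightarrow> bool" where
  "no_internal \<Gamma> \<longleftrightarrow> external \<Gamma> = hedges \<Gamma>"

definition is_fgraph :: "'e ftheory \<Rightarrow> 'e fgraph \<Rightarrow> bool" where
  "is_fgraph T \<Gamma> \<longleftrightarrow>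
     finite (verts \<Gamma>) \<and> finite (hedges \<Gamma>) \<and>
     invol \<Gamma> \<in> hedges \<Gamma> \<rightarrow>\<^sub>E hedges \<Gamma> \<and> (\<forall>e\<in>hedges \<Gamma>. invol \<Gamma> (invol \<Gamma> e) = e) \<and>
     att \<Gamma> \<in> hedges \<Gamma> \<rightarrow>\<^sub>E verts \<Gamma> \<and>
     htype \<Gamma> \<in> hedges \<Gamma> \<rightarrow>\<^sub>E etypes T \<and>
     (\<forall>e\<in>hedges \<Gamma>. htype \<Gamma> (invol \<Gamma> e) = htype \<Gamma> e) \<and>
     vidx \<Gamma> \<in> extensional (verts \<Gamma>)"

definition in_theory :: "'e ftheory \<Rightarrow> 'e fgraph \<Rightarrow> bool" where
  "in_theory T \<Gamma> \<longleftrightarrow> (\<forall>v\<in>verts \<Gamma>. (vtype \<Gamma> v, vidx \<Gamma> v) \<in> rvtypes T)"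

definition graph_of :: "'e ftheory \<Rightarrow> 'e fgraph \<Rightarrow> bool" where
  "graph_of T \<Gamma> \<longleftrightarrow> is_fgraph T \<Gamma> \<and> in_theory T \<Gamma>"

definition graph_iso ::
  "(nat \<Rightarrow> nat) \<Rightarrow> (nat \<Rightarrow> nat) \<Rightarrow> 'e fgraph \<Rightarrow> 'e fgraph \<Rightarrow> bool" where
  "graph_iso f g \<Gamma> \<Gamma>' \<longleftrightarrow>
     bij_betw f (verts \<Gamma>) (verts \<Gamma>') \<and> bij_betw g (hedges \<Gamma>) (hedges \<Gamma>') \<and>
     (\<forall>e\<in>hedges \<Gamma>. g (invol \<Gamma> e) = invol \<Gamma>' (g e) \<and> f (att \<Gamma> e) = att \<Gamma>' (g e) \<and>
        htype \<Gamma>' (g e) = htype \<Gamma> e) \<and>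
     (\<forall>v\<in>verts \<Gamma>. vidx \<Gamma>' (f v) = vidx \<Gamma> v)"

text \<open>Connected components are represented by their vertex sets.\<close>

definition conn :: "'e fgraph \<Rightarrow> (nat \<times> nat) set" where
  "conn \<Gamma> = {(v, w). v \<in> verts \<Gamma> \<and> w \<in> verts \<Gamma> \<and>
     (v, w) \<in> {(att \<Gamma> e, att \<Gamma> (invol \<Gamma> e)) | e. e \<in> hedges \<Gamma>}\<^sup>*}"

definition gcomp :: "'e fgraph \<Rightarrow> nat \<Rightarrow> nat set" where
  "gcomp \<Gamma> v = conn \<Gamma> `` {v}"

definition gcomps :: "'e fgraph \<Rightarrow> nat set set" where
  "gcomps \<Gamma> = verts \<Gamma> // conn \<Gamma>"

definition comp_graph :: "'e fgraph \<Rightarrow> nat set \<Rightarrow> 'e fgraph" where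
  "comp_graph \<Gamma> C = (let E = {e \<in> hedges \<Gamma>. att \<Gamma> e \<in> C} in
     \<lparr>verts = C, hedges = E, invol = restrict (invol \<Gamma>) E, att = restrict (att \<Gamma>) E,
      htype = restrict (htype \<Gamma>) E, vidx = restrict (vidx \<Gamma>) C\<rparr>)"

definition cut :: "'e fgraph \<Rightarrow> nat set \<Rightarrow> 'e fgraph" where
  "cut \<Gamma> S = \<Gamma>\<lparr>invol := (\<lambda>e. if e \<in> S then e else invol \<Gamma> e)\<rparr>"

definition covering :: "'e fgraph \<Rightarrow> 'e fgraph \<Rightarrow> bool" where
  "covering \<gamma> \<Gamma> \<longleftrightarrow> (\<exists>S\<subseteq>hedges \<Gamma>. invol \<Gamma> ` S \<subseteq> S \<and> \<gamma> = cut \<Gamma> S)"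

definition gconnected :: "'e fgraph \<Rightarrow> bool" where
  "gconnected \<Gamma> \<longleftrightarrow> card (gcomps \<Gamma>) = 1"

definition one_PI :: "'e fgraph \<Rightarrow> bool" where
  "one_PI \<Gamma> \<longleftrightarrow> gconnected \<Gamma> \<and>
     (\<forall>e\<in>hedges \<Gamma> - external \<Gamma>. gconnected (cut \<Gamma> {e, invol \<Gamma> e}))"

definition locally_one_PI :: "'e fgraph \<Rightarrow> bool" where
  "locally_one_PI \<Gamma> \<longleftrightarrow> (\<forall>C\<in>gcomps \<Gamma>. one_PI (comp_graph \<Gamma> C))"

text \<open>
  The contraction of \<open>\<Gamma>\<close> by the covering subgraph \<open>\<gamma>\<close>, the vertex coming from a component \<open>C\<close> of
  \<open>\<gamma>\<close> getting the index \<open>j C\<close>. To stay within labels in \<open>nat\<close>, the vertex coming from \<open>C\<close> is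
  labelled by the least element of \<open>C\<close>.
\<close>

definition contract :: "'e fgraph \<Rightarrow> 'e fgraph \<Rightarrow> (nat set \<Rightarrow> nat) \<Rightarrow> 'e fgraph" where
  "contract \<Gamma> \<gamma> j =
     \<lparr>verts = Min ` gcomps \<gamma>, hedges = external \<gamma>,
      invol = restrict (invol \<Gamma>) (external \<gamma>),
      att = restrict (\<lambda>e. Min (gcomp \<gamma> (att \<gamma> e))) (external \<gamma>),
      htype = restrict (htype \<Gamma>) (external \<gamma>),
      vidx = restrict (\<lambda>v. j (gcomp \<gamma> v)) (Min ` gcomps \<gamma>)\<rparr>"

text \<open>
  The type of the vertex \<open>res \<Gamma>\<^sub>0 = \<Gamma>\<^sub>0 / \<Gamma>\<^sub>0\<close>, for \<open>\<Gamma>\<^sub>0\<close> the component \<open>C\<close> of \<open>\<Gamma>\<close>. The type does not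
  depend on the index given to the contracted vertex, for which \<open>0\<close> is a dummy value.
\<close>

definition res :: "'e fgraph \<Rightarrow> 'e fgraph" where
  "res \<Gamma> = contract \<Gamma> \<Gamma> (\<lambda>_. 0)"

definition res_type :: "'e fgraph \<Rightarrow> nat set \<Rightarrow> 'e \<Rightarrow> nat" where
  "res_type \<Gamma> C = vtype (res (comp_graph \<Gamma> C)) (Min C)"

definition superficially_divergent :: "'e ftheory \<Rightarrow> 'e fgraph \<Rightarrow> bool" where
  "superficially_divergent T \<Gamma> \<longleftrightarrow> (\<forall>C\<in>gcomps \<Gamma>. res_type \<Gamma> C \<in> vtypes T)"

definition empty_graph :: "'e fgraph" where
  "empty_graph = \<lparr>verts = {}, hedges = {}, invol = (\<lambda>_. undefined), att = (\<lambda>_. undefined),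
     htype = (\<lambda>_. undefined), vidx = (\<lambda>_. undefined)\<rparr>"

text \<open>
  The disjoint union is the union of graphs with disjoint labels; any two graphs are isomorphic
  to such ones.
\<close>

definition gdisjoint :: "'e fgraph \<Rightarrow> 'e fgraph \<Rightarrow> bool" where
  "gdisjoint \<Gamma> \<Gamma>' \<longleftrightarrow> verts \<Gamma> \<inter> verts \<Gamma>' = {} \<and> hedges \<Gamma> \<inter> hedges \<Gamma>' = {}"

definition gunion :: "'e fgraph \<Rightarrow> 'e fgraph \<Rightarrow> 'e fgraph" where
  "gunion \<Gamma> \<Gamma>' =
     \<lparr>verts = verts \<Gamma> \<union> verts \<Gamma>', hedges = hedges \<Gamma> \<union> hedges \<Gamma>',
      invol = (\<lambda>e. if e \<in> hedges \<Gamma> then invol \<Gamma> e else invol \<Gamma>' e),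
      att = (\<lambda>e. if e \<in> hedges \<Gamma> then att \<Gamma> e else att \<Gamma>' e),
      htype = (\<lambda>e. if e \<in> hedges \<Gamma> then htype \<Gamma> e else htype \<Gamma>' e),
      vidx = (\<lambda>v. if v \<in> verts \<Gamma> then vidx \<Gamma> v else vidx \<Gamma>' v)\<rparr>"


section \<open>Specified graphs\<close>

type_synonym 'e sgraph = "'e fgraph \<times> (nat set \<Rightarrow> nat)"

definition specified :: "'e ftheory \<Rightarrow> 'e sgraph \<Rightarrow> bool" where
  "specified T = (\<lambda>(\<Gamma>, i).
     graph_of T \<Gamma> \<and> locally_one_PI \<Gamma> \<and> superficially_divergent T \<Gamma> \<and>
     i \<in> extensional (gcomps \<Gamma>) \<and>
     (\<forall>C\<in>gcomps \<Gamma>. (res_type \<Gamma> C, i C) \<in> rvtypes T) \<and>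
     (\<forall>v. {v} \<in> gcomps \<Gamma> \<and> no_internal (comp_graph \<Gamma> {v}) \<longrightarrow> i {v} = vidx \<Gamma> v))"

text \<open>A component of \<open>\<gamma>\<close> is a full component of \<open>\<Gamma>\<close> iff both induce the same graph.\<close>

definition spec_covering :: "'e ftheory \<Rightarrow> 'e sgraph \<Rightarrow> 'e sgraph \<Rightarrow> bool" where
  "spec_covering T = (\<lambda>(\<gamma>, j) (\<Gamma>, i).
     specified T (\<gamma>, j) \<and> specified T (\<Gamma>, i) \<and> covering \<gamma> \<Gamma> \<and>
     (\<forall>C\<in>gcomps \<gamma> \<inter> gcomps \<Gamma>. comp_graph \<gamma> C = comp_graph \<Gamma> C \<longrightarrow> j C = i C))"

text \<open>
  The specification of \<open>\<Gamma>/\<gamma>\<close> is that of \<open>\<Gamma>\<close>, transported along the bijection between the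
  components of \<open>\<Gamma>/\<gamma>\<close> and those of \<open>\<Gamma>\<close>: as vertices of \<open>\<Gamma>/\<gamma>\<close> are labelled by vertices of \<open>\<Gamma>\<close>, the
  component of \<open>\<Gamma>\<close> corresponding to \<open>C'\<close> is the one containing \<open>C'\<close>.
\<close>

definition spec_contract :: "'e sgraph \<Rightarrow> 'e sgraph \<Rightarrow> 'e sgraph" where
  "spec_contract = (\<lambda>(\<Gamma>, i) (\<gamma>, j).
     (contract \<Gamma> \<gamma> j,
      restrict (\<lambda>C'. i (THE C. C \<in> gcomps \<Gamma> \<and> C' \<subseteq> C)) (gcomps (contract \<Gamma> \<gamma> j))))"

definition sempty :: "'e sgraph" where
  "sempty = (empty_graph, \<lambda>_. undefined)"

definition sunion :: "'e sgraph \<Rightarrow> 'e sgraph \<Rightarrow> 'e sgraph" where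
  "sunion = (\<lambda>(\<Gamma>, i) (\<Gamma>', i'). (gunion \<Gamma> \<Gamma>', \<lambda>C. if C \<in> gcomps \<Gamma> then i C else i' C))"

text \<open>The vector space spanned by the specified graphs.\<close>

definition Hspace :: "'e ftheory \<Rightarrow> ('e sgraph \<Rightarrow>\<^sub>0 complex) set" where
  "Hspace T = {x. \<forall>s\<in>Poly_Mapping.keys x. specified T s}"

abbreviation basis :: "'e sgraph \<Rightarrow> ('e sgraph \<Rightarrow>\<^sub>0 complex)" where
  "basis s \<equiv> Poly_Mapping.single s 1"


section \<open>Momentum spaces and function spaces\<close>

text \<open>
  Momenta are extended by \<open>0\<close> to all of \<open>nat\<close>; then \<open>W \<Gamma>\<close> is a finite-dimensional vector space
  of functions, whose product topology is the Euclidean one. Functions on \<open>W \<Gamma>\<close> are extended by \<open>0\<close>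
  as well.
\<close>

type_synonym 'd momenta = "nat \<Rightarrow> real ^ 'd"

definition W :: "'e fgraph \<Rightarrow> ('d::finite) momenta set" where
  "W \<Gamma> = {p. (\<forall>e. e \<notin> hedges \<Gamma> \<longrightarrow> p e = 0) \<and>
     (\<forall>v\<in>verts \<Gamma>. (\<Sum>e\<in>star \<Gamma> v. p e) = 0) \<and>
     (\<forall>e\<in>hedges \<Gamma>. e \<noteq> invol \<Gamma> e \<longrightarrow> p e + p (invol \<Gamma> e) = 0)}"

definition on_W :: "'e fgraph \<Rightarrow> (('d::finite) momenta \<Rightarrow> complex) \<Rightarrow> 'd momenta \<Rightarrow> complex" where
  "on_W \<Gamma> f = (\<lambda>p. if p \<in> W \<Gamma> then f p else 0)"

definition mom_restrict :: "nat set \<Rightarrow> ('d::finite) momenta \<Rightarrow> 'd momenta" where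
  "mom_restrict E p = (\<lambda>e. if e \<in> E then p e else 0)"

text \<open>
  Continuous differentiability of order \<open>n\<close> on a linear subspace \<open>X\<close> of the momenta: all iterated
  directional derivatives along \<open>X\<close> of order at most \<open>n\<close> exist and are continuous.
\<close>

primrec Ck_on :: "nat \<Rightarrow> ('d::finite) momenta set \<Rightarrow> ('d momenta \<Rightarrow> complex) \<Rightarrow> bool" where
  "Ck_on 0 X f \<longleftrightarrow> continuous_on X f"
| "Ck_on (Suc n) X f \<longleftrightarrow> continuous_on X f \<and>
     (\<forall>w\<in>X. \<exists>g. (\<forall>p\<in>X. ((\<lambda>t. f (\<lambda>e. p e + t *\<^sub>R w e)) has_vector_derivative g p) (at 0)) \<and>
        Ck_on n X g)"

definition smooth_on :: "('d::finite) momenta set \<Rightarrow> ('d momenta \<Rightarrow> complex) \<Rightarrow> bool" where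
  "smooth_on X f \<longleftrightarrow> (\<forall>n. Ck_on n X f)"

text \<open>
  The algebraic tensor product over the components, as a space of functions on \<open>W \<Gamma>\<close>: finite
  linear combinations of products of smooth functions of the momenta of the single components.
  For \<open>\<Gamma>\<close> connected these are all smooth functions on \<open>W \<Gamma>\<close>, for \<open>\<Gamma>\<close> empty the constants. The
  coefficients \<open>c\<close> are needed in the empty case only.
\<close>

definition V :: "'e fgraph \<Rightarrow> (('d::finite) momenta \<Rightarrow> complex) set" where
  "V \<Gamma> = {on_W \<Gamma> (\<lambda>p. \<Sum>k<n. c k *
            (\<Prod>C\<in>gcomps \<Gamma>. u k C (mom_restrict (hedges (comp_graph \<Gamma> C)) p))) | (n::nat) c u.
          \<forall>k<n. \<forall>C\<in>gcomps \<Gamma>. smooth_on (W (comp_graph \<Gamma> C)) (u k C)}"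

definition Bspace :: "'e ftheory \<Rightarrow> ('e fgraph \<Rightarrow> ('d::finite) momenta \<Rightarrow> complex) set" where
  "Bspace T = {b. (\<forall>\<Gamma>. graph_of T \<Gamma> \<longrightarrow> b \<Gamma> \<in> V \<Gamma>) \<and> (\<forall>\<Gamma>. \<not> graph_of T \<Gamma> \<longrightarrow> b \<Gamma> = (\<lambda>_. 0))}"

definition concat ::
  "'e fgraph \<Rightarrow> 'e fgraph \<Rightarrow> (('d::finite) momenta \<Rightarrow> complex) \<Rightarrow> ('d momenta \<Rightarrow> complex) \<Rightarrow>
   'd momenta \<Rightarrow> complex" where
  "concat \<Gamma> \<Gamma>' v v' = on_W (gunion \<Gamma> \<Gamma>')
     (\<lambda>p. v (mom_restrict (hedges \<Gamma>) p) * v' (mom_restrict (hedges \<Gamma>') p))"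

text \<open>
  The bilinear extension of the concatenation product to the product of all \<open>V \<Gamma>\<close>; the sum runs
  over the finitely many ways to write \<open>\<Gamma>\<close> as a disjoint union.
\<close>

definition Bmult ::
  "'e ftheory \<Rightarrow> ('e fgraph \<Rightarrow> ('d::finite) momenta \<Rightarrow> complex) \<Rightarrow>
   ('e fgraph \<Rightarrow> 'd momenta \<Rightarrow> complex) \<Rightarrow> 'e fgraph \<Rightarrow> 'd momenta \<Rightarrow> complex" where
  "Bmult T b b' \<Gamma> = (\<lambda>p. \<Sum>(\<Gamma>1, \<Gamma>2)\<in>{(\<Gamma>1, \<Gamma>2). graph_of T \<Gamma>1 \<and> graph_of T \<Gamma>2 \<and>
     gdisjoint \<Gamma>1 \<Gamma>2 \<and> gunion \<Gamma>1 \<Gamma>2 = \<Gamma>}. concat \<Gamma>1 \<Gamma>2 (b \<Gamma>1) (b' \<Gamma>2) p)"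

text \<open>The inclusion of the factor \<open>V \<Gamma>\<close> into the product.\<close>

definition Bincl ::
  "'e fgraph \<Rightarrow> (('d::finite) momenta \<Rightarrow> complex) \<Rightarrow> 'e fgraph \<Rightarrow> 'd momenta \<Rightarrow> complex" where
  "Bincl \<Gamma> v = (\<lambda>\<Gamma>'. if \<Gamma>' = \<Gamma> then v else (\<lambda>_. 0))"

definition Vone :: "'e fgraph \<Rightarrow> ('d::finite) momenta \<Rightarrow> complex" where
  "Vone \<Gamma> = on_W \<Gamma> (\<lambda>_. 1)"

definition Bone :: "'e fgraph \<Rightarrow> ('d::finite) momenta \<Rightarrow> complex" where
  "Bone = Bincl empty_graph (Vone (empty_graph :: 'e fgraph))"

text \<open>Pullback along the restriction of momenta from \<open>W \<Gamma>\<close> to the contracted graph \<open>\<Gamma>'\<close>.\<close>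

definition i_map ::
  "'e fgraph \<Rightarrow> 'e fgraph \<Rightarrow> (('d::finite) momenta \<Rightarrow> complex) \<Rightarrow> 'd momenta \<Rightarrow> complex" where
  "i_map \<Gamma> \<Gamma>' v = on_W \<Gamma> (\<lambda>p. v (mom_restrict (hedges \<Gamma>') p))"

text \<open>Pullback along the inclusion of \<open>W \<Gamma>\<close> into \<open>W \<gamma>\<close>, \<open>\<gamma>\<close> a covering subgraph of \<open>\<Gamma>\<close>.\<close>

definition pi_map ::
  "'e fgraph \<Rightarrow> (('d::finite) momenta \<Rightarrow> complex) \<Rightarrow> 'd momenta \<Rightarrow> complex" where
  "pi_map \<Gamma> v = on_W \<Gamma> v"


section \<open>Linear maps and convolution\<close>

type_synonym ('e, 'd) lmap =
  "('e sgraph \<Rightarrow>\<^sub>0 complex) \<Rightarrow> 'e fgraph \<Rightarrow> 'd momenta \<Rightarrow> complex"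

definition linear_HB :: "'e ftheory \<Rightarrow> ('e, 'd::finite) lmap \<Rightarrow> bool" where
  "linear_HB T \<phi> \<longleftrightarrow> \<phi> \<in> Hspace T \<rightarrow>\<^sub>E Bspace T \<and>
     (\<forall>x\<in>Hspace T. \<forall>y\<in>Hspace T. \<phi> (x + y) = (\<lambda>\<Gamma> p. \<phi> x \<Gamma> p + \<phi> y \<Gamma> p)) \<and>
     (\<forall>c. \<forall>x\<in>Hspace T. \<phi> (Poly_Mapping.map ((*) c) x) = (\<lambda>\<Gamma> p. c * \<phi> x \<Gamma> p))"

text \<open>The value of \<open>\<phi>\<close> at a specified graph, as an element of \<open>V \<Gamma>\<close>.\<close>

definition val :: "('e, 'd::finite) lmap \<Rightarrow> 'e sgraph \<Rightarrow> 'd momenta \<Rightarrow> complex" where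
  "val \<phi> s = \<phi> (basis s) (fst s)"

definition Ltilde :: "'e ftheory \<Rightarrow> ('e, 'd::finite) lmap set" where
  "Ltilde T = {\<phi>. linear_HB T \<phi> \<and>
     (\<forall>\<Gamma> i i'. specified T (\<Gamma>, i) \<and> specified T (\<Gamma>, i') \<longrightarrow>
        \<phi> (basis (\<Gamma>, i)) = \<phi> (basis (\<Gamma>, i'))) \<and>
     (\<forall>\<Gamma> i. specified T (\<Gamma>, i) \<longrightarrow> (\<exists>v\<in>V \<Gamma>. \<phi> (basis (\<Gamma>, i)) = Bincl \<Gamma> v)) \<and>
     (\<forall>\<Gamma> i. specified T (\<Gamma>, i) \<and> no_internal \<Gamma> \<longrightarrow> \<phi> (basis (\<Gamma>, i)) = Bincl \<Gamma> (Vone \<Gamma>)) \<and>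
     (\<forall>\<Gamma> i \<Gamma>' i' f g. specified T (\<Gamma>, i) \<and> specified T (\<Gamma>', i') \<and> graph_iso f g \<Gamma> \<Gamma>' \<longrightarrow>
        (\<forall>p\<in>W \<Gamma>'. val \<phi> (\<Gamma>', i') p = val \<phi> (\<Gamma>, i) (mom_restrict (hedges \<Gamma>) (p \<circ> g))))}"

definition conv_basis ::
  "'e ftheory \<Rightarrow> ('e, 'd::finite) lmap \<Rightarrow> ('e, 'd) lmap \<Rightarrow> 'e sgraph \<Rightarrow> 'd momenta \<Rightarrow> complex"
where
  "conv_basis T \<phi> \<psi> s = (\<lambda>p.
     \<Sum>s'\<in>{s'. spec_covering T s' s \<and> in_theory T (fst (spec_contract s s'))}.
       pi_map (fst s) (val \<phi> s') p *
       i_map (fst s) (fst (spec_contract s s')) (val \<psi> (spec_contract s s')) p)"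

definition conv :: "'e ftheory \<Rightarrow> ('e, 'd::finite) lmap \<Rightarrow> ('e, 'd) lmap \<Rightarrow> ('e, 'd) lmap" where
  "conv T \<phi> \<psi> = (\<lambda>x\<in>Hspace T. \<lambda>\<Gamma> p.
     \<Sum>s\<in>Poly_Mapping.keys x. Poly_Mapping.lookup x s * Bincl (fst s) (conv_basis T \<phi> \<psi> s) \<Gamma> p)"

definition Gset :: "'e ftheory \<Rightarrow> ('e, 'd::finite) lmap set" where
  "Gset T = {\<phi> \<in> Ltilde T.
     (\<forall>s s'. specified T s \<and> specified T s' \<and> gdisjoint (fst s) (fst s') \<longrightarrow>
        \<phi> (basis (sunion s s')) = Bmult T (\<phi> (basis s)) (\<phi> (basis s'))) \<and>
     \<phi> (basis sempty) = Bone}"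

end

theory Submission
  imports Defs
begin

text \<open>
  An element of \<open>Gset\<close> is determined by its values on specified graphs, and these are the functions that are
  smooth, normalised, compatible with isomorphisms and multiplicative. Associativity is a bijection between
  chains \<open>\<delta> \<subset> \<gamma> \<subset> \<Gamma>\<close> and pairs of \<open>\<delta> \<subset> \<Gamma>\<close> with a covering of \<open>\<Gamma>/\<delta>\<close>, via \<open>\<gamma> \<mapsto> \<gamma>/\<delta>\<close> and
  \<open>(\<Gamma>/\<delta>)/(\<gamma>/\<delta>) = \<Gamma>/\<gamma>\<close>. Local 1PI-ness is the absence of bridges, which passes to contractions and to
  extensions because the components of \<open>\<Gamma>/\<gamma>\<close> are those of \<open>\<Gamma>\<close>. The specification of \<open>\<Gamma>\<close> enters a
  convolution only through refined types of vertices without internal edges, which multiplicative functions do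
  not see. A left inverse is built by recursion on the number of internal edges; since the convolution of two
  functions on \<open>\<Gamma>\<close> involves the value of the left one at \<open>\<Gamma>\<close> with coefficient 1, each property of the
  inverse follows from the corresponding property of the unit.
\<close>

section \<open>Connectivity, coverings and bridges of labelled graphs\<close>

section \<open>Connectivity\<close>

text \<open>The specification of a covering is tied down in two ways: on full components it equals
  the given one, on vertices without internal edges it equals the vertex index. These are one
  condition seen before and after contraction, because a component of \<gamma> is full exactly when
  it becomes a vertex of \<Gamma>/\<gamma> without internal edges. This equivalence lets coverings
  of a contraction be lifted to coverings of the graph. The obstacle to invariance is that two
  specifications of one graph have different sets of coverings. Independence of the specification is
  treated as compatibility with the identity isomorphism, and coverings move along an isomorphism by
  a transfer that keeps the cut but takes the indices on full components from the target. Graphs are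
  labelled, so iterated contraction has to give equal graphs and not merely isomorphic ones; naming
  a contracted vertex by the least vertex of its component achieves this, as the minimum of a union
  of blocks is the least of their minima. Only a left unit and left inverses are constructed, which
  suffices for a group.\<close>

lemma is_fgraphD:
  assumes "is_fgraph T \<Gamma>"
  shows fg_finite_verts: "finite (verts \<Gamma>)" and fg_finite_hedges: "finite (hedges \<Gamma>)"
    and fg_invol_in: "\<And>e. e \<in> hedges \<Gamma> \<Longrightarrow> invol \<Gamma> e \<in> hedges \<Gamma>"
    and fg_invol_invol: "\<And>e. e \<in> hedges \<Gamma> \<Longrightarrow> invol \<Gamma> (invol \<Gamma> e) = e"
    and fg_att_in: "\<And>e. e \<in> hedges \<Gamma> \<Longrightarrow> att \<Gamma> e \<in> verts \<Gamma>"
    and fg_htype_in: "\<And>e. e \<in> hedges \<Gamma> \<Longrightarrow> htype \<Gamma> e \<in> etypes T"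
    and fg_htype_invol: "\<And>e. e \<in> hedges \<Gamma> \<Longrightarrow> htype \<Gamma> (invol \<Gamma> e) = htype \<Gamma> e"
    and fg_invol_ext: "invol \<Gamma> \<in> extensional (hedges \<Gamma>)"
    and fg_att_ext: "att \<Gamma> \<in> extensional (hedges \<Gamma>)"
    and fg_htype_ext: "htype \<Gamma> \<in> extensional (hedges \<Gamma>)"
    and fg_vidx_ext: "vidx \<Gamma> \<in> extensional (verts \<Gamma>)"
  using assms by (auto simp: is_fgraph_def PiE_def)

lemma is_fgraphI:
  assumes "finite (verts \<Gamma>)" "finite (hedges \<Gamma>)"
    "\<And>e. e \<in> hedges \<Gamma> \<Longrightarrow> invol \<Gamma> e \<in> hedges \<Gamma>"
    "\<And>e. e \<in> hedges \<Gamma> \<Longrightarrow> invol \<Gamma> (invol \<Gamma> e) = e"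
    "\<And>e. e \<in> hedges \<Gamma> \<Longrightarrow> att \<Gamma> e \<in> verts \<Gamma>"
    "\<And>e. e \<in> hedges \<Gamma> \<Longrightarrow> htype \<Gamma> e \<in> etypes T"
    "\<And>e. e \<in> hedges \<Gamma> \<Longrightarrow> htype \<Gamma> (invol \<Gamma> e) = htype \<Gamma> e"
    "invol \<Gamma> \<in> extensional (hedges \<Gamma>)" "att \<Gamma> \<in> extensional (hedges \<Gamma>)"
    "htype \<Gamma> \<in> extensional (hedges \<Gamma>)" "vidx \<Gamma> \<in> extensional (verts \<Gamma>)"
  shows "is_fgraph T \<Gamma>"
  using assms by (auto simp: is_fgraph_def PiE_def)

lemma fgraph_eqI:
  assumes "is_fgraph T \<Gamma>" "is_fgraph T' \<Delta>" "verts \<Gamma> = verts \<Delta>" "hedges \<Gamma> = hedges \<Delta>"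
    "\<And>e. e \<in> hedges \<Delta> \<Longrightarrow> invol \<Gamma> e = invol \<Delta> e"
    "\<And>e. e \<in> hedges \<Delta> \<Longrightarrow> att \<Gamma> e = att \<Delta> e"
    "\<And>e. e \<in> hedges \<Delta> \<Longrightarrow> htype \<Gamma> e = htype \<Delta> e"
    "\<And>v. v \<in> verts \<Delta> \<Longrightarrow> vidx \<Gamma> v = vidx \<Delta> v"
  shows "\<Gamma> = \<Delta>"
proof -
  note a = is_fgraphD[OF assms(1)] and b = is_fgraphD[OF assms(2)]
  have "invol \<Gamma> = invol \<Delta>" "att \<Gamma> = att \<Delta>" "htype \<Gamma> = htype \<Delta>" "vidx \<Gamma> = vidx \<Delta>"
    using a(8-11) b(8-11) assms(3-8) by (metis extensionalityI)+
  then show ?thesis using assms(3,4) by simp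
qed

text \<open>On a graph, \<open>conn\<close> is the least transitive relation that is reflexive on
  the vertices and contains every edge. Upper bounds for connectivity are obtained below by choosing
  a suitable \<open>R\<close> instead of inducting on paths.\<close>

lemma conn_subsetI:
  assumes "\<And>v. v \<in> verts \<Gamma> \<Longrightarrow> (v, v) \<in> R" "trans R"
    "\<And>e. e \<in> hedges \<Gamma> \<Longrightarrow> (att \<Gamma> e, att \<Gamma> (invol \<Gamma> e)) \<in> R"
  shows "conn \<Gamma> \<subseteq> R"
proof
  fix x assume "x \<in> conn \<Gamma>"
  then obtain v w where x: "x = (v, w)" and v: "v \<in> verts \<Gamma>"
    and st: "(v, w) \<in> {(att \<Gamma> e, att \<Gamma> (invol \<Gamma> e)) | e. e \<in> hedges \<Gamma>}\<^sup>*"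
    by (auto simp: conn_def)
  from st have "(v, w) \<in> R"
  proof (induction rule: rtrancl_induct)
    case base then show ?case using assms(1) v by simp
  next
    case (step y z)
    then have "(y, z) \<in> R" using assms(3) by auto
    then show ?case using step.IH assms(2) by (meson transD)
  qed
  then show "x \<in> R" using x by simp
qed

lemma conn_in: "(v, w) \<in> conn \<Gamma> \<Longrightarrow> v \<in> verts \<Gamma>" "(v, w) \<in> conn \<Gamma> \<Longrightarrow> w \<in> verts \<Gamma>"
  by (auto simp: conn_def)

lemma conn_refl: "v \<in> verts \<Gamma> \<Longrightarrow> (v, v) \<in> conn \<Gamma>"
  by (auto simp: conn_def)

lemma conn_trans: "(u, v) \<in> conn \<Gamma> \<Longrightarrow> (v, w) \<in> conn \<Gamma> \<Longrightarrow> (u, w) \<in> conn \<Gamma>"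
  by (auto simp: conn_def intro: rtrancl_trans)

lemma trans_conn: "trans (conn \<Gamma>)"
  by (meson conn_trans transI)

lemma conn_edge:
  assumes "is_fgraph T \<Gamma>" "e \<in> hedges \<Gamma>"
  shows "(att \<Gamma> e, att \<Gamma> (invol \<Gamma> e)) \<in> conn \<Gamma>"
  using fg_att_in[OF assms(1)] fg_invol_in[OF assms(1)] assms(2) by (auto simp: conn_def)

text \<open>The involution supplies the reverse of each edge, so directed reachability is already
  symmetric.\<close>

lemma conn_sym:
  assumes "is_fgraph T \<Gamma>" "(v, w) \<in> conn \<Gamma>"
  shows "(w, v) \<in> conn \<Gamma>"
proof -
  have "conn \<Gamma> \<subseteq> (conn \<Gamma>)\<inverse>"
  proof (rule conn_subsetI)
    show "trans ((conn \<Gamma>)\<inverse>)" using trans_conn by (simp add: trans_def) blast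
    fix e assume e: "e \<in> hedges \<Gamma>"
    show "(att \<Gamma> e, att \<Gamma> (invol \<Gamma> e)) \<in> (conn \<Gamma>)\<inverse>"
      using conn_edge[OF assms(1) fg_invol_in[OF assms(1) e]] fg_invol_invol[OF assms(1) e] by simp
  qed (auto intro: conn_refl)
  then show ?thesis using assms(2) by auto
qed

lemma gcomp_iff: "w \<in> gcomp \<Gamma> v \<longleftrightarrow> (v, w) \<in> conn \<Gamma>"
  by (simp add: gcomp_def)

lemma gcomps_eq: "gcomps \<Gamma> = gcomp \<Gamma> ` verts \<Gamma>"
  by (auto simp: gcomps_def quotient_def gcomp_def)

lemma gcomp_self: "v \<in> verts \<Gamma> \<Longrightarrow> v \<in> gcomp \<Gamma> v"
  by (simp add: gcomp_iff conn_refl)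

lemma gcomp_subset: "gcomp \<Gamma> v \<subseteq> verts \<Gamma>"
  by (auto simp: gcomp_iff dest: conn_in)

lemma gcomp_finite: "is_fgraph T \<Gamma> \<Longrightarrow> finite (gcomp \<Gamma> v)"
  by (meson gcomp_subset fg_finite_verts finite_subset)

lemma finite_gcomps: "is_fgraph T \<Gamma> \<Longrightarrow> finite (gcomps \<Gamma>)"
  by (simp add: gcomps_eq fg_finite_verts)

lemma gcomp_eqI:
  assumes "is_fgraph T \<Gamma>" "(v, w) \<in> conn \<Gamma>"
  shows "gcomp \<Gamma> v = gcomp \<Gamma> w"
  using assms conn_sym[OF assms] by (auto simp: gcomp_iff intro: conn_trans)

lemma gcomp_eq_iff:
  assumes "is_fgraph T \<Gamma>" "v \<in> verts \<Gamma>"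
  shows "gcomp \<Gamma> v = gcomp \<Gamma> w \<longleftrightarrow> (v, w) \<in> conn \<Gamma>"
proof
  assume "gcomp \<Gamma> v = gcomp \<Gamma> w"
  then have "(w, v) \<in> conn \<Gamma>" using gcomp_self[OF assms(2)] by (simp add: gcomp_iff)
  then show "(v, w) \<in> conn \<Gamma>" by (rule conn_sym[OF assms(1)])
qed (rule gcomp_eqI[OF assms(1)])

lemma gcomps_disjoint:
  assumes "is_fgraph T \<Gamma>" "C \<in> gcomps \<Gamma>" "D \<in> gcomps \<Gamma>" "x \<in> C" "x \<in> D"
  shows "C = D"
  using assms unfolding gcomps_eq
  by (metis (no_types, lifting) gcomp_eqI gcomp_iff image_iff)

lemma gcomps_conn:
  assumes "is_fgraph T \<Gamma>" "C \<in> gcomps \<Gamma>" "x \<in> C" "y \<in> C"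
  shows "(x, y) \<in> conn \<Gamma>"
proof -
  obtain v where "(v, x) \<in> conn \<Gamma>" "(v, y) \<in> conn \<Gamma>"
    using assms(2-4) by (auto simp: gcomps_eq gcomp_iff)
  then show ?thesis using conn_sym[OF assms(1)] conn_trans by metis
qed

text \<open>The label that \<open>contract\<close> gives to the component of v. Comparing vertices
  by \<open>vmin\<close> avoids handling components as sets.\<close>

definition vmin :: "'e fgraph \<Rightarrow> nat \<Rightarrow> nat" where
  "vmin \<gamma> v = Min (gcomp \<gamma> v)"

lemma vmin_conn:
  assumes "is_fgraph T \<gamma>" "v \<in> verts \<gamma>"
  shows "(v, vmin \<gamma> v) \<in> conn \<gamma>"
proof -
  have "vmin \<gamma> v \<in> gcomp \<gamma> v"
    unfolding vmin_def using gcomp_self[OF assms(2)] gcomp_finite[OF assms(1), of v]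
    by (metis Min_in empty_iff)
  then show ?thesis by (simp add: gcomp_iff)
qed

lemma vmin_in: "is_fgraph T \<gamma> \<Longrightarrow> v \<in> verts \<gamma> \<Longrightarrow> vmin \<gamma> v \<in> verts \<gamma>"
  by (meson vmin_conn conn_in(2))

lemma gcomp_vmin: "is_fgraph T \<gamma> \<Longrightarrow> v \<in> verts \<gamma> \<Longrightarrow> gcomp \<gamma> (vmin \<gamma> v) = gcomp \<gamma> v"
  using vmin_conn gcomp_eqI by metis

lemma vmin_eq_iff:
  assumes "is_fgraph T \<gamma>" "v \<in> verts \<gamma>" "w \<in> verts \<gamma>"
  shows "vmin \<gamma> v = vmin \<gamma> w \<longleftrightarrow> (v, w) \<in> conn \<gamma>"
  by (metis assms gcomp_eq_iff gcomp_vmin vmin_def)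

lemma Min_gcomps: "Min ` gcomps \<gamma> = vmin \<gamma> ` verts \<gamma>"
  by (auto simp: gcomps_eq vmin_def)

subsection \<open>Components\<close>

text \<open>In a graph, these are the unions of connected components. Single components, the parts
  of a disjoint union and the set of vertices without internal edges are all of this kind, so the
  same restriction lemmas serve them all.\<close>

definition closed_in :: "'e fgraph \<Rightarrow> nat set \<Rightarrow> bool" where
  "closed_in \<Gamma> U \<longleftrightarrow> U \<subseteq> verts \<Gamma> \<and> (\<forall>e\<in>hedges \<Gamma>. att \<Gamma> e \<in> U \<longrightarrow> att \<Gamma> (invol \<Gamma> e) \<in> U)"

lemma comp_graph_simps [simp]:
  "verts (comp_graph \<Gamma> U) = U"
  "hedges (comp_graph \<Gamma> U) = {e \<in> hedges \<Gamma>. att \<Gamma> e \<in> U}"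
  "e \<in> hedges \<Gamma> \<Longrightarrow> att \<Gamma> e \<in> U \<Longrightarrow> invol (comp_graph \<Gamma> U) e = invol \<Gamma> e"
  "e \<in> hedges \<Gamma> \<Longrightarrow> att \<Gamma> e \<in> U \<Longrightarrow> att (comp_graph \<Gamma> U) e = att \<Gamma> e"
  "e \<in> hedges \<Gamma> \<Longrightarrow> att \<Gamma> e \<in> U \<Longrightarrow> htype (comp_graph \<Gamma> U) e = htype \<Gamma> e"
  "v \<in> U \<Longrightarrow> vidx (comp_graph \<Gamma> U) v = vidx \<Gamma> v"
  by (auto simp: comp_graph_def Let_def)

lemma is_fgraph_comp_graph:
  assumes "is_fgraph T \<Gamma>" "closed_in \<Gamma> U"
  shows "is_fgraph T (comp_graph \<Gamma> U)"
proof (rule is_fgraphI)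
  show "finite (verts (comp_graph \<Gamma> U))"
    using assms fg_finite_verts[OF assms(1)] by (auto simp: closed_in_def intro: finite_subset)
  show "finite (hedges (comp_graph \<Gamma> U))"
    using fg_finite_hedges[OF assms(1)] by simp
qed (use assms in \<open>auto simp: closed_in_def fg_invol_in fg_invol_invol fg_htype_in fg_htype_invol\<close>,
     auto simp: comp_graph_def Let_def)

lemma conn_comp_graph:
  assumes "is_fgraph T \<Gamma>" "closed_in \<Gamma> U"
  shows "conn (comp_graph \<Gamma> U) = conn \<Gamma> \<inter> U \<times> U"
proof
  have cl: "e \<in> hedges \<Gamma> \<Longrightarrow> att \<Gamma> e \<in> U \<Longrightarrow> att \<Gamma> (invol \<Gamma> e) \<in> U" for e
    using assms(2) by (auto simp: closed_in_def)
  have U: "U \<subseteq> verts \<Gamma>" using assms(2) by (auto simp: closed_in_def)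
  show "conn (comp_graph \<Gamma> U) \<subseteq> conn \<Gamma> \<inter> U \<times> U"
  proof (rule conn_subsetI)
    show "trans (conn \<Gamma> \<inter> U \<times> U)"
      using trans_conn[of \<Gamma>] unfolding trans_def by blast
  qed (use U cl assms(1) in \<open>auto intro: conn_refl conn_edge simp: fg_invol_in\<close>)
  \<comment> \<open>The implication makes the bound vacuous for paths that start outside U, so it
    holds for all edges of \<Gamma> and is still transitive.\<close>
  have "conn \<Gamma> \<subseteq> {(v, w). v \<in> U \<longrightarrow> w \<in> U \<and> (v, w) \<in> conn (comp_graph \<Gamma> U)}"
  proof (rule conn_subsetI)
    show "trans {(v, w). v \<in> U \<longrightarrow> w \<in> U \<and> (v, w) \<in> conn (comp_graph \<Gamma> U)}"
      using trans_conn[of "comp_graph \<Gamma> U"] unfolding trans_def by blast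
    fix e assume e: "e \<in> hedges \<Gamma>"
    show "(att \<Gamma> e, att \<Gamma> (invol \<Gamma> e))
        \<in> {(v, w). v \<in> U \<longrightarrow> w \<in> U \<and> (v, w) \<in> conn (comp_graph \<Gamma> U)}"
      using conn_edge[OF is_fgraph_comp_graph[OF assms], of e] cl e fg_invol_in[OF assms(1) e]
      by auto
  qed (auto intro: conn_refl)
  then show "conn \<Gamma> \<inter> U \<times> U \<subseteq> conn (comp_graph \<Gamma> U)" by blast
qed

lemma closed_in_conn:
  assumes "closed_in \<Gamma> U" "(v, w) \<in> conn \<Gamma>" "v \<in> U"
  shows "w \<in> U"
proof -
  have "conn \<Gamma> \<subseteq> {(v, w). v \<in> U \<longrightarrow> w \<in> U}"
    by (rule conn_subsetI) (use assms(1) in \<open>auto simp: closed_in_def intro: transI\<close>)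
  then show ?thesis using assms by blast
qed

lemma gcomp_comp_graph:
  assumes "is_fgraph T \<Gamma>" "closed_in \<Gamma> U" "v \<in> U"
  shows "gcomp (comp_graph \<Gamma> U) v = gcomp \<Gamma> v"
  using assms closed_in_conn[OF assms(2)] by (auto simp: gcomp_iff conn_comp_graph)

lemma closed_in_gcomp:
  assumes "is_fgraph T \<Gamma>"
  shows "closed_in \<Gamma> (gcomp \<Gamma> v)"
  unfolding closed_in_def
  by (meson assms conn_edge conn_trans gcomp_iff gcomp_subset)

lemma closed_in_gcomps:
  assumes "is_fgraph T \<Gamma>" "C \<in> gcomps \<Gamma>"
  shows "closed_in \<Gamma> C"
  using assms closed_in_gcomp by (auto simp: gcomps_eq)

subsection \<open>Covering subgraphs\<close>

lemma cut_simps [simp]: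
  "verts (cut \<Gamma> S) = verts \<Gamma>" "hedges (cut \<Gamma> S) = hedges \<Gamma>" "att (cut \<Gamma> S) = att \<Gamma>"
  "htype (cut \<Gamma> S) = htype \<Gamma>" "vidx (cut \<Gamma> S) = vidx \<Gamma>"
  "invol (cut \<Gamma> S) e = (if e \<in> S then e else invol \<Gamma> e)"
  by (auto simp: cut_def)

lemma is_fgraph_cut:
  assumes "is_fgraph T \<Gamma>" "S \<subseteq> hedges \<Gamma>" "invol \<Gamma> ` S \<subseteq> S"
  shows "is_fgraph T (cut \<Gamma> S)"
proof (rule is_fgraphI)
  note f = is_fgraphD[OF assms(1)]
  show "invol (cut \<Gamma> S) (invol (cut \<Gamma> S) e) = e" if "e \<in> hedges (cut \<Gamma> S)" for e
    using that f(4)[of e] assms(3) by auto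
  show "invol (cut \<Gamma> S) \<in> extensional (hedges (cut \<Gamma> S))"
    using f(8) assms(2) by (auto simp: extensional_def)
qed (use assms in \<open>auto simp: is_fgraphD[OF assms(1)]\<close>)

text \<open>A pointwise form without the cut set: that set is recovered as
  \<open>external \<gamma>\<close>, and its stability under the involution of \<Gamma> comes from
  \<gamma> having an involution of its own.\<close>

lemma covering_iff:
  assumes "is_fgraph T \<Gamma>"
  shows "covering \<gamma> \<Gamma> \<longleftrightarrow> is_fgraph T \<gamma> \<and> verts \<gamma> = verts \<Gamma> \<and> hedges \<gamma> = hedges \<Gamma> \<and>
    att \<gamma> = att \<Gamma> \<and> htype \<gamma> = htype \<Gamma> \<and> vidx \<gamma> = vidx \<Gamma> \<and>
    (\<forall>e\<in>hedges \<Gamma>. invol \<gamma> e = e \<or> invol \<gamma> e = invol \<Gamma> e)" (is "?L \<longleftrightarrow> ?R")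
proof
  assume ?L
  then obtain S where S: "S \<subseteq> hedges \<Gamma>" "invol \<Gamma> ` S \<subseteq> S" "\<gamma> = cut \<Gamma> S"
    by (auto simp: covering_def)
  then show ?R using is_fgraph_cut[OF assms S(1,2)] by simp
next
  assume R: ?R
  then have g: "is_fgraph T \<gamma>" by simp
  \<comment> \<open>If \<gamma> sent the partner of e to e, then applying its involution once more
    would force the partner to be e itself.\<close>
  have st: "invol \<Gamma> e \<in> external \<gamma>" if "e \<in> external \<gamma>" for e
  proof -
    have e: "e \<in> hedges \<Gamma>" "invol \<gamma> e = e" using that R by (auto simp: external_def)
    have e': "invol \<Gamma> e \<in> hedges \<Gamma>" by (rule fg_invol_in[OF assms e(1)])
    have "invol \<gamma> (invol \<Gamma> e) = invol \<Gamma> e \<or> invol \<gamma> (invol \<Gamma> e) = e"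
      using R e' fg_invol_invol[OF assms e(1)] by metis
    moreover have "invol \<gamma> (invol \<gamma> (invol \<Gamma> e)) = invol \<Gamma> e"
      using fg_invol_invol[OF g] e' R by simp
    ultimately show ?thesis using e e' R by (auto simp: external_def)
  qed
  have "\<gamma> = cut \<Gamma> (external \<gamma>)"
  proof (rule fgraph_eqI[OF g])
    show "is_fgraph T (cut \<Gamma> (external \<gamma>))"
      by (rule is_fgraph_cut[OF assms]) (use st R in \<open>auto simp: external_def\<close>)
  qed (use R in \<open>auto simp: external_def\<close>)
  moreover have "external \<gamma> \<subseteq> hedges \<Gamma>" using R by (auto simp: external_def)
  ultimately show ?L using st unfolding covering_def by (metis image_subsetI)
qed

lemma covering_is_fgraph: "is_fgraph T \<Gamma> \<Longrightarrow> covering \<gamma> \<Gamma> \<Longrightarrow> is_fgraph T \<gamma>"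
  by (simp add: covering_iff)

lemma covering_simps:
  assumes "covering \<gamma> \<Gamma>"
  shows "verts \<gamma> = verts \<Gamma>" "hedges \<gamma> = hedges \<Gamma>" "att \<gamma> = att \<Gamma>" "htype \<gamma> = htype \<Gamma>"
    "vidx \<gamma> = vidx \<Gamma>"
  using assms by (auto simp: covering_def)

lemma covering_invol:
  assumes "covering \<gamma> \<Gamma>"
  shows "invol \<gamma> e = (if e \<in> external \<gamma> then e else invol \<Gamma> e)"
  using assms by (auto simp: covering_def external_def)

lemma covering_trans:
  assumes "is_fgraph T \<Gamma>" "covering \<gamma> \<Gamma>" "covering \<delta> \<gamma>"
  shows "covering \<delta> \<Gamma>"
  using assms(2,3) unfolding covering_iff[OF assms(1)] covering_iff[OF covering_is_fgraph[OF assms(1,2)]]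
  by metis

lemma covering_refl: "covering \<Gamma> \<Gamma>"
  unfolding covering_def by (rule exI[of _ "{}"]) (auto simp: cut_def)

lemma covering_external: "covering \<gamma> \<Gamma> \<Longrightarrow> external \<Gamma> \<subseteq> external \<gamma>"
  by (auto simp: covering_def external_def)

lemma covering_invol_external:
  assumes "is_fgraph T \<Gamma>" "covering \<gamma> \<Gamma>" "e \<in> external \<gamma>"
  shows "invol \<Gamma> e \<in> external \<gamma>"
proof -
  have g: "is_fgraph T \<gamma>" by (rule covering_is_fgraph[OF assms(1,2)])
  have e: "e \<in> hedges \<Gamma>" "invol \<gamma> e = e"
    using assms(3) covering_simps[OF assms(2)] by (auto simp: external_def)
  have e': "invol \<Gamma> e \<in> hedges \<Gamma>" by (rule fg_invol_in[OF assms(1) e(1)])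
  have "invol \<gamma> (invol \<Gamma> e) = invol \<Gamma> e \<or> invol \<gamma> (invol \<Gamma> e) = e"
    using covering_invol[OF assms(2)] fg_invol_invol[OF assms(1) e(1)] by metis
  moreover have "invol \<gamma> (invol \<gamma> (invol \<Gamma> e)) = invol \<Gamma> e"
    using fg_invol_invol[OF g] e' covering_simps[OF assms(2)] by simp
  ultimately show ?thesis using e e' covering_simps[OF assms(2)] by (auto simp: external_def)
qed

lemma covering_cut_external:
  assumes "is_fgraph T \<Gamma>" "covering \<gamma> \<Gamma>"
  shows "\<gamma> = cut \<Gamma> (external \<gamma>)"
proof (rule fgraph_eqI[of T _ T])
  show "is_fgraph T (cut \<Gamma> (external \<gamma>))"
    by (rule is_fgraph_cut) (use assms covering_invol_external[OF assms] covering_simps(2)[OF assms(2)] in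
        \<open>auto simp: external_def\<close>)
  show "invol \<gamma> e = invol (cut \<Gamma> (external \<gamma>)) e" for e
    using covering_invol[OF assms(2)] by simp
qed (use assms covering_is_fgraph covering_simps[OF assms(2)] in auto)

text \<open>The free half-edges of a covering are its cut set, so identities between coverings
  reduce to identities between sets of half-edges.\<close>

lemma covering_eqI:
  assumes "is_fgraph T \<Gamma>" "covering \<gamma> \<Gamma>" "covering \<delta> \<Gamma>" "external \<gamma> = external \<delta>"
  shows "\<gamma> = \<delta>"
  using assms covering_cut_external by metis

lemma conn_mono:
  assumes "is_fgraph T \<Gamma>" "covering \<gamma> \<Gamma>"
  shows "conn \<gamma> \<subseteq> conn \<Gamma>"
proof (rule conn_subsetI)
  fix e assume "e \<in> hedges \<gamma>"
  then show "(att \<gamma> e, att \<gamma> (invol \<gamma> e)) \<in> conn \<Gamma>"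
    using assms by (auto simp: covering_simps[OF assms(2)] covering_invol[OF assms(2)]
        intro: conn_edge conn_refl fg_att_in)
qed (auto simp: covering_simps[OF assms(2)] trans_conn conn_refl)

lemma gcomp_mono:
  assumes "is_fgraph T \<Gamma>" "covering \<gamma> \<Gamma>"
  shows "gcomp \<gamma> v \<subseteq> gcomp \<Gamma> v"
  using conn_mono[OF assms] by (auto simp: gcomp_iff)

subsection \<open>Bridges\<close>

text \<open>The edgewise form of local 1PI-ness. It does not mention components, hence can be tested
  edge by edge and transported through contractions and restrictions.\<close>

definition bridgeless :: "'e fgraph \<Rightarrow> bool" where
  "bridgeless \<Gamma> \<longleftrightarrow> (\<forall>e\<in>hedges \<Gamma>. invol \<Gamma> e \<noteq> e \<longrightarrow>
     (att \<Gamma> e, att \<Gamma> (invol \<Gamma> e)) \<in> conn (cut \<Gamma> {e, invol \<Gamma> e}))"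

lemma gconnected_iff:
  assumes "is_fgraph T \<Gamma>"
  shows "gconnected \<Gamma> \<longleftrightarrow> verts \<Gamma> \<noteq> {} \<and> verts \<Gamma> \<times> verts \<Gamma> \<subseteq> conn \<Gamma>"
proof
  assume "gconnected \<Gamma>"
  then obtain C where C: "gcomp \<Gamma> ` verts \<Gamma> = {C}"
    by (auto simp: gconnected_def gcomps_eq card_1_singleton_iff)
  have "(v, w) \<in> conn \<Gamma>" if "v \<in> verts \<Gamma>" "w \<in> verts \<Gamma>" for v w
    using gcomp_eq_iff[OF assms that(1), of w] that C by blast
  then show "verts \<Gamma> \<noteq> {} \<and> verts \<Gamma> \<times> verts \<Gamma> \<subseteq> conn \<Gamma>"
    using C by auto
next
  assume R: "verts \<Gamma> \<noteq> {} \<and> verts \<Gamma> \<times> verts \<Gamma> \<subseteq> conn \<Gamma>"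
  then obtain v where v: "v \<in> verts \<Gamma>" by blast
  have "gcomp \<Gamma> ` verts \<Gamma> = {gcomp \<Gamma> v}"
    using R v gcomp_eqI[OF assms] by blast
  then show "gconnected \<Gamma>" by (simp add: gconnected_def gcomps_eq)
qed

lemma is_fgraph_cut1:
  assumes "is_fgraph T \<Gamma>" "e \<in> hedges \<Gamma>"
  shows "is_fgraph T (cut \<Gamma> {e, invol \<Gamma> e})"
  by (rule is_fgraph_cut) (use assms fg_invol_in[OF assms(1)] fg_invol_invol[OF assms(1)] in auto)

text \<open>A component survives a cut exactly when the two ends of the cut edge remain connected,
  since any path through the edge can then take the detour.\<close>

lemma locally_one_PI_iff:
  assumes "is_fgraph T \<Gamma>"
  shows "locally_one_PI \<Gamma> \<longleftrightarrow> bridgeless \<Gamma>"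
proof -
  note f = is_fgraphD[OF assms]
  have cutc: "gconnected (cut (comp_graph \<Gamma> C) {e, invol (comp_graph \<Gamma> C) e}) \<longleftrightarrow>
      C \<times> C \<subseteq> conn (cut \<Gamma> {e, invol \<Gamma> e})"
    if C: "C \<in> gcomps \<Gamma>" and e: "e \<in> hedges \<Gamma>" "att \<Gamma> e \<in> C" for C e
  proof -
    let ?S = "{e, invol \<Gamma> e}"
    have cl: "closed_in \<Gamma> C" using closed_in_gcomps[OF assms C] .
    then have cl': "closed_in (cut \<Gamma> ?S) C" using f(4) e by (auto simp: closed_in_def)
    have fc: "is_fgraph T (cut \<Gamma> ?S)" using is_fgraph_cut1[OF assms e(1)] .
    \<comment> \<open>Cutting inside the component C and restricting the cut graph to C give the
      same graph, so connectedness after the cut is read off from \<open>conn\<close> of the cut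
      graph.\<close>
    have eq: "cut (comp_graph \<Gamma> C) {e, invol (comp_graph \<Gamma> C) e} = comp_graph (cut \<Gamma> ?S) C"
    proof (rule fgraph_eqI)
      show "is_fgraph T (cut (comp_graph \<Gamma> C) {e, invol (comp_graph \<Gamma> C) e})"
        by (rule is_fgraph_cut1[OF is_fgraph_comp_graph[OF assms cl]]) (use e in auto)
      show "is_fgraph T (comp_graph (cut \<Gamma> ?S) C)"
        by (rule is_fgraph_comp_graph[OF fc cl'])
    qed (use e in auto)
    have "C \<noteq> {}" using e by auto
    then show ?thesis
      unfolding eq gconnected_iff[OF is_fgraph_comp_graph[OF fc cl']] conn_comp_graph[OF fc cl']
      by auto
  qed
  have conC: "gconnected (comp_graph \<Gamma> C)" if C: "C \<in> gcomps \<Gamma>" for C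
  proof -
    obtain v where v: "v \<in> verts \<Gamma>" "C = gcomp \<Gamma> v" using C by (auto simp: gcomps_eq)
    have cl: "closed_in \<Gamma> C" using closed_in_gcomps[OF assms C] .
    have "C \<times> C \<subseteq> conn \<Gamma>" using gcomps_conn[OF assms C] by auto
    then show ?thesis
      using gcomp_self[OF v(1)] v(2)
      unfolding gconnected_iff[OF is_fgraph_comp_graph[OF assms cl]] conn_comp_graph[OF assms cl]
      by auto
  qed
  show ?thesis
  proof
    assume L: "locally_one_PI \<Gamma>"
    show "bridgeless \<Gamma>" unfolding bridgeless_def
    proof (intro ballI impI)
      fix e assume e: "e \<in> hedges \<Gamma>" "invol \<Gamma> e \<noteq> e"
      let ?C = "gcomp \<Gamma> (att \<Gamma> e)"
      have C: "?C \<in> gcomps \<Gamma>" using f(5)[OF e(1)] by (simp add: gcomps_eq)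
      have a: "att \<Gamma> e \<in> ?C" using f(5)[OF e(1)] by (rule gcomp_self)
      have b: "att \<Gamma> (invol \<Gamma> e) \<in> ?C" using conn_edge[OF assms e(1)] by (simp add: gcomp_iff)
      have "gconnected (cut (comp_graph \<Gamma> ?C) {e, invol (comp_graph \<Gamma> ?C) e})"
        using L C e a unfolding locally_one_PI_def one_PI_def external_def by auto
      then show "(att \<Gamma> e, att \<Gamma> (invol \<Gamma> e)) \<in> conn (cut \<Gamma> {e, invol \<Gamma> e})"
        using cutc[OF C e(1) a] a b by blast
    qed
  next
    assume R: "bridgeless \<Gamma>"
    show "locally_one_PI \<Gamma>" unfolding locally_one_PI_def one_PI_def
    proof (intro ballI conjI conC)
      fix C e assume C: "C \<in> gcomps \<Gamma>"
        and "e \<in> hedges (comp_graph \<Gamma> C) - external (comp_graph \<Gamma> C)"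
      then have e: "e \<in> hedges \<Gamma>" "att \<Gamma> e \<in> C" "invol \<Gamma> e \<noteq> e" by (auto simp: external_def)
      let ?G = "cut \<Gamma> {e, invol \<Gamma> e}"
      have fc: "is_fgraph T ?G" using is_fgraph_cut1[OF assms e(1)] .
      have br: "(att \<Gamma> e, att \<Gamma> (invol \<Gamma> e)) \<in> conn ?G" using R e by (auto simp: bridgeless_def)
      \<comment> \<open>Each use of the cut edge, in either direction, is replaced by the detour
        \<open>br\<close>.\<close>
      have "conn \<Gamma> \<subseteq> conn ?G"
      proof (rule conn_subsetI)
        fix x assume x: "x \<in> hedges \<Gamma>"
        show "(att \<Gamma> x, att \<Gamma> (invol \<Gamma> x)) \<in> conn ?G"
          using br conn_sym[OF fc br] conn_edge[OF fc, of x] x f(4)[OF e(1)]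
          by (cases "x = e \<or> x = invol \<Gamma> e") auto
      qed (auto simp: trans_conn intro: conn_refl)
      moreover have "C \<times> C \<subseteq> conn \<Gamma>" using gcomps_conn[OF assms C] by auto
      ultimately show "gconnected (cut (comp_graph \<Gamma> C) {e, invol (comp_graph \<Gamma> C) e})"
        using cutc[OF C e(1,2)] by blast
    qed
  qed
qed

section \<open>Contraction\<close>

lemma contract_simps:
  assumes "is_fgraph T \<Gamma>" "covering \<gamma> \<Gamma>"
  shows "verts (contract \<Gamma> \<gamma> j) = vmin \<gamma> ` verts \<Gamma>"
    "hedges (contract \<Gamma> \<gamma> j) = external \<gamma>"
    "\<And>e. e \<in> external \<gamma> \<Longrightarrow> invol (contract \<Gamma> \<gamma> j) e = invol \<Gamma> e"
    "\<And>e. e \<in> external \<gamma> \<Longrightarrow> att (contract \<Gamma> \<gamma> j) e = vmin \<gamma> (att \<Gamma> e)"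
    "\<And>e. e \<in> external \<gamma> \<Longrightarrow> htype (contract \<Gamma> \<gamma> j) e = htype \<Gamma> e"
    "\<And>v. v \<in> verts \<Gamma> \<Longrightarrow> vidx (contract \<Gamma> \<gamma> j) (vmin \<gamma> v) = j (gcomp \<gamma> v)"
proof -
  note c = covering_simps[OF assms(2)]
  note g = covering_is_fgraph[OF assms]
  show "verts (contract \<Gamma> \<gamma> j) = vmin \<gamma> ` verts \<Gamma>" "hedges (contract \<Gamma> \<gamma> j) = external \<gamma>"
    by (auto simp: contract_def Min_gcomps c)
  fix e assume e: "e \<in> external \<gamma>"
  show "invol (contract \<Gamma> \<gamma> j) e = invol \<Gamma> e"
    "att (contract \<Gamma> \<gamma> j) e = vmin \<gamma> (att \<Gamma> e)" "htype (contract \<Gamma> \<gamma> j) e = htype \<Gamma> e"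
    using e by (simp_all add: contract_def c vmin_def)
next
  note c = covering_simps[OF assms(2)]
  note g = covering_is_fgraph[OF assms]
  fix v assume v: "v \<in> verts \<Gamma>"
  show "vidx (contract \<Gamma> \<gamma> j) (vmin \<gamma> v) = j (gcomp \<gamma> v)"
    using v gcomp_vmin[OF g] by (simp add: contract_def Min_gcomps c)
qed

lemma external_hedges:
  assumes "covering \<gamma> \<Gamma>" "e \<in> external \<gamma>"
  shows "e \<in> hedges \<Gamma>"
  using assms covering_simps[OF assms(1)] by (auto simp: external_def)

lemma is_fgraph_contract:
  assumes "is_fgraph T \<Gamma>" "covering \<gamma> \<Gamma>"
  shows "is_fgraph T (contract \<Gamma> \<gamma> j)"
proof (rule is_fgraphI)
  note f = is_fgraphD[OF assms(1)]
  note s = contract_simps[OF assms]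
  note h = external_hedges[OF assms(2)]
  show "finite (verts (contract \<Gamma> \<gamma> j))" using f(1) by (simp add: s)
  show "finite (hedges (contract \<Gamma> \<gamma> j))"
    using f(2) h by (simp add: s) (meson finite_subset subsetI)
  show "invol (contract \<Gamma> \<gamma> j) \<in> extensional (hedges (contract \<Gamma> \<gamma> j))"
    "att (contract \<Gamma> \<gamma> j) \<in> extensional (hedges (contract \<Gamma> \<gamma> j))"
    "htype (contract \<Gamma> \<gamma> j) \<in> extensional (hedges (contract \<Gamma> \<gamma> j))"
    "vidx (contract \<Gamma> \<gamma> j) \<in> extensional (verts (contract \<Gamma> \<gamma> j))"
    by (auto simp: contract_def)
  fix e assume "e \<in> hedges (contract \<Gamma> \<gamma> j)"
  then have e: "e \<in> external \<gamma>" by (simp add: s)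
  have ie: "invol \<Gamma> e \<in> external \<gamma>" by (rule covering_invol_external[OF assms e])
  show "invol (contract \<Gamma> \<gamma> j) e \<in> hedges (contract \<Gamma> \<gamma> j)"
    "invol (contract \<Gamma> \<gamma> j) (invol (contract \<Gamma> \<gamma> j) e) = e"
    "att (contract \<Gamma> \<gamma> j) e \<in> verts (contract \<Gamma> \<gamma> j)"
    "htype (contract \<Gamma> \<gamma> j) e \<in> etypes T"
    "htype (contract \<Gamma> \<gamma> j) (invol (contract \<Gamma> \<gamma> j) e) = htype (contract \<Gamma> \<gamma> j) e"
    using e ie h[OF e] f by (simp_all add: s)
qed

lemma contract_verts_subset:
  assumes "is_fgraph T \<Gamma>" "covering \<gamma> \<Gamma>"
  shows "verts (contract \<Gamma> \<gamma> j) \<subseteq> verts \<Gamma>"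
  using vmin_in[OF covering_is_fgraph[OF assms]] covering_simps[OF assms(2)]
  by (auto simp: contract_simps[OF assms])

lemma vmin_idem:
  assumes "is_fgraph T \<Gamma>" "covering \<gamma> \<Gamma>" "a \<in> verts (contract \<Gamma> \<gamma> j)"
  shows "vmin \<gamma> a = a"
proof -
  obtain v where v: "v \<in> verts \<gamma>" "a = vmin \<gamma> v"
    using assms(3) covering_simps[OF assms(2)] by (auto simp: contract_simps[OF assms(1,2)])
  show ?thesis
    using gcomp_vmin[OF covering_is_fgraph[OF assms(1,2)] v(1)] v(2) by (metis vmin_def)
qed

lemma vmin_conn_covering:
  assumes "is_fgraph T \<Gamma>" "covering \<gamma> \<Gamma>" "v \<in> verts \<Gamma>"
  shows "(v, vmin \<gamma> v) \<in> conn \<Gamma>"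
  using vmin_conn[OF covering_is_fgraph[OF assms(1,2)], of v] conn_mono[OF assms(1,2)]
    covering_simps[OF assms(2)] assms(3) by auto

lemma conn_contract:
  assumes "is_fgraph T \<Gamma>" "covering \<gamma> \<Gamma>"
  shows "conn (contract \<Gamma> \<gamma> j) = Restr (conn \<Gamma>) (verts (contract \<Gamma> \<gamma> j))"
proof
  let ?K = "contract \<Gamma> \<gamma> j"
  note s = contract_simps[OF assms]
  note h = external_hedges[OF assms(2)]
  note g = covering_is_fgraph[OF assms] and c = covering_simps[OF assms(2)]
  note fK = is_fgraph_contract[OF assms, of j]
  show "conn ?K \<subseteq> Restr (conn \<Gamma>) (verts ?K)"
  proof (rule conn_subsetI)
    show "trans (Restr (conn \<Gamma>) (verts ?K))" using trans_conn[of \<Gamma>] unfolding trans_def by blast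
    show "(v, v) \<in> Restr (conn \<Gamma>) (verts ?K)" if "v \<in> verts ?K" for v
      using that contract_verts_subset[OF assms] by (auto intro: conn_refl)
    fix e assume e: "e \<in> hedges ?K"
    then have e1: "e \<in> external \<gamma>" by (simp add: s)
    have e2: "invol \<Gamma> e \<in> external \<gamma>" by (rule covering_invol_external[OF assms e1])
    have "(att \<Gamma> e, vmin \<gamma> (att \<Gamma> e)) \<in> conn \<Gamma>"
      "(att \<Gamma> (invol \<Gamma> e), vmin \<gamma> (att \<Gamma> (invol \<Gamma> e))) \<in> conn \<Gamma>"
      "(att \<Gamma> e, att \<Gamma> (invol \<Gamma> e)) \<in> conn \<Gamma>"
      using vmin_conn_covering[OF assms] fg_att_in[OF assms(1)] h e1 e2 conn_edge[OF assms(1)] by auto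
    then have "(vmin \<gamma> (att \<Gamma> e), vmin \<gamma> (att \<Gamma> (invol \<Gamma> e))) \<in> conn \<Gamma>"
      using conn_sym[OF assms(1)] conn_trans by metis
    then show "(att ?K e, att ?K (invol ?K e)) \<in> Restr (conn \<Gamma>) (verts ?K)"
      using e1 e2 h fg_att_in[OF assms(1)] by (auto simp: s)
  qed
  \<comment> \<open>A path of \<Gamma> is pushed forward along \<open>vmin\<close>: edges cut in
    \<gamma> become edges of the contraction, the others become trivial. On vertices of the
    contraction \<open>vmin\<close> is the identity.\<close>
  have "conn \<Gamma> \<subseteq> {(v, w). (vmin \<gamma> v, vmin \<gamma> w) \<in> conn ?K}"
  proof (rule conn_subsetI)
    show "trans {(v, w). (vmin \<gamma> v, vmin \<gamma> w) \<in> conn ?K}"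
      using trans_conn[of ?K] unfolding trans_def by blast
    show "(v, v) \<in> {(v, w). (vmin \<gamma> v, vmin \<gamma> w) \<in> conn ?K}" if "v \<in> verts \<Gamma>" for v
      using that by (auto intro: conn_refl simp: s)
    fix e assume e: "e \<in> hedges \<Gamma>"
    show "(att \<Gamma> e, att \<Gamma> (invol \<Gamma> e)) \<in> {(v, w). (vmin \<gamma> v, vmin \<gamma> w) \<in> conn ?K}"
    proof (cases "e \<in> external \<gamma>")
      case True
      then have "invol \<Gamma> e \<in> external \<gamma>" by (rule covering_invol_external[OF assms])
      then show ?thesis using conn_edge[OF fK, of e] True by (simp add: s)
    next
      case False
      then have "(att \<Gamma> e, att \<Gamma> (invol \<Gamma> e)) \<in> conn \<gamma>"
        using conn_edge[OF g, of e] e by (simp add: c covering_invol[OF assms(2)])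
      then have "vmin \<gamma> (att \<Gamma> e) = vmin \<gamma> (att \<Gamma> (invol \<Gamma> e))"
        using gcomp_eqI[OF g] by (simp add: vmin_def)
      moreover have "vmin \<gamma> (att \<Gamma> (invol \<Gamma> e)) \<in> verts ?K"
        using e fg_att_in[OF assms(1)] fg_invol_in[OF assms(1)] by (simp add: s)
      ultimately show ?thesis by (auto intro: conn_refl)
    qed
  qed
  then have "(vmin \<gamma> a, vmin \<gamma> b) \<in> conn ?K" if "(a, b) \<in> conn \<Gamma>" for a b
    using that by auto
  then show "Restr (conn \<Gamma>) (verts ?K) \<subseteq> conn ?K"
    using vmin_idem[OF assms, of _ j] by (auto simp del: split_paired_All) metis
qed

lemma gcomp_contract:
  assumes "is_fgraph T \<Gamma>" "covering \<gamma> \<Gamma>" "a \<in> verts (contract \<Gamma> \<gamma> j)"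
  shows "gcomp (contract \<Gamma> \<gamma> j) a = gcomp \<Gamma> a \<inter> verts (contract \<Gamma> \<gamma> j)"
  using assms(3) by (auto simp: gcomp_iff conn_contract[OF assms(1,2)])

lemma gcomp_vmin_covering:
  assumes "is_fgraph T \<Gamma>" "covering \<gamma> \<Gamma>" "v \<in> verts \<Gamma>"
  shows "gcomp \<Gamma> (vmin \<gamma> v) = gcomp \<Gamma> v"
  using gcomp_eqI[OF assms(1) vmin_conn_covering[OF assms]] by simp

text \<open>The vertices of \<open>\<Gamma>/\<gamma>\<close> are minimal in their components of \<open>\<gamma>\<close>; this makes iterated
  contraction independent of the order.\<close>

lemma vmin_contract:
  assumes "is_fgraph T \<Gamma>" "covering \<gamma> \<Gamma>" "v \<in> verts \<Gamma>"
  shows "vmin (contract \<Gamma> \<gamma> j) (vmin \<gamma> v) = vmin \<Gamma> v"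
proof -
  let ?K = "contract \<Gamma> \<gamma> j"
  note g = covering_is_fgraph[OF assms(1,2)] and c = covering_simps[OF assms(2)]
  have a: "vmin \<gamma> v \<in> verts ?K" using assms(3) by (simp add: contract_simps[OF assms(1,2)])
  have "Min (gcomp \<Gamma> v \<inter> verts ?K) = Min (gcomp \<Gamma> v)"
  proof (rule Min_eqI)
    show "finite (gcomp \<Gamma> v \<inter> verts ?K)" using gcomp_finite[OF assms(1)] by blast
    show "Min (gcomp \<Gamma> v) \<le> y" if "y \<in> gcomp \<Gamma> v \<inter> verts ?K" for y
      using that gcomp_finite[OF assms(1)] by auto
    let ?m = "vmin \<Gamma> v"
    have m: "(v, ?m) \<in> conn \<Gamma>" "?m \<in> verts \<Gamma>"
      using vmin_conn[OF assms(1,3)] vmin_in[OF assms(1,3)] by auto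
    have "(?m, vmin \<gamma> ?m) \<in> conn \<Gamma>" by (rule vmin_conn_covering[OF assms(1,2) m(2)])
    then have "vmin \<gamma> ?m \<in> gcomp \<Gamma> v" using m(1) conn_trans by (metis gcomp_iff)
    then have "?m \<le> vmin \<gamma> ?m"
      unfolding vmin_def[of \<Gamma>] using gcomp_finite[OF assms(1)] by (meson Min_le)
    moreover have "vmin \<gamma> ?m \<le> ?m"
      unfolding vmin_def[of \<gamma>] using gcomp_self[of ?m \<gamma>] m(2) gcomp_finite[OF g, of ?m] c(1)
      by (metis Min_le)
    ultimately have "vmin \<gamma> ?m = ?m" by simp
    moreover have "vmin \<gamma> ?m \<in> verts ?K" using m(2) by (simp add: contract_simps[OF assms(1,2)])
    ultimately show "Min (gcomp \<Gamma> v) \<in> gcomp \<Gamma> v \<inter> verts ?K"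
      using m(1) by (simp add: vmin_def gcomp_iff)
  qed
  then show ?thesis
    unfolding vmin_def[of ?K] gcomp_contract[OF assms(1,2) a] gcomp_vmin_covering[OF assms]
    by (simp add: vmin_def)
qed

lemma external_contract:
  assumes "is_fgraph T \<Gamma>" "covering \<gamma> \<Gamma>"
  shows "external (contract \<Gamma> \<gamma> j) = external \<Gamma>"
proof -
  have "external (contract \<Gamma> \<gamma> j) = {e \<in> external \<gamma>. invol \<Gamma> e = e}"
    by (auto simp: external_def[of "contract \<Gamma> \<gamma> j"] contract_simps[OF assms])
  then show ?thesis
    using covering_external[OF assms(2)] external_hedges[OF assms(2)] by (auto simp: external_def[of \<Gamma>])
qed

section \<open>Residues and specifications under contraction\<close>

section \<open>Specified graphs\<close>

text \<open>The type of the residue of the component of v, counted directly in \<Gamma>; by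
  \<open>res_type_eq\<close> it replaces \<open>res_type\<close>, which passes through
  \<open>comp_graph\<close> and \<open>contract\<close>.\<close>

definition rtype :: "'e fgraph \<Rightarrow> nat \<Rightarrow> 'e \<Rightarrow> nat" where
  "rtype \<Gamma> v = (\<lambda>t. card {e \<in> external \<Gamma>. att \<Gamma> e \<in> gcomp \<Gamma> v \<and> htype \<Gamma> e = t})"

text \<open>By \<open>naked_iff\<close>, the vertices that form a component of their own without
  internal edges; there the specification is prescribed by the vertex index.\<close>

definition naked :: "'e fgraph \<Rightarrow> nat set" where
  "naked \<Gamma> = {v \<in> verts \<Gamma>. \<forall>e\<in>hedges \<Gamma>. att \<Gamma> e = v \<longrightarrow> invol \<Gamma> e = e}"

text \<open>The vertexwise form of the condition that a component of \<gamma> is a full component of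
  \<Gamma>, see \<open>full_iff\<close>.\<close>

definition full :: "'e fgraph \<Rightarrow> 'e fgraph \<Rightarrow> nat \<Rightarrow> bool" where
  "full \<gamma> \<Gamma> v \<longleftrightarrow> (\<forall>e\<in>hedges \<Gamma>. att \<Gamma> e \<in> gcomp \<gamma> v \<longrightarrow> invol \<gamma> e = invol \<Gamma> e)"

lemma vtype_contract:
  assumes "is_fgraph T \<Gamma>" "covering \<gamma> \<Gamma>" "v \<in> verts \<Gamma>"
  shows "vtype (contract \<Gamma> \<gamma> j) (vmin \<gamma> v) = rtype \<gamma> v"
proof
  fix t
  note s = contract_simps[OF assms(1,2)] and c = covering_simps[OF assms(2)]
  note g = covering_is_fgraph[OF assms(1,2)]
  have "vmin \<gamma> (att \<Gamma> e) = vmin \<gamma> v \<longleftrightarrow> att \<gamma> e \<in> gcomp \<gamma> v" if "e \<in> external \<gamma>" for e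
    using vmin_eq_iff[OF g, of v "att \<gamma> e"] assms(3) fg_att_in[OF assms(1)]
      external_hedges[OF assms(2) that] by (auto simp: c gcomp_iff)
  then have "{e \<in> star (contract \<Gamma> \<gamma> j) (vmin \<gamma> v). htype (contract \<Gamma> \<gamma> j) e = t} =
      {e \<in> external \<gamma>. att \<gamma> e \<in> gcomp \<gamma> v \<and> htype \<gamma> e = t}"
    by (auto simp: star_def s c)
  then show "vtype (contract \<Gamma> \<gamma> j) (vmin \<gamma> v) t = rtype \<gamma> v t"
    by (simp add: vtype_def rtype_def)
qed

lemma res_type_eq:
  assumes "is_fgraph T \<Gamma>" "v \<in> verts \<Gamma>"
  shows "res_type \<Gamma> (gcomp \<Gamma> v) = rtype \<Gamma> v"
proof
  fix t
  let ?C = "gcomp \<Gamma> v" and ?K = "comp_graph \<Gamma> (gcomp \<Gamma> v)"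
  have cl: "closed_in \<Gamma> ?C" by (rule closed_in_gcomp[OF assms(1)])
  have v: "v \<in> ?C" by (rule gcomp_self[OF assms(2)])
  have fK: "is_fgraph T ?K" by (rule is_fgraph_comp_graph[OF assms(1) cl])
  have g: "gcomp ?K v = ?C" by (rule gcomp_comp_graph[OF assms(1) cl v])
  have "res_type \<Gamma> ?C = rtype ?K v"
    using vtype_contract[OF fK covering_refl, of v "\<lambda>_. 0"] v
    by (simp add: res_type_def res_def vmin_def g)
  moreover have "{e \<in> external ?K. att ?K e \<in> gcomp ?K v \<and> htype ?K e = t} =
      {e \<in> external \<Gamma>. att \<Gamma> e \<in> gcomp \<Gamma> v \<and> htype \<Gamma> e = t}"
    unfolding g by (auto simp: external_def)
  ultimately show "res_type \<Gamma> ?C t = rtype \<Gamma> v t" by (simp add: rtype_def)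
qed

text \<open>Contraction keeps the external half-edges of \<Gamma> and matches components, so
  residues are unchanged and the specification of \<Gamma> stays admissible on the
  contraction.\<close>

lemma rtype_contract:
  assumes "is_fgraph T \<Gamma>" "covering \<gamma> \<Gamma>" "v \<in> verts \<Gamma>"
  shows "rtype (contract \<Gamma> \<gamma> j) (vmin \<gamma> v) = rtype \<Gamma> v"
proof
  fix t
  let ?K = "contract \<Gamma> \<gamma> j"
  note s = contract_simps[OF assms(1,2)]
  have a: "vmin \<gamma> v \<in> verts ?K" using assms(3) by (simp add: s)
  have "att ?K e \<in> gcomp ?K (vmin \<gamma> v) \<longleftrightarrow> att \<Gamma> e \<in> gcomp \<Gamma> v" if "e \<in> external \<Gamma>" for e
  proof -
    have e: "e \<in> external \<gamma>" using covering_external[OF assms(2)] that by auto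
    have "att \<Gamma> e \<in> verts \<Gamma>" using fg_att_in[OF assms(1)] external_hedges[OF assms(2) e] by auto
    then show ?thesis
      using vmin_conn_covering[OF assms(1,2)] conn_sym[OF assms(1)] conn_trans
      unfolding gcomp_contract[OF assms(1,2) a] gcomp_vmin_covering[OF assms]
      by (auto simp: s e gcomp_iff) blast+
  qed
  moreover have "htype ?K e = htype \<Gamma> e" if "e \<in> external \<Gamma>" for e
    using covering_external[OF assms(2)] that by (auto simp: s)
  ultimately have "{e \<in> external ?K. att ?K e \<in> gcomp ?K (vmin \<gamma> v) \<and> htype ?K e = t} =
      {e \<in> external \<Gamma>. att \<Gamma> e \<in> gcomp \<Gamma> v \<and> htype \<Gamma> e = t}"
    unfolding external_contract[OF assms(1,2)] by auto
  then show "rtype ?K (vmin \<gamma> v) t = rtype \<Gamma> v t" by (simp add: rtype_def)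
qed

lemma naked_iff:
  assumes "is_fgraph T \<Gamma>"
  shows "{v} \<in> gcomps \<Gamma> \<and> no_internal (comp_graph \<Gamma> {v}) \<longleftrightarrow> v \<in> naked \<Gamma>"
proof
  assume a: "{v} \<in> gcomps \<Gamma> \<and> no_internal (comp_graph \<Gamma> {v})"
  then have "v \<in> verts \<Gamma>" using gcomp_subset by (fastforce simp: gcomps_eq)
  moreover have "invol \<Gamma> e = e" if "e \<in> hedges \<Gamma>" "att \<Gamma> e = v" for e
  proof -
    have "e \<in> external (comp_graph \<Gamma> {v})" using a that by (auto simp: no_internal_def)
    then show ?thesis using that by (simp add: external_def)
  qed
  ultimately show "v \<in> naked \<Gamma>" by (simp add: naked_def)
next
  assume n: "v \<in> naked \<Gamma>"
  have "conn \<Gamma> \<subseteq> {(a, b). a = v \<longrightarrow> b = v}"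
    by (rule conn_subsetI) (use n in \<open>auto simp: naked_def trans_def\<close>)
  moreover have v: "v \<in> verts \<Gamma>" using n by (simp add: naked_def)
  ultimately have "gcomp \<Gamma> v = {v}" by (auto simp: gcomp_iff conn_refl)
  then show "{v} \<in> gcomps \<Gamma> \<and> no_internal (comp_graph \<Gamma> {v})"
    using n v by (auto simp: gcomps_eq naked_def no_internal_def external_def intro: rev_image_eqI)
qed

lemma gcomp_naked:
  assumes "is_fgraph T \<Gamma>" "v \<in> naked \<Gamma>"
  shows "gcomp \<Gamma> v = {v}"
proof -
  have "{v} \<in> gcomps \<Gamma>" "v \<in> verts \<Gamma>" using naked_iff[OF assms(1)] assms(2) by (auto simp: naked_def)
  then show ?thesis using gcomps_disjoint[OF assms(1), of "{v}" "gcomp \<Gamma> v" v] gcomp_self[of v \<Gamma>]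
    by (auto simp: gcomps_eq)
qed

lemma specified_iff:
  assumes "valid_theory T"
  shows "specified T (\<Gamma>, i) \<longleftrightarrow> is_fgraph T \<Gamma> \<and> in_theory T \<Gamma> \<and> bridgeless \<Gamma> \<and>
    i \<in> extensional (gcomps \<Gamma>) \<and>
    (\<forall>v\<in>verts \<Gamma>. (rtype \<Gamma> v, i (gcomp \<Gamma> v)) \<in> rvtypes T) \<and>
    (\<forall>v\<in>naked \<Gamma>. i (gcomp \<Gamma> v) = vidx \<Gamma> v)"
proof (cases "is_fgraph T \<Gamma>")
  case True
  have 1: "(\<forall>C\<in>gcomps \<Gamma>. (res_type \<Gamma> C, i C) \<in> rvtypes T) \<longleftrightarrow>
      (\<forall>v\<in>verts \<Gamma>. (rtype \<Gamma> v, i (gcomp \<Gamma> v)) \<in> rvtypes T)"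
    by (auto simp: gcomps_eq res_type_eq[OF True])
  \<comment> \<open>Refined types project into \<open>vtypes T\<close>, so an admissible
    specification already yields superficial divergence.\<close>
  have 2: "superficially_divergent T \<Gamma>" if "\<forall>C\<in>gcomps \<Gamma>. (res_type \<Gamma> C, i C) \<in> rvtypes T"
    using that assms by (auto simp: superficially_divergent_def valid_theory_def)
  have 3: "(\<forall>v. {v} \<in> gcomps \<Gamma> \<and> no_internal (comp_graph \<Gamma> {v}) \<longrightarrow> i {v} = vidx \<Gamma> v) \<longleftrightarrow>
      (\<forall>v\<in>naked \<Gamma>. i (gcomp \<Gamma> v) = vidx \<Gamma> v)"
    unfolding naked_iff[OF True] using gcomp_naked[OF True] by auto
  show ?thesis
    unfolding specified_def prod.case graph_of_def locally_one_PI_iff[OF True] 3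
    using 1 2 True by blast
qed (simp add: specified_def graph_of_def)

lemma specifiedD:
  assumes "valid_theory T" "specified T s"
  shows sp_fgraph: "is_fgraph T (fst s)" and sp_in_theory: "in_theory T (fst s)"
    and sp_bridgeless: "bridgeless (fst s)" and sp_ext: "snd s \<in> extensional (gcomps (fst s))"
    and sp_rtype: "\<And>v. v \<in> verts (fst s) \<Longrightarrow>
      (rtype (fst s) v, snd s (gcomp (fst s) v)) \<in> rvtypes T"
    and sp_naked: "\<And>v. v \<in> naked (fst s) \<Longrightarrow> snd s (gcomp (fst s) v) = vidx (fst s) v"
  using assms(2) specified_iff[OF assms(1), of "fst s" "snd s"] by auto

lemma specifiedI:
  assumes "valid_theory T" "is_fgraph T (fst s)" "in_theory T (fst s)" "bridgeless (fst s)"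
    "snd s \<in> extensional (gcomps (fst s))"
    "\<And>v. v \<in> verts (fst s) \<Longrightarrow> (rtype (fst s) v, snd s (gcomp (fst s) v)) \<in> rvtypes T"
    "\<And>v. v \<in> naked (fst s) \<Longrightarrow> snd s (gcomp (fst s) v) = vidx (fst s) v"
  shows "specified T s"
  using assms(2-) specified_iff[OF assms(1), of "fst s" "snd s"] by auto

lemma sgraph_eqI:
  assumes "fst s = fst t" "snd s \<in> extensional (gcomps (fst t))"
    "snd t \<in> extensional (gcomps (fst t))"
    "\<And>v. v \<in> verts (fst t) \<Longrightarrow> snd s (gcomp (fst t) v) = snd t (gcomp (fst t) v)"
  shows "s = t"
proof -
  have "snd s = snd t"
    by (rule extensionalityI[OF assms(2,3)]) (auto simp: gcomps_eq assms(4))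
  then show ?thesis using assms(1) by (simp add: prod_eq_iff)
qed

text \<open>A full component retains all edges of \<Gamma> at its vertices, so it is closed in
  \<Gamma> and cannot be a proper part of a component.\<close>

lemma full_gcomp:
  assumes "is_fgraph T \<Gamma>" "covering \<gamma> \<Gamma>" "full \<gamma> \<Gamma> v" "v \<in> verts \<Gamma>"
  shows "gcomp \<gamma> v = gcomp \<Gamma> v"
proof -
  note c = covering_simps[OF assms(2)]
  note g = covering_is_fgraph[OF assms(1,2)]
  have "closed_in \<Gamma> (gcomp \<gamma> v)"
    using closed_in_gcomp[OF g, of v] assms(3) by (auto simp: closed_in_def c full_def)
  then have "gcomp \<Gamma> v \<subseteq> gcomp \<gamma> v"
    using closed_in_conn[of \<Gamma>] gcomp_self[of v \<gamma>] assms(4) c(1) by (metis gcomp_iff subsetI)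
  then show ?thesis using gcomp_mono[OF assms(1,2)] by blast
qed

lemma full_iff:
  assumes "is_fgraph T \<Gamma>" "covering \<gamma> \<Gamma>" "v \<in> verts \<Gamma>"
  shows "gcomp \<gamma> v \<in> gcomps \<Gamma> \<and> comp_graph \<gamma> (gcomp \<gamma> v) = comp_graph \<Gamma> (gcomp \<gamma> v) \<longleftrightarrow>
    full \<gamma> \<Gamma> v"
proof
  note c = covering_simps[OF assms(2)]
  assume "gcomp \<gamma> v \<in> gcomps \<Gamma> \<and> comp_graph \<gamma> (gcomp \<gamma> v) = comp_graph \<Gamma> (gcomp \<gamma> v)"
  then have "invol (comp_graph \<gamma> (gcomp \<gamma> v)) = invol (comp_graph \<Gamma> (gcomp \<gamma> v))" by simp
  then show "full \<gamma> \<Gamma> v" unfolding full_def using comp_graph_simps(3) c by metis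
next
  note c = covering_simps[OF assms(2)]
  assume f: "full \<gamma> \<Gamma> v"
  have "gcomp \<gamma> v \<in> gcomps \<Gamma>" using full_gcomp[OF assms(1,2) f assms(3)] assms(3)
    by (simp add: gcomps_eq)
  moreover have "restrict (invol \<gamma>) {e \<in> hedges \<gamma>. att \<gamma> e \<in> gcomp \<gamma> v} =
      restrict (invol \<Gamma>) {e \<in> hedges \<Gamma>. att \<Gamma> e \<in> gcomp \<gamma> v}"
    using f by (intro ext) (auto simp: full_def c restrict_def)
  ultimately show "gcomp \<gamma> v \<in> gcomps \<Gamma> \<and>
      comp_graph \<gamma> (gcomp \<gamma> v) = comp_graph \<Gamma> (gcomp \<gamma> v)"
    by (auto simp: comp_graph_def c Let_def)
qed

lemma spec_covering_iff:
  "spec_covering T t s \<longleftrightarrow> specified T t \<and> specified T s \<and> covering (fst t) (fst s) \<and>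
    (\<forall>v\<in>verts (fst s). full (fst t) (fst s) v \<longrightarrow>
       snd t (gcomp (fst t) v) = snd s (gcomp (fst s) v))"
proof -
  obtain \<gamma> j \<Gamma> i where ts: "t = (\<gamma>, j)" "s = (\<Gamma>, i)" by (cases t; cases s)
  show ?thesis
  proof (cases "specified T t \<and> specified T s \<and> covering (fst t) (fst s)")
    case True
    then have f: "is_fgraph T \<Gamma>" and cv: "covering \<gamma> \<Gamma>" by (auto simp: ts specified_def graph_of_def)
    have "(\<forall>C\<in>gcomps \<gamma> \<inter> gcomps \<Gamma>. comp_graph \<gamma> C = comp_graph \<Gamma> C \<longrightarrow> j C = i C) \<longleftrightarrow>
      (\<forall>v\<in>verts \<gamma>. gcomp \<gamma> v \<in> gcomps \<Gamma> \<and> comp_graph \<gamma> (gcomp \<gamma> v) = comp_graph \<Gamma> (gcomp \<gamma> v)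
         \<longrightarrow> j (gcomp \<gamma> v) = i (gcomp \<gamma> v))"
      by (auto simp: gcomps_eq[of \<gamma>])
    also have "\<dots> \<longleftrightarrow> (\<forall>v\<in>verts \<Gamma>. full \<gamma> \<Gamma> v \<longrightarrow> j (gcomp \<gamma> v) = i (gcomp \<Gamma> v))"
      using full_iff[OF f cv] full_gcomp[OF f cv] covering_simps(1)[OF cv] by (metis (no_types, lifting))
    finally show ?thesis using True by (simp add: spec_covering_def ts)
  qed (auto simp: spec_covering_def ts)
qed

subsection \<open>Contraction of specified graphs\<close>

lemma fst_spec_contract: "fst (spec_contract s t) = contract (fst s) (fst t) (snd t)"
  by (cases s; cases t) (simp add: spec_contract_def)

lemma snd_spec_contract_ext:
  "snd (spec_contract s t) \<in> extensional (gcomps (fst (spec_contract s t)))"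
  by (cases s; cases t) (simp add: spec_contract_def)

lemma snd_spec_contract:
  assumes "is_fgraph T (fst s)" "covering (fst t) (fst s)" "a \<in> verts (fst (spec_contract s t))"
  shows "snd (spec_contract s t) (gcomp (fst (spec_contract s t)) a) = snd s (gcomp (fst s) a)"
proof -
  obtain \<gamma> j \<Gamma> i where ts: "t = (\<gamma>, j)" "s = (\<Gamma>, i)" by (cases t; cases s)
  let ?K = "contract \<Gamma> \<gamma> j"
  have f: "is_fgraph T \<Gamma>" and cv: "covering \<gamma> \<Gamma>" using assms by (auto simp: ts)
  have a: "a \<in> verts ?K" using assms(3) by (simp add: fst_spec_contract ts)
  have a': "a \<in> verts \<Gamma>" using a contract_verts_subset[OF f cv] by auto
  have aK: "a \<in> gcomp ?K a" by (rule gcomp_self[OF a])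
  \<comment> \<open>Labels of the contraction are vertices of \<Gamma> and components of \<Gamma>
    are disjoint, so the single vertex a pins the component down.\<close>
  have "(THE C. C \<in> gcomps \<Gamma> \<and> gcomp ?K a \<subseteq> C) = gcomp \<Gamma> a"
  proof (rule the_equality)
    show "gcomp \<Gamma> a \<in> gcomps \<Gamma> \<and> gcomp ?K a \<subseteq> gcomp \<Gamma> a"
      using a' gcomp_contract[OF f cv a] by (auto simp: gcomps_eq)
    fix C assume "C \<in> gcomps \<Gamma> \<and> gcomp ?K a \<subseteq> C"
    then show "C = gcomp \<Gamma> a"
      using gcomps_disjoint[OF f, of C "gcomp \<Gamma> a" a] gcomp_self[OF a'] aK a'
      by (auto simp: gcomps_eq)
  qed
  moreover have "gcomp ?K a \<in> gcomps ?K" using a by (simp add: gcomps_eq)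
  ultimately show ?thesis by (simp add: spec_contract_def ts)
qed

text \<open>The contracted vertex has no internal edges precisely if \<gamma> cut no edge at the
  component. This turns the condition on full components of a covering into the condition on bare
  vertices of the contraction.\<close>

lemma naked_contract:
  assumes "is_fgraph T \<Gamma>" "covering \<gamma> \<Gamma>" "v \<in> verts \<Gamma>"
  shows "vmin \<gamma> v \<in> naked (contract \<Gamma> \<gamma> j) \<longleftrightarrow> full \<gamma> \<Gamma> v"
proof -
  note s = contract_simps[OF assms(1,2)] and c = covering_simps[OF assms(2)]
  note g = covering_is_fgraph[OF assms(1,2)]
  have eq: "vmin \<gamma> (att \<Gamma> e) = vmin \<gamma> v \<longleftrightarrow> att \<Gamma> e \<in> gcomp \<gamma> v" if "e \<in> hedges \<Gamma>" for e
    using vmin_eq_iff[OF g, of v "att \<gamma> e"] assms(3) fg_att_in[OF assms(1) that]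
    by (auto simp: c gcomp_iff)
  have "vmin \<gamma> v \<in> naked (contract \<Gamma> \<gamma> j) \<longleftrightarrow>
      (\<forall>e\<in>external \<gamma>. att \<Gamma> e \<in> gcomp \<gamma> v \<longrightarrow> invol \<Gamma> e = e)"
    using assms(3) eq external_hedges[OF assms(2)] by (auto simp: naked_def s)
  also have "\<dots> \<longleftrightarrow> full \<gamma> \<Gamma> v"
    using external_hedges[OF assms(2)] unfolding full_def covering_invol[OF assms(2)]
    by (metis (full_types))
  finally show ?thesis .
qed

text \<open>A cut at a half-edge that is free in \<gamma> may be made in \<Gamma> first: \<gamma>
  still covers the result, and the cut commutes with contraction. Bridges of the contraction can
  thus be studied in a cut copy of \<Gamma>.\<close>

lemma covering_cut1:
  assumes "is_fgraph T \<Gamma>" "covering \<gamma> \<Gamma>" "e \<in> external \<gamma>"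
  shows "covering \<gamma> (cut \<Gamma> {e, invol \<Gamma> e})"
    and "cut (contract \<Gamma> \<gamma> j) {e, invol \<Gamma> e} = contract (cut \<Gamma> {e, invol \<Gamma> e}) \<gamma> j"
proof -
  have e: "e \<in> hedges \<Gamma>" by (rule external_hedges[OF assms(2,3)])
  have e': "invol \<Gamma> e \<in> external \<gamma>" by (rule covering_invol_external[OF assms])
  have fc: "is_fgraph T (cut \<Gamma> {e, invol \<Gamma> e})" by (rule is_fgraph_cut1[OF assms(1) e])
  show "covering \<gamma> (cut \<Gamma> {e, invol \<Gamma> e})"
    using assms(2,3) e' unfolding covering_iff[OF fc] covering_iff[OF assms(1)]
    by (auto simp: external_def)
  show "cut (contract \<Gamma> \<gamma> j) {e, invol \<Gamma> e} = contract (cut \<Gamma> {e, invol \<Gamma> e}) \<gamma> j"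
    using assms(3) e' by (auto simp: contract_def cut_def fun_eq_iff)
qed

text \<open>An internal edge of the contraction is an edge of \<Gamma> cut in \<gamma>; its detour
  in \<Gamma> is pushed forward by \<open>conn_contract\<close> for the graph in which the edge is
  cut.\<close>

lemma bridgeless_contract:
  assumes "is_fgraph T \<Gamma>" "covering \<gamma> \<Gamma>" "bridgeless \<Gamma>"
  shows "bridgeless (contract \<Gamma> \<gamma> j)"
  unfolding bridgeless_def
proof (intro ballI impI)
  let ?K = "contract \<Gamma> \<gamma> j"
  note s = contract_simps[OF assms(1,2)]
  fix e assume "e \<in> hedges ?K" and n: "invol ?K e \<noteq> e"
  then have e: "e \<in> external \<gamma>" by (simp add: s)
  have h: "e \<in> hedges \<Gamma>" by (rule external_hedges[OF assms(2) e])
  have e': "invol \<Gamma> e \<in> external \<gamma>" by (rule covering_invol_external[OF assms(1,2) e])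
  let ?G = "cut \<Gamma> {e, invol \<Gamma> e}"
  have fG: "is_fgraph T ?G" by (rule is_fgraph_cut1[OF assms(1) h])
  note cG = covering_cut1[OF assms(1,2) e]
  have "(att \<Gamma> e, att \<Gamma> (invol \<Gamma> e)) \<in> conn ?G"
    using assms(3) h n e by (auto simp: bridgeless_def s)
  moreover have "(att \<Gamma> e, vmin \<gamma> (att \<Gamma> e)) \<in> conn ?G"
    "(att \<Gamma> (invol \<Gamma> e), vmin \<gamma> (att \<Gamma> (invol \<Gamma> e))) \<in> conn ?G"
    using vmin_conn_covering[OF fG cG(1)] fg_att_in[OF assms(1)] h fg_invol_in[OF assms(1) h] by auto
  ultimately have "(vmin \<gamma> (att \<Gamma> e), vmin \<gamma> (att \<Gamma> (invol \<Gamma> e))) \<in> conn ?G"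
    using conn_sym[OF fG] conn_trans by metis
  moreover have "vmin \<gamma> (att \<Gamma> e) \<in> verts (contract ?G \<gamma> j)"
    "vmin \<gamma> (att \<Gamma> (invol \<Gamma> e)) \<in> verts (contract ?G \<gamma> j)"
    using fg_att_in[OF assms(1)] h fg_invol_in[OF assms(1) h]
    by (auto simp: contract_simps[OF fG cG(1)])
  ultimately show "(att ?K e, att ?K (invol ?K e)) \<in> conn (cut ?K {e, invol ?K e})"
    using e e' cG(2)[of j] conn_contract[OF fG cG(1), of j] by (simp add: s)
qed

text \<open>An edge cut in \<gamma> has a detour in the contraction, which lifts because \<gamma>
  still connects each of its components; an edge kept in \<gamma> has a detour inside
  \<gamma>.\<close>

lemma bridgeless_extension:
  assumes "is_fgraph T \<Gamma>" "covering \<gamma> \<Gamma>" "bridgeless \<gamma>" "bridgeless (contract \<Gamma> \<gamma> j)"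
  shows "bridgeless \<Gamma>"
  unfolding bridgeless_def
proof (intro ballI impI)
  let ?K = "contract \<Gamma> \<gamma> j"
  note s = contract_simps[OF assms(1,2)] and c = covering_simps[OF assms(2)]
  note g = covering_is_fgraph[OF assms(1,2)]
  fix e assume h: "e \<in> hedges \<Gamma>" and n: "invol \<Gamma> e \<noteq> e"
  let ?G = "cut \<Gamma> {e, invol \<Gamma> e}"
  have fG: "is_fgraph T ?G" by (rule is_fgraph_cut1[OF assms(1) h])
  show "(att \<Gamma> e, att \<Gamma> (invol \<Gamma> e)) \<in> conn ?G"
  proof (cases "e \<in> external \<gamma>")
    case True
    note cG = covering_cut1[OF assms(1,2) True]
    have e': "invol \<Gamma> e \<in> external \<gamma>" by (rule covering_invol_external[OF assms(1,2) True])
    have "(vmin \<gamma> (att \<Gamma> e), vmin \<gamma> (att \<Gamma> (invol \<Gamma> e))) \<in> conn ?G"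
      using assms(4) n True e' cG(2)[of j] conn_contract[OF fG cG(1), of j]
      by (auto simp: bridgeless_def s)
    moreover have "(att \<Gamma> e, vmin \<gamma> (att \<Gamma> e)) \<in> conn ?G"
      "(att \<Gamma> (invol \<Gamma> e), vmin \<gamma> (att \<Gamma> (invol \<Gamma> e))) \<in> conn ?G"
      using vmin_conn_covering[OF fG cG(1)] fg_att_in[OF assms(1)] h fg_invol_in[OF assms(1) h] by auto
    ultimately show ?thesis using conn_sym[OF fG] conn_trans by metis
  next
    case False
    have i: "invol \<gamma> e = invol \<Gamma> e" using covering_invol[OF assms(2)] False by simp
    have "(att \<Gamma> e, att \<Gamma> (invol \<Gamma> e)) \<in> conn (cut \<gamma> {e, invol \<Gamma> e})"
      using assms(3) h n i by (auto simp: bridgeless_def c)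
    moreover have "covering (cut \<gamma> {e, invol \<Gamma> e}) ?G"
      unfolding covering_iff[OF fG]
      using is_fgraph_cut1[OF g, of e] h i c covering_invol[OF assms(2)] by auto
    ultimately show ?thesis using conn_mono[OF fG] by blast
  qed
qed

text \<open>Vertex types of the contraction are residues of t; residues and absence of bridges are
  inherited from s. What remains is the condition on bare vertices, which
  \<open>naked_contract\<close> identifies with the condition on full components.\<close>

lemma specified_spec_contract_iff:
  assumes "valid_theory T" "specified T t" "specified T s" "covering (fst t) (fst s)"
  shows "specified T (spec_contract s t) \<longleftrightarrow> spec_covering T t s"
proof -
  let ?K = "spec_contract s t"
  note f = sp_fgraph[OF assms(1,3)]
  note fk = fst_spec_contract[of s t]
  note cs = contract_simps[OF f assms(4)] and c = covering_simps[OF assms(4)]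
  have sn: "snd ?K (gcomp (fst ?K) (vmin (fst t) v)) = snd s (gcomp (fst s) v)"
    if "v \<in> verts (fst s)" for v
    using snd_spec_contract[OF f assms(4), of "vmin (fst t) v"] that
      gcomp_vmin_covering[OF f assms(4) that] by (simp add: fk cs)
  have 1: "is_fgraph T (fst ?K)" unfolding fk by (rule is_fgraph_contract[OF f assms(4)])
  have 2: "in_theory T (fst ?K)"
    using sp_rtype[OF assms(1,2)] vtype_contract[OF f assms(4)]
    by (auto simp: in_theory_def fk cs c)
  have 3: "bridgeless (fst ?K)"
    unfolding fk by (rule bridgeless_contract[OF f assms(4) sp_bridgeless[OF assms(1,3)]])
  have 4: "(rtype (fst ?K) a, snd ?K (gcomp (fst ?K) a)) \<in> rvtypes T" if a: "a \<in> verts (fst ?K)" for a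
  proof -
    obtain v where v: "v \<in> verts (fst s)" "a = vmin (fst t) v"
      using a by (auto simp: fk cs)
    show ?thesis
      using sn[OF v(1)] rtype_contract[OF f assms(4) v(1)] sp_rtype[OF assms(1,3) v(1)]
      unfolding v(2) fk by simp
  qed
  have "specified T ?K \<longleftrightarrow> (\<forall>a\<in>naked (fst ?K). snd ?K (gcomp (fst ?K) a) = vidx (fst ?K) a)"
    using 1 2 3 4 snd_spec_contract_ext[of s t] specified_iff[OF assms(1), of "fst ?K" "snd ?K"] by auto
  also have "\<dots> \<longleftrightarrow> (\<forall>v\<in>verts (fst s). vmin (fst t) v \<in> naked (fst ?K) \<longrightarrow>
      snd ?K (gcomp (fst ?K) (vmin (fst t) v)) = vidx (fst ?K) (vmin (fst t) v))"
    by (auto simp: naked_def fk cs)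
  also have "\<dots> \<longleftrightarrow> (\<forall>v\<in>verts (fst s). full (fst t) (fst s) v \<longrightarrow>
      snd t (gcomp (fst t) v) = snd s (gcomp (fst s) v))"
    using sn naked_contract[OF f assms(4)] by (auto simp: fk cs)
  finally show ?thesis using assms(2-) by (simp add: spec_covering_iff)
qed

section \<open>Transport of coverings along isomorphisms\<close>

section \<open>Isomorphisms\<close>

text \<open>The part of \<open>graph_iso\<close> that determines connectivity, residues and bridges,
  none of which see the indices; shared with \<open>weak_iso\<close>.\<close>

definition shape_iso ::
  "(nat \<Rightarrow> nat) \<Rightarrow> (nat \<Rightarrow> nat) \<Rightarrow> 'e fgraph \<Rightarrow> 'e fgraph \<Rightarrow> bool" where
  "shape_iso f g \<Gamma> \<Gamma>' \<longleftrightarrow>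
     bij_betw f (verts \<Gamma>) (verts \<Gamma>') \<and> bij_betw g (hedges \<Gamma>) (hedges \<Gamma>') \<and>
     (\<forall>e\<in>hedges \<Gamma>. g (invol \<Gamma> e) = invol \<Gamma>' (g e) \<and> f (att \<Gamma> e) = att \<Gamma>' (g e) \<and>
        htype \<Gamma>' (g e) = htype \<Gamma> e)"

text \<open>Indices of vertices without internal edges are invisible to multiplicative functions, so
  contractions need to be related only up to these.\<close>

definition weak_iso ::
  "(nat \<Rightarrow> nat) \<Rightarrow> (nat \<Rightarrow> nat) \<Rightarrow> 'e fgraph \<Rightarrow> 'e fgraph \<Rightarrow> bool" where
  "weak_iso f g \<Gamma> \<Gamma>' \<longleftrightarrow> shape_iso f g \<Gamma> \<Gamma>' \<and> (\<forall>v\<in>verts \<Gamma> - naked \<Gamma>. vidx \<Gamma>' (f v) = vidx \<Gamma> v)"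

lemma graph_iso_iff:
  "graph_iso f g \<Gamma> \<Gamma>' \<longleftrightarrow> shape_iso f g \<Gamma> \<Gamma>' \<and> (\<forall>v\<in>verts \<Gamma>. vidx \<Gamma>' (f v) = vidx \<Gamma> v)"
  by (auto simp: graph_iso_def shape_iso_def)

lemma shape_isoD:
  assumes "shape_iso f g \<Gamma> \<Gamma>'"
  shows si_f: "v \<in> verts \<Gamma> \<Longrightarrow> f v \<in> verts \<Gamma>'" and si_g: "e \<in> hedges \<Gamma> \<Longrightarrow> g e \<in> hedges \<Gamma>'"
    and si_f_surj: "verts \<Gamma>' = f ` verts \<Gamma>" and si_g_surj: "hedges \<Gamma>' = g ` hedges \<Gamma>"
    and si_f_inj: "inj_on f (verts \<Gamma>)" and si_g_inj: "inj_on g (hedges \<Gamma>)"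
    and si_invol: "e \<in> hedges \<Gamma> \<Longrightarrow> invol \<Gamma>' (g e) = g (invol \<Gamma> e)"
    and si_att: "e \<in> hedges \<Gamma> \<Longrightarrow> att \<Gamma>' (g e) = f (att \<Gamma> e)"
    and si_htype: "e \<in> hedges \<Gamma> \<Longrightarrow> htype \<Gamma>' (g e) = htype \<Gamma> e"
  using assms by (auto simp: shape_iso_def bij_betw_def)

lemma shape_iso_inv:
  assumes "is_fgraph T \<Gamma>" "shape_iso f g \<Gamma> \<Gamma>'"
  shows "shape_iso (inv_into (verts \<Gamma>) f) (inv_into (hedges \<Gamma>) g) \<Gamma>' \<Gamma>"
  unfolding shape_iso_def
proof (intro conjI ballI)
  show "bij_betw (inv_into (verts \<Gamma>) f) (verts \<Gamma>') (verts \<Gamma>)"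
    "bij_betw (inv_into (hedges \<Gamma>) g) (hedges \<Gamma>') (hedges \<Gamma>)"
    using assms(2) bij_betw_inv_into by (auto simp: shape_iso_def)
  fix e' assume "e' \<in> hedges \<Gamma>'"
  then obtain e where e: "e \<in> hedges \<Gamma>" "e' = g e" using si_g_surj[OF assms(2)] by auto
  note i = fg_invol_in[OF assms(1) e(1)] fg_att_in[OF assms(1) e(1)]
  note s = shape_isoD[OF assms(2)]
  show "inv_into (hedges \<Gamma>) g (invol \<Gamma>' e') = invol \<Gamma> (inv_into (hedges \<Gamma>) g e')"
    "inv_into (verts \<Gamma>) f (att \<Gamma>' e') = att \<Gamma> (inv_into (hedges \<Gamma>) g e')"
    "htype \<Gamma> (inv_into (hedges \<Gamma>) g e') = htype \<Gamma>' e'"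
    using e i by (simp_all add: s inv_into_f_f)
qed

lemma conn_shape_iso1:
  assumes "is_fgraph T \<Gamma>" "is_fgraph T \<Gamma>'" "shape_iso f g \<Gamma> \<Gamma>'" "(v, w) \<in> conn \<Gamma>"
  shows "(f v, f w) \<in> conn \<Gamma>'"
proof -
  note s = shape_isoD[OF assms(3)]
  have "conn \<Gamma> \<subseteq> {(v, w). (f v, f w) \<in> conn \<Gamma>'}"
  proof (rule conn_subsetI)
    show "trans {(v, w). (f v, f w) \<in> conn \<Gamma>'}"
      using trans_conn[of \<Gamma>'] unfolding trans_def by blast
    fix e assume e: "e \<in> hedges \<Gamma>"
    show "(att \<Gamma> e, att \<Gamma> (invol \<Gamma> e)) \<in> {(v, w). (f v, f w) \<in> conn \<Gamma>'}"
      using conn_edge[OF assms(2), of "g e"] fg_invol_in[OF assms(1) e] e by (simp add: s)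
  qed (auto intro: conn_refl s(1))
  then show ?thesis using assms(4) by auto
qed

lemma conn_shape_iso:
  assumes "is_fgraph T \<Gamma>" "is_fgraph T \<Gamma>'" "shape_iso f g \<Gamma> \<Gamma>'" "v \<in> verts \<Gamma>" "w \<in> verts \<Gamma>"
  shows "(f v, f w) \<in> conn \<Gamma>' \<longleftrightarrow> (v, w) \<in> conn \<Gamma>"
  using conn_shape_iso1[OF assms(1-3), of v w]
    conn_shape_iso1[OF assms(2,1) shape_iso_inv[OF assms(1,3)], of "f v" "f w"]
    assms(4,5) si_f_inj[OF assms(3)] by auto

lemma gcomp_shape_iso:
  assumes "is_fgraph T \<Gamma>" "is_fgraph T \<Gamma>'" "shape_iso f g \<Gamma> \<Gamma>'" "v \<in> verts \<Gamma>" "w \<in> verts \<Gamma>"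
  shows "f w \<in> gcomp \<Gamma>' (f v) \<longleftrightarrow> w \<in> gcomp \<Gamma> v"
  by (simp add: gcomp_iff conn_shape_iso[OF assms])

lemma external_shape_iso:
  assumes "is_fgraph T \<Gamma>" "shape_iso f g \<Gamma> \<Gamma>'"
  shows "external \<Gamma>' = g ` external \<Gamma>"
proof -
  have "g (invol \<Gamma> e) = g e \<longleftrightarrow> invol \<Gamma> e = e" if "e \<in> hedges \<Gamma>" for e
    using inj_on_eq_iff[OF si_g_inj[OF assms(2)] fg_invol_in[OF assms(1) that] that] .
  then show ?thesis
    using si_invol[OF assms(2)] by (auto simp: external_def si_g_surj[OF assms(2)])
qed

lemma rtype_shape_iso:
  assumes "is_fgraph T \<Gamma>" "is_fgraph T \<Gamma>'" "shape_iso f g \<Gamma> \<Gamma>'" "v \<in> verts \<Gamma>"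
  shows "rtype \<Gamma>' (f v) = rtype \<Gamma> v"
proof
  fix t
  note s = shape_isoD[OF assms(3)]
  let ?A = "{e \<in> external \<Gamma>. att \<Gamma> e \<in> gcomp \<Gamma> v \<and> htype \<Gamma> e = t}"
  have h: "external \<Gamma> \<subseteq> hedges \<Gamma>" by (auto simp: external_def)
  have "{e \<in> external \<Gamma>'. att \<Gamma>' e \<in> gcomp \<Gamma>' (f v) \<and> htype \<Gamma>' e = t} = g ` ?A"
    unfolding external_shape_iso[OF assms(1,3)]
    using h fg_att_in[OF assms(1)]
    by (auto simp: s gcomp_shape_iso[OF assms(1-4)] subset_iff image_iff)
  moreover have "inj_on g ?A" by (rule inj_on_subset[OF si_g_inj[OF assms(3)]]) (use h in auto)
  ultimately show "rtype \<Gamma>' (f v) t = rtype \<Gamma> v t" by (simp add: rtype_def card_image)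
qed

lemma naked_shape_iso:
  assumes "is_fgraph T \<Gamma>" "shape_iso f g \<Gamma> \<Gamma>'" "v \<in> verts \<Gamma>"
  shows "f v \<in> naked \<Gamma>' \<longleftrightarrow> v \<in> naked \<Gamma>"
proof -
  note s = shape_isoD[OF assms(2)]
  have "f (att \<Gamma> e) = f v \<longleftrightarrow> att \<Gamma> e = v" "g (invol \<Gamma> e) = g e \<longleftrightarrow> invol \<Gamma> e = e"
    if "e \<in> hedges \<Gamma>" for e
    using inj_on_eq_iff[OF s(5) fg_att_in[OF assms(1) that] assms(3)]
      inj_on_eq_iff[OF s(6) fg_invol_in[OF assms(1) that] that] .
  then show ?thesis using assms(3) by (auto simp: naked_def s(4,7,8) s(1))
qed

lemma bridgeless_shape_iso:
  assumes "is_fgraph T \<Gamma>" "is_fgraph T \<Gamma>'" "shape_iso f g \<Gamma> \<Gamma>'" "bridgeless \<Gamma>"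
  shows "bridgeless \<Gamma>'"
  unfolding bridgeless_def
proof (intro ballI impI)
  note s = shape_isoD[OF assms(3)]
  fix e' assume e': "e' \<in> hedges \<Gamma>'" "invol \<Gamma>' e' \<noteq> e'"
  then obtain e where e: "e \<in> hedges \<Gamma>" "e' = g e" using si_g_surj[OF assms(3)] by auto
  let ?S = "{e, invol \<Gamma> e}" and ?S' = "{e', invol \<Gamma>' e'}"
  have ie: "invol \<Gamma> e \<in> hedges \<Gamma>" by (rule fg_invol_in[OF assms(1) e(1)])
  have S: "g x \<in> ?S' \<longleftrightarrow> x \<in> ?S" if "x \<in> hedges \<Gamma>" for x
    using inj_on_eq_iff[OF s(6) that e(1)] inj_on_eq_iff[OF s(6) that ie] e by (simp add: s)
  have f1: "is_fgraph T (cut \<Gamma> ?S)" and f2: "is_fgraph T (cut \<Gamma>' ?S')"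
    using is_fgraph_cut1[OF assms(1) e(1)] is_fgraph_cut1[OF assms(2) e'(1)] by auto
  have "shape_iso f g (cut \<Gamma> ?S) (cut \<Gamma>' ?S')"
    using assms(3) S unfolding shape_iso_def by simp
  moreover have "(att \<Gamma> e, att \<Gamma> (invol \<Gamma> e)) \<in> conn (cut \<Gamma> ?S)"
    using assms(4) e e' by (auto simp: bridgeless_def s)
  ultimately have "(f (att \<Gamma> e), f (att \<Gamma> (invol \<Gamma> e))) \<in> conn (cut \<Gamma>' ?S')"
    using conn_shape_iso1[OF f1 f2] by blast
  then show "(att \<Gamma>' e', att \<Gamma>' (invol \<Gamma>' e')) \<in> conn (cut \<Gamma>' ?S')"
    using e ie by (simp add: s)
qed

section \<open>Transfer of coverings along isomorphisms\<close>

abbreviation Cov :: "'e ftheory \<Rightarrow> 'e sgraph \<Rightarrow> 'e sgraph set" where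
  "Cov T s \<equiv> {t. spec_covering T t s}"

lemma CovD:
  assumes "spec_covering T t s"
  shows cov_sp1: "specified T t" and cov_sp2: "specified T s" and cov_cov: "covering (fst t) (fst s)"
    and cov_full: "\<And>v. v \<in> verts (fst s) \<Longrightarrow> full (fst t) (fst s) v \<Longrightarrow>
      snd t (gcomp (fst t) v) = snd s (gcomp (fst s) v)"
  using assms by (auto simp: spec_covering_iff)

lemma Cov_refl:
  assumes "specified T s"
  shows "spec_covering T s s"
  using assms covering_refl by (auto simp: spec_covering_iff)

lemma full_cong:
  assumes "is_fgraph T \<gamma>" "(v, w) \<in> conn \<gamma>"
  shows "full \<gamma> \<Gamma> v \<longleftrightarrow> full \<gamma> \<Gamma> w"
  using gcomp_eqI[OF assms] by (simp add: full_def)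

lemma in_theory_covering:
  assumes "covering \<gamma> \<Gamma>"
  shows "in_theory T \<gamma> \<longleftrightarrow> in_theory T \<Gamma>"
  by (simp add: in_theory_def vtype_def star_def covering_simps[OF assms])

lemma rtype_full:
  assumes "is_fgraph T \<Gamma>" "covering \<gamma> \<Gamma>" "full \<gamma> \<Gamma> v" "v \<in> verts \<Gamma>"
  shows "rtype \<gamma> v = rtype \<Gamma> v"
proof -
  have "e \<in> external \<gamma> \<longleftrightarrow> e \<in> external \<Gamma>" if "att \<Gamma> e \<in> gcomp \<gamma> v" for e
    using assms(3) that by (auto simp: external_def full_def covering_simps[OF assms(2)])
  then show ?thesis
    unfolding rtype_def full_gcomp[OF assms, symmetric]
    by (auto simp: covering_simps[OF assms(2)] intro!: arg_cong[of _ _ card] ext)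
qed

text \<open>The cut is carried over by g. The indices cannot simply follow, because s and s' may be
  specified differently: on full components the value of s' is prescribed, elsewhere the value of t
  is read at the preimage of the least vertex.\<close>

definition cov_transfer ::
  "(nat \<Rightarrow> nat) \<Rightarrow> (nat \<Rightarrow> nat) \<Rightarrow> 'e sgraph \<Rightarrow> 'e sgraph \<Rightarrow> 'e sgraph \<Rightarrow> 'e sgraph" where
  "cov_transfer f g s s' t = (let \<gamma>' = cut (fst s') (g ` external (fst t)) in
     (\<gamma>', \<lambda>C\<in>gcomps \<gamma>'. if full \<gamma>' (fst s') (Min C) then snd s' (gcomp (fst s') (Min C))
        else snd t (gcomp (fst t) (inv_into (verts (fst s)) f (Min C)))))"

context
  fixes T :: "'e ftheory" and f g and s s' t :: "'e sgraph"
  assumes T: "valid_theory T" and ss': "specified T s" "specified T s'"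
    and iso: "graph_iso f g (fst s) (fst s')" and t: "spec_covering T t s"
begin

private abbreviation (input) "\<Gamma> \<equiv> fst s"
private abbreviation (input) "\<Gamma>' \<equiv> fst s'"
private abbreviation (input) "\<gamma> \<equiv> fst t"
private abbreviation (input) "t' \<equiv> cov_transfer f g s s' t"
private abbreviation (input) "\<gamma>' \<equiv> fst t'"

private lemma si: "shape_iso f g \<Gamma> \<Gamma>'"
  using iso by (simp add: graph_iso_iff)

private lemma fgs: "is_fgraph T \<Gamma>" "is_fgraph T \<Gamma>'" "covering \<gamma> \<Gamma>" "is_fgraph T \<gamma>"
  using T ss' t by (auto intro: sp_fgraph cov_sp1 cov_cov)

private lemma \<gamma>': "\<gamma>' = cut \<Gamma>' (g ` external \<gamma>)"
  by (simp add: cov_transfer_def Let_def)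

private lemma ext_hedges: "external \<gamma> \<subseteq> hedges \<Gamma>"
  using external_hedges[OF fgs(3)] by blast

lemma covering_transfer: "covering (fst (cov_transfer f g s s' t)) (fst s')"
proof -
  have "invol \<Gamma>' ` g ` external \<gamma> \<subseteq> g ` external \<gamma>"
    using covering_invol_external[OF fgs(1,3)] ext_hedges by (auto simp: si_invol[OF si])
  moreover have "g ` external \<gamma> \<subseteq> hedges \<Gamma>'" using ext_hedges si_g[OF si] by auto
  ultimately show ?thesis unfolding \<gamma>' covering_def by blast
qed

private lemma f': "is_fgraph T \<gamma>'"
  by (rule covering_is_fgraph[OF fgs(2) covering_transfer])

private lemma mem_ext: "e \<in> hedges \<Gamma> \<Longrightarrow> g e \<in> g ` external \<gamma> \<longleftrightarrow> e \<in> external \<gamma>"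
  using si_g_inj[OF si] ext_hedges by (meson inj_on_image_mem_iff)

lemma iso_transfer: "graph_iso f g (fst t) (fst (cov_transfer f g s s' t))"
  unfolding graph_iso_def \<gamma>'
  using iso mem_ext covering_simps[OF fgs(3)] covering_invol[OF fgs(3)]
  by (auto simp: graph_iso_def)

private lemma si': "shape_iso f g \<gamma> \<gamma>'"
  using iso_transfer by (simp add: graph_iso_iff)

lemma external_transfer: "external (fst (cov_transfer f g s s' t)) = g ` external (fst t)"
  by (rule external_shape_iso[OF fgs(4) si'])

lemma full_transfer:
  assumes "v \<in> verts (fst s)"
  shows "full (fst (cov_transfer f g s s' t)) (fst s') (f v) \<longleftrightarrow> full (fst t) (fst s) v"
proof -
  have eq: "invol \<gamma>' (g e) = invol \<Gamma>' (g e) \<longleftrightarrow> invol \<gamma> e = invol \<Gamma> e" if "e \<in> hedges \<Gamma>" for e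
  proof -
    have "e \<in> hedges \<gamma>" using that covering_simps[OF fgs(3)] by simp
    then have "invol \<gamma>' (g e) = g (invol \<gamma> e)" "invol \<gamma> e \<in> hedges \<Gamma>"
      using si_invol[OF si'] fg_invol_in[OF fgs(4), of e] covering_simps[OF fgs(3)] by auto
    then show ?thesis
      using si_invol[OF si that] si_g_inj[OF si] fg_invol_in[OF fgs(1) that] by (simp add: inj_on_eq_iff)
  qed
  have mem: "f (att \<Gamma> e) \<in> gcomp \<gamma>' (f v) \<longleftrightarrow> att \<Gamma> e \<in> gcomp \<gamma> v" if "e \<in> hedges \<Gamma>" for e
    using gcomp_shape_iso[OF fgs(4) f' si'] fg_att_in[OF fgs(1) that] assms covering_simps[OF fgs(3)]
    by simp
  show ?thesis unfolding full_def si_g_surj[OF si] using eq mem si_att[OF si] by auto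
qed

lemma snd_transfer:
  assumes "v \<in> verts (fst s)"
  shows "snd (cov_transfer f g s s' t) (gcomp (fst (cov_transfer f g s s' t)) (f v)) =
    (if full (fst t) (fst s) v then snd s' (gcomp (fst s') (f v)) else snd t (gcomp (fst t) v))"
proof -
  have fv: "f v \<in> verts \<gamma>'" using si_f[OF si assms] covering_simps[OF covering_transfer] by simp
  have c: "(f v, vmin \<gamma>' (f v)) \<in> conn \<gamma>'" by (rule vmin_conn[OF f' fv])
  have "vmin \<gamma>' (f v) \<in> verts \<Gamma>'" using vmin_in[OF f' fv] covering_simps[OF covering_transfer] by simp
  \<comment> \<open>The definition reads the index at the least vertex \<open>f w\<close> of the
    component, which need not be \<open>f v\<close>; v and w lie in one component of
    \<gamma>.\<close>
  then obtain w where w: "w \<in> verts \<Gamma>" "vmin \<gamma>' (f v) = f w" using si_f_surj[OF si] by auto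
  have "(v, w) \<in> conn \<gamma>"
    using conn_shape_iso[OF fgs(4) f' si', of v w] c w assms covering_simps[OF fgs(3)] by simp
  then have g: "gcomp \<gamma> w = gcomp \<gamma> v" using gcomp_eqI[OF fgs(4)] by metis
  have inv: "inv_into (verts \<Gamma>) f (f w) = w" using si_f_inj[OF si] w(1) by simp
  have g': "gcomp \<Gamma>' (f w) = gcomp \<Gamma>' (f v)"
    using gcomp_vmin_covering[OF fgs(2) covering_transfer, of "f v"] si_f[OF si assms] w(2) by simp
  have fu: "full \<gamma>' \<Gamma>' (f w) \<longleftrightarrow> full \<gamma> \<Gamma> v"
    using full_cong[OF f' c] full_transfer[OF assms] w(2) by simp
  have m: "Min (gcomp \<gamma>' (f v)) = f w" using w(2) by (simp add: vmin_def)
  have "gcomp \<gamma>' (f v) \<in> gcomps \<gamma>'" using fv by (simp add: gcomps_eq)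
  then have "snd t' (gcomp \<gamma>' (f v)) =
      (if full \<gamma>' \<Gamma>' (f w) then snd s' (gcomp \<Gamma>' (f w))
       else snd t (gcomp \<gamma> (inv_into (verts \<Gamma>) f (f w))))"
    unfolding m[symmetric] by (simp add: cov_transfer_def Let_def)
  then show ?thesis by (simp add: fu g' inv g)
qed

text \<open>On a full component the residue is the one in s', so the index of s' is admissible;
  elsewhere both the residue and the index come from t.\<close>

lemma Cov_transfer: "spec_covering T (cov_transfer f g s s' t) s'"
proof -
  note c = covering_simps[OF fgs(3)] and c' = covering_simps[OF covering_transfer]
  note sj = si_f_surj[OF si]
  have "specified T t'"
  proof (rule specifiedI[OF T f'])
    show "in_theory T \<gamma>'"
      using in_theory_covering[OF covering_transfer] sp_in_theory[OF T ss'(2)] by simp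
    show "bridgeless \<gamma>'"
      by (rule bridgeless_shape_iso[OF fgs(4) f' si' sp_bridgeless[OF T cov_sp1[OF t]]])
    show "snd t' \<in> extensional (gcomps \<gamma>')" by (simp add: cov_transfer_def Let_def)
    fix v' assume "v' \<in> verts \<gamma>'"
    then obtain v where v: "v \<in> verts \<Gamma>" "v' = f v" using c' sj by auto
    show "(rtype \<gamma>' v', snd t' (gcomp \<gamma>' v')) \<in> rvtypes T"
    proof (cases "full \<gamma> \<Gamma> v")
      case True
      then have "rtype \<gamma>' (f v) = rtype \<Gamma>' (f v)"
        using rtype_full[OF fgs(2) covering_transfer] full_transfer[OF v(1)] si_f[OF si v(1)] by simp
      then show ?thesis
        using sp_rtype[OF T ss'(2) si_f[OF si v(1)]] by (simp add: v(2) snd_transfer[OF v(1)] True)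
    next
      case False
      then show ?thesis
        using rtype_shape_iso[OF fgs(4) f' si', of v] sp_rtype[OF T cov_sp1[OF t], of v] v(1)
        by (simp add: v(2) snd_transfer[OF v(1)] c)
    qed
  next
    fix v' assume n: "v' \<in> naked \<gamma>'"
    then obtain v where v: "v \<in> verts \<Gamma>" "v' = f v" using c' sj by (auto simp: naked_def)
    show "snd t' (gcomp \<gamma>' v') = vidx \<gamma>' v'"
    proof (cases "full \<gamma> \<Gamma> v")
      case True
      then have "full \<gamma>' \<Gamma>' (f v)" using full_transfer[OF v(1)] by simp
      \<comment> \<open>Here \<gamma>' and \<Gamma>' have the same edges at the component, so the
        vertex is bare in \<Gamma>' as well and s' prescribes its index.\<close>
      then have "f v \<in> naked \<Gamma>'"
        using n v c' gcomp_self[of "f v" \<gamma>'] by (auto simp: naked_def full_def)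
      then show ?thesis
        using sp_naked[OF T ss'(2)] by (simp add: v(2) snd_transfer[OF v(1)] True c')
    next
      case False
      have "v \<in> naked \<gamma>" using n v naked_shape_iso[OF fgs(4) si', of v] c by simp
      then have "snd t (gcomp \<gamma> v) = vidx \<Gamma> v" using sp_naked[OF T cov_sp1[OF t]] c by simp
      then show ?thesis
        using False v iso by (simp add: snd_transfer c' graph_iso_def)
    qed
  qed
  moreover have "snd t' (gcomp \<gamma>' v') = snd s' (gcomp \<Gamma>' v')"
    if "v' \<in> verts \<Gamma>'" "full \<gamma>' \<Gamma>' v'" for v'
    using that sj snd_transfer full_transfer by auto
  ultimately show ?thesis
    using ss'(2) covering_transfer by (simp add: spec_covering_iff)
qed

text \<open>The transfer alters indices on full components only. These become vertices without
  internal edges, whose indices \<open>weak_iso\<close> ignores.\<close>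

lemma weak_iso_transfer:
  "\<exists>f'. weak_iso f' g (fst (spec_contract s t)) (fst (spec_contract s' (cov_transfer f g s s' t)))"
proof (intro exI)
  \<comment> \<open>f need not map least vertices to least vertices, so the image has to be
    relabelled by \<open>vmin\<close>.\<close>
  let ?f = "\<lambda>a. vmin \<gamma>' (f a)"
  let ?K = "fst (spec_contract s t)" and ?K' = "fst (spec_contract s' t')"
  note k = contract_simps[OF fgs(1,3)] and k' = contract_simps[OF fgs(2) covering_transfer]
  note c = covering_simps[OF fgs(3)] and c' = covering_simps[OF covering_transfer]
  note fs = fst_spec_contract
  have fv: "?f (vmin \<gamma> v) = vmin \<gamma>' (f v)" if "v \<in> verts \<Gamma>" for v
  proof -
    have "(f v, f (vmin \<gamma> v)) \<in> conn \<gamma>'"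
      using conn_shape_iso1[OF fgs(4) f' si' vmin_conn[OF fgs(4), of v]] that c by simp
    then show ?thesis using gcomp_eqI[OF f'] by (simp add: vmin_def)
  qed
  have "shape_iso ?f g ?K ?K'"
    unfolding shape_iso_def
  proof (intro conjI ballI)
    have "inj_on ?f (vmin \<gamma> ` verts \<Gamma>)"
    proof (rule inj_onI, clarify)
      fix v w assume vw: "v \<in> verts \<Gamma>" "w \<in> verts \<Gamma>" "?f (vmin \<gamma> v) = ?f (vmin \<gamma> w)"
      then have "(f v, f w) \<in> conn \<gamma>'"
        using vmin_eq_iff[OF f', of "f v" "f w"] si_f[OF si] by (simp add: fv c')
      then show "vmin \<gamma> v = vmin \<gamma> w"
        using conn_shape_iso[OF fgs(4) f' si', of v w] vmin_eq_iff[OF fgs(4), of v w] vw(1,2) c by simp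
    qed
    moreover have "?f ` vmin \<gamma> ` verts \<Gamma> = vmin \<gamma>' ` verts \<Gamma>'"
      unfolding si_f_surj[OF si] image_image using fv by (intro image_cong) auto
    ultimately show "bij_betw ?f (verts ?K) (verts ?K')"
      by (simp add: bij_betw_def fs k k')
    have "inj_on g (external \<gamma>)" using si_g_inj[OF si] ext_hedges by (rule inj_on_subset)
    then show "bij_betw g (hedges ?K) (hedges ?K')"
      by (simp add: bij_betw_def fs k k' external_transfer)
    fix e assume "e \<in> hedges ?K"
    then have e: "e \<in> external \<gamma>" by (simp add: fs k)
    then have ge: "g e \<in> external \<gamma>'" by (simp add: external_transfer)
    have h: "e \<in> hedges \<Gamma>" using e ext_hedges by auto
    show "g (invol ?K e) = invol ?K' (g e)" "?f (att ?K e) = att ?K' (g e)" "htype ?K' (g e) = htype ?K e"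
      using e ge h fg_att_in[OF fgs(1) h] fv
      by (simp_all add: fs k k' si_invol[OF si] si_att[OF si] si_htype[OF si])
  qed
  moreover have "vidx ?K' (?f a) = vidx ?K a" if a: "a \<in> verts ?K - naked ?K" for a
  proof -
    obtain v where v: "v \<in> verts \<Gamma>" "a = vmin \<gamma> v" using a by (auto simp: fs k)
    then have "\<not> full \<gamma> \<Gamma> v" using a naked_contract[OF fgs(1,3) v(1)] by (auto simp: fs)
    then show ?thesis
      using v snd_transfer[OF v(1)] si_f[OF si v(1)] by (simp add: fv fs k k')
  qed
  ultimately show "weak_iso ?f g ?K ?K'" by (simp add: weak_iso_def)
qed

end

lemma graph_iso_inv:
  assumes "is_fgraph T \<Gamma>" "graph_iso f g \<Gamma> \<Gamma>'"
  shows "graph_iso (inv_into (verts \<Gamma>) f) (inv_into (hedges \<Gamma>) g) \<Gamma>' \<Gamma>"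
proof -
  have si: "shape_iso f g \<Gamma> \<Gamma>'" using assms(2) by (simp add: graph_iso_iff)
  have "vidx \<Gamma> (inv_into (verts \<Gamma>) f v') = vidx \<Gamma>' v'" if "v' \<in> verts \<Gamma>'" for v'
    using that assms(2) si_f_inj[OF si] by (auto simp: si_f_surj[OF si] graph_iso_iff)
  then show ?thesis using shape_iso_inv[OF assms(1) si] by (simp add: graph_iso_iff)
qed

text \<open>The cut returns because l undoes g; on full components the index returns to that of s,
  which t carries as a covering. The maps k and l are parameters so that both round trips are
  instances.\<close>

lemma cov_transfer_inverse:
  fixes T :: "'e ftheory"
  assumes T: "valid_theory T" and ss': "specified T s" "specified T s'"
    and iso: "graph_iso f g (fst s) (fst s')" "graph_iso k l (fst s') (fst s)"
    and kf: "\<And>v. v \<in> verts (fst s) \<Longrightarrow> k (f v) = v" and lg: "\<And>e. e \<in> hedges (fst s) \<Longrightarrow> l (g e) = e"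
    and t: "spec_covering T t s"
  shows "cov_transfer k l s' s (cov_transfer f g s s' t) = t"
proof -
  let ?t' = "cov_transfer f g s s' t"
  let ?t = "cov_transfer k l s' s ?t'"
  note f = sp_fgraph[OF T ss'(1)]
  note C = Cov_transfer[OF T ss' iso(1) t]
  note c = cov_cov[OF t]
  have si: "shape_iso f g (fst s) (fst s')" using iso(1) by (simp add: graph_iso_iff)
  have 1: "fst ?t = fst t"
  proof (rule covering_eqI[OF f])
    show "covering (fst ?t) (fst s)" by (rule covering_transfer[OF T ss'(2,1) iso(2) C])
    show "covering (fst t) (fst s)" by (rule c)
    have "external (fst t) \<subseteq> hedges (fst s)" using external_hedges[OF c] by blast
    then show "external (fst ?t) = external (fst t)"
      unfolding external_transfer[OF T ss'(2,1) iso(2) C] external_transfer[OF T ss' iso(1) t] image_image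
      using lg by (simp add: subset_iff cong: image_cong_simp)
  qed
  show ?thesis
  proof (rule sgraph_eqI[OF 1])
    show "snd ?t \<in> extensional (gcomps (fst t))"
      using sp_ext[OF T cov_sp1[OF Cov_transfer[OF T ss'(2,1) iso(2) C]]] 1 by simp
    show "snd t \<in> extensional (gcomps (fst t))" by (rule sp_ext[OF T cov_sp1[OF t]])
    fix v assume "v \<in> verts (fst t)"
    then have v: "v \<in> verts (fst s)" using covering_simps[OF c] by simp
    have fv: "f v \<in> verts (fst s')" by (rule si_f[OF si v])
    have full: "full (fst ?t') (fst s') (f v) \<longleftrightarrow> full (fst t) (fst s) v"
      using full_transfer[OF T ss' iso(1) t v] .
    have "snd ?t (gcomp (fst ?t) (k (f v))) = (if full (fst t) (fst s) v then snd s (gcomp (fst s) v)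
        else snd t (gcomp (fst t) v))"
      unfolding snd_transfer[OF T ss'(2,1) iso(2) C fv] snd_transfer[OF T ss' iso(1) t v] full
      by (simp add: kf[OF v])
    then show "snd ?t (gcomp (fst t) v) = snd t (gcomp (fst t) v)"
      using cov_full[OF t v] by (simp add: 1 kf[OF v])
  qed
qed

text \<open>Lets the trivial covering be removed from the sums on both sides, as the recursion for
  the inverse requires.\<close>

lemma cov_transfer_top:
  assumes T: "valid_theory T" and ss': "specified T s" "specified T s'"
    and iso: "graph_iso f g (fst s) (fst s')"
  shows "cov_transfer f g s s' s = s'"
proof -
  note C = Cov_transfer[OF T ss' iso Cov_refl[OF ss'(1)]]
  note f = sp_fgraph[OF T ss'(1)] and f' = sp_fgraph[OF T ss'(2)]
  have si: "shape_iso f g (fst s) (fst s')" using iso by (simp add: graph_iso_iff)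
  have 1: "fst (cov_transfer f g s s' s) = fst s'"
    by (rule covering_eqI[OF f' cov_cov[OF C] covering_refl])
      (simp add: external_transfer[OF T ss' iso Cov_refl[OF ss'(1)]] external_shape_iso[OF f si])
  show ?thesis
  proof (rule sgraph_eqI[OF 1])
    show "snd (cov_transfer f g s s' s) \<in> extensional (gcomps (fst s'))"
      using sp_ext[OF T cov_sp1[OF C]] 1 by simp
    show "snd s' \<in> extensional (gcomps (fst s'))" by (rule sp_ext[OF T ss'(2)])
    fix v' assume "v' \<in> verts (fst s')"
    then show "snd (cov_transfer f g s s' s) (gcomp (fst s') v') = snd s' (gcomp (fst s') v')"
      using cov_full[OF C, of v'] by (simp add: 1 full_def)
  qed
qed

lemma bij_betw_Cov:
  assumes T: "valid_theory T" and ss': "specified T s" "specified T s'"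
    and iso: "graph_iso f g (fst s) (fst s')"
  shows "bij_betw (cov_transfer f g s s') (Cov T s) (Cov T s')"
proof -
  let ?\<Gamma> = "fst s" and ?\<Gamma>' = "fst s'"
  let ?k = "inv_into (verts ?\<Gamma>) f" and ?l = "inv_into (hedges ?\<Gamma>) g"
  note f = sp_fgraph[OF T ss'(1)]
  have si: "shape_iso f g ?\<Gamma> ?\<Gamma>'" using iso by (simp add: graph_iso_iff)
  have iso': "graph_iso ?k ?l ?\<Gamma>' ?\<Gamma>" by (rule graph_iso_inv[OF f iso])
  show ?thesis
  proof (rule bij_betw_byWitness[where f' = "cov_transfer ?k ?l s' s"])
    show "\<forall>t\<in>Cov T s. cov_transfer ?k ?l s' s (cov_transfer f g s s' t) = t"
      using cov_transfer_inverse[OF T ss' iso iso'] si_f_inj[OF si] si_g_inj[OF si] by simp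
    show "\<forall>t\<in>Cov T s'. cov_transfer f g s s' (cov_transfer ?k ?l s' s t) = t"
      using cov_transfer_inverse[OF T ss'(2,1) iso' iso]
      by (simp add: si_f_surj[OF si] si_g_surj[OF si] f_inv_into_f)
  qed (use Cov_transfer[OF T ss' iso] Cov_transfer[OF T ss'(2,1) iso'] in auto)
qed

section \<open>Restriction to unions of components and splitting of disjoint unions\<close>

section \<open>Disjoint unions\<close>

lemma closed_in_compl:
  assumes "is_fgraph T \<Gamma>" "closed_in \<Gamma> U"
  shows "closed_in \<Gamma> (verts \<Gamma> - U)"
  unfolding closed_in_def
proof (intro conjI ballI impI)
  fix e assume e: "e \<in> hedges \<Gamma>" "att \<Gamma> e \<in> verts \<Gamma> - U"
  have "att \<Gamma> (invol \<Gamma> e) \<notin> U"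
    using assms(2) e fg_invol_in[OF assms(1) e(1)] fg_invol_invol[OF assms(1) e(1)]
    by (auto simp: closed_in_def)
  then show "att \<Gamma> (invol \<Gamma> e) \<in> verts \<Gamma> - U"
    using fg_att_in[OF assms(1) fg_invol_in[OF assms(1) e(1)]] by simp
qed auto

lemma closed_in_iff:
  assumes "is_fgraph T \<Gamma>" "closed_in \<Gamma> U" "e \<in> hedges \<Gamma>"
  shows "att \<Gamma> (invol \<Gamma> e) \<in> U \<longleftrightarrow> att \<Gamma> e \<in> U"
  using assms(2) assms(3) fg_invol_in[OF assms(1,3)] fg_invol_invol[OF assms(1,3)]
  unfolding closed_in_def by metis

lemma closed_in_covering:
  assumes "covering \<gamma> \<Gamma>" "closed_in \<Gamma> U"
  shows "closed_in \<gamma> U"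
  using assms(2) covering_invol[OF assms(1)] covering_simps[OF assms(1)] by (simp add: closed_in_def)

lemma external_comp_graph: "external (comp_graph \<Gamma> U) = {e \<in> external \<Gamma>. att \<Gamma> e \<in> U}"
  by (auto simp: external_def)

lemma rtype_comp_graph:
  assumes "is_fgraph T \<Gamma>" "closed_in \<Gamma> U" "v \<in> U"
  shows "rtype (comp_graph \<Gamma> U) v = rtype \<Gamma> v"
proof
  fix t
  have "gcomp \<Gamma> v \<subseteq> U"
    using closed_in_conn[OF assms(2)] assms(3) by (auto simp: gcomp_iff)
  then have "{e \<in> external (comp_graph \<Gamma> U). att (comp_graph \<Gamma> U) e \<in> gcomp \<Gamma> v \<and>
        htype (comp_graph \<Gamma> U) e = t} = {e \<in> external \<Gamma>. att \<Gamma> e \<in> gcomp \<Gamma> v \<and> htype \<Gamma> e = t}"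
    unfolding external_comp_graph by (auto simp: external_def)
  then show "rtype (comp_graph \<Gamma> U) v t = rtype \<Gamma> v t"
    by (simp add: rtype_def gcomp_comp_graph[OF assms])
qed

lemma naked_comp_graph: "U \<subseteq> verts \<Gamma> \<Longrightarrow> naked (comp_graph \<Gamma> U) = naked \<Gamma> \<inter> U"
  by (auto simp: naked_def)

lemma in_theory_comp_graph:
  assumes "U \<subseteq> verts \<Gamma>"
  shows "in_theory T (comp_graph \<Gamma> U) \<longleftrightarrow> (\<forall>v\<in>U. (vtype \<Gamma> v, vidx \<Gamma> v) \<in> rvtypes T)"
proof -
  have "vtype (comp_graph \<Gamma> U) v = vtype \<Gamma> v" if "v \<in> U" for v
    unfolding vtype_def star_def
    using that by (intro ext arg_cong[of _ _ card]) auto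
  then show ?thesis using assms by (simp add: in_theory_def)
qed

lemma bridgeless_comp_graph:
  assumes "is_fgraph T \<Gamma>" "closed_in \<Gamma> U"
  shows "bridgeless (comp_graph \<Gamma> U) \<longleftrightarrow> (\<forall>e\<in>hedges \<Gamma>. att \<Gamma> e \<in> U \<longrightarrow> invol \<Gamma> e \<noteq> e \<longrightarrow>
     (att \<Gamma> e, att \<Gamma> (invol \<Gamma> e)) \<in> conn (cut \<Gamma> {e, invol \<Gamma> e}))"
proof -
  have "(att (comp_graph \<Gamma> U) e, att (comp_graph \<Gamma> U) (invol (comp_graph \<Gamma> U) e))
      \<in> conn (cut (comp_graph \<Gamma> U) {e, invol (comp_graph \<Gamma> U) e}) \<longleftrightarrow>
      (att \<Gamma> e, att \<Gamma> (invol \<Gamma> e)) \<in> conn (cut \<Gamma> {e, invol \<Gamma> e})"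
    if e: "e \<in> hedges \<Gamma>" "att \<Gamma> e \<in> U" for e
  proof -
    let ?G = "cut \<Gamma> {e, invol \<Gamma> e}"
    have fc: "is_fgraph T ?G" by (rule is_fgraph_cut1[OF assms(1) e(1)])
    have cl: "closed_in ?G U" using assms(2) by (auto simp: closed_in_def)
    have ie: "invol \<Gamma> e \<in> hedges \<Gamma>" "att \<Gamma> (invol \<Gamma> e) \<in> U"
      using fg_invol_in[OF assms(1) e(1)] assms(2) e by (auto simp: closed_in_def)
    have "cut (comp_graph \<Gamma> U) {e, invol (comp_graph \<Gamma> U) e} = comp_graph ?G U"
    proof (rule fgraph_eqI)
      show "is_fgraph T (cut (comp_graph \<Gamma> U) {e, invol (comp_graph \<Gamma> U) e})"
        by (rule is_fgraph_cut1[OF is_fgraph_comp_graph[OF assms]]) (use e in auto)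
      show "is_fgraph T (comp_graph ?G U)" by (rule is_fgraph_comp_graph[OF fc cl])
    qed (use e in auto)
    then show ?thesis using e ie conn_comp_graph[OF fc cl] by simp
  qed
  then show ?thesis by (auto simp: bridgeless_def)
qed

lemma covering_comp_graph:
  assumes "is_fgraph T \<Gamma>" "covering \<gamma> \<Gamma>" "closed_in \<Gamma> U"
  shows "covering (comp_graph \<gamma> U) (comp_graph \<Gamma> U)"
proof -
  note c = covering_simps[OF assms(2)]
  have "restrict (att \<gamma>) {e \<in> hedges \<gamma>. att \<gamma> e \<in> U} = restrict (att \<Gamma>) {e \<in> hedges \<Gamma>. att \<Gamma> e \<in> U}"
    by (simp add: c)
  then show ?thesis
    unfolding covering_iff[OF is_fgraph_comp_graph[OF assms(1,3)]]
    using is_fgraph_comp_graph[OF covering_is_fgraph[OF assms(1,2)] closed_in_covering[OF assms(2,3)]]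
      covering_invol[OF assms(2)]
    by (auto simp: c comp_graph_def Let_def)
qed

lemma full_comp_graph:
  assumes "is_fgraph T \<Gamma>" "covering \<gamma> \<Gamma>" "closed_in \<Gamma> U" "v \<in> U"
  shows "full (comp_graph \<gamma> U) (comp_graph \<Gamma> U) v \<longleftrightarrow> full \<gamma> \<Gamma> v"
proof -
  have "gcomp (comp_graph \<gamma> U) v = gcomp \<gamma> v"
    by (rule gcomp_comp_graph[OF covering_is_fgraph[OF assms(1,2)] closed_in_covering[OF assms(2,3)] assms(4)])
  moreover have "gcomp \<gamma> v \<subseteq> U"
    using closed_in_conn[OF closed_in_covering[OF assms(2,3)]] assms(4) by (auto simp: gcomp_iff)
  ultimately show ?thesis using covering_simps[OF assms(2)] by (auto simp: full_def)
qed

text \<open>Meant for U a union of components. Each component of the restriction is then a component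
  of s, so the specification only has to be restricted; on such parts this inverts
  \<open>sunion\<close>.\<close>

definition sub :: "'e sgraph \<Rightarrow> nat set \<Rightarrow> 'e sgraph" where
  "sub s U = (comp_graph (fst s) U, restrict (snd s) (gcomps (comp_graph (fst s) U)))"

lemma fst_sub [simp]: "fst (sub s U) = comp_graph (fst s) U"
  by (simp add: sub_def)

lemma snd_sub:
  assumes "is_fgraph T (fst s)" "closed_in (fst s) U" "v \<in> U"
  shows "snd (sub s U) (gcomp (comp_graph (fst s) U) v) = snd s (gcomp (fst s) v)"
proof -
  have "gcomp (comp_graph (fst s) U) v \<in> gcomps (comp_graph (fst s) U)"
    using assms(3) by (simp add: gcomps_eq)
  then show ?thesis by (simp add: sub_def gcomp_comp_graph[OF assms])
qed

lemma specified_sub: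
  assumes T: "valid_theory T" and "specified T s" "closed_in (fst s) U"
  shows "specified T (sub s U)"
proof (rule specifiedI[OF T])
  note f = sp_fgraph[OF T assms(2)]
  have U: "U \<subseteq> verts (fst s)" using assms(3) by (simp add: closed_in_def)
  show "is_fgraph T (fst (sub s U))" using is_fgraph_comp_graph[OF f assms(3)] by simp
  show "in_theory T (fst (sub s U))"
    using sp_in_theory[OF T assms(2)] U in_theory_comp_graph[OF U] by (auto simp: in_theory_def)
  show "bridgeless (fst (sub s U))"
    using sp_bridgeless[OF T assms(2)] bridgeless_comp_graph[OF f assms(3)] by (simp add: bridgeless_def)
  show "snd (sub s U) \<in> extensional (gcomps (fst (sub s U)))" by (simp add: sub_def)
  show "(rtype (fst (sub s U)) v, snd (sub s U) (gcomp (fst (sub s U)) v)) \<in> rvtypes T"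
    if "v \<in> verts (fst (sub s U))" for v
    using that sp_rtype[OF T assms(2), of v] U
    by (auto simp: snd_sub[OF f assms(3)] rtype_comp_graph[OF f assms(3)])
  show "snd (sub s U) (gcomp (fst (sub s U)) v) = vidx (fst (sub s U)) v"
    if "v \<in> naked (fst (sub s U))" for v
    using that sp_naked[OF T assms(2), of v] snd_sub[OF f assms(3), of v]
    by (auto simp: naked_comp_graph[OF U])
qed

lemma Cov_sub:
  assumes T: "valid_theory T" and t: "spec_covering T t s" and cl: "closed_in (fst s) U"
  shows "spec_covering T (sub t U) (sub s U)"
proof -
  note f = sp_fgraph[OF T cov_sp2[OF t]] and c = cov_cov[OF t]
  note g = sp_fgraph[OF T cov_sp1[OF t]]
  note cl' = closed_in_covering[OF c cl]
  have "snd (sub t U) (gcomp (comp_graph (fst t) U) v) = snd (sub s U) (gcomp (comp_graph (fst s) U) v)"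
    if "v \<in> U" "full (comp_graph (fst t) U) (comp_graph (fst s) U) v" for v
    using that cov_full[OF t, of v] cl full_comp_graph[OF f c cl]
    by (auto simp: snd_sub[OF f cl] snd_sub[OF g cl'] closed_in_def)
  then show ?thesis
    using specified_sub[OF T cov_sp1[OF t] cl'] specified_sub[OF T cov_sp2[OF t] cl]
      covering_comp_graph[OF f c cl] by (simp add: spec_covering_iff)
qed

lemma vmin_comp_graph:
  assumes "is_fgraph T \<Gamma>" "closed_in \<Gamma> U" "v \<in> U"
  shows "vmin (comp_graph \<Gamma> U) v = vmin \<Gamma> v"
  by (simp add: vmin_def gcomp_comp_graph[OF assms])

lemma closed_in_contract:
  assumes "is_fgraph T \<Gamma>" "covering \<gamma> \<Gamma>" "closed_in \<Gamma> U"
  shows "closed_in (contract \<Gamma> \<gamma> j) (U \<inter> verts (contract \<Gamma> \<gamma> j))"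
proof -
  let ?K = "contract \<Gamma> \<gamma> j"
  note fK = is_fgraph_contract[OF assms(1,2), of j]
  have "att ?K (invol ?K e) \<in> U \<inter> verts ?K"
    if "e \<in> hedges ?K" "att ?K e \<in> U \<inter> verts ?K" for e
    using conn_edge[OF fK that(1)] that closed_in_conn[OF assms(3), of "att ?K e"]
    unfolding conn_contract[OF assms(1,2)] by auto
  then show ?thesis by (auto simp: closed_in_def)
qed

lemma vmin_closed:
  assumes "is_fgraph T \<gamma>" "closed_in \<gamma> U" "v \<in> verts \<gamma>"
  shows "vmin \<gamma> v \<in> U \<longleftrightarrow> v \<in> U"
  using vmin_conn[OF assms(1,3)] conn_sym[OF assms(1)] closed_in_conn[OF assms(2)] by blast

text \<open>The least vertex of a component lies in U exactly when the component does, so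
  contraction commutes with restriction, labels included. This is the source of multiplicativity on
  contracted graphs.\<close>

lemma sub_spec_contract:
  assumes T: "valid_theory T" and t: "spec_covering T t s" and cl: "closed_in (fst s) U"
  shows "sub (spec_contract s t) (U \<inter> verts (fst (spec_contract s t))) = spec_contract (sub s U) (sub t U)"
proof -
  note f = sp_fgraph[OF T cov_sp2[OF t]] and c = cov_cov[OF t]
  note g = sp_fgraph[OF T cov_sp1[OF t]]
  note cl' = closed_in_covering[OF c cl]
  note cs = covering_simps[OF c]
  note fU = is_fgraph_comp_graph[OF f cl] and cU = covering_comp_graph[OF f c cl]
  note s = contract_simps[OF f c] and sU = contract_simps[OF fU cU]
  let ?K = "contract (fst s) (fst t) (snd t)"
  let ?U = "U \<inter> verts ?K"
  let ?L = "contract (comp_graph (fst s) U) (comp_graph (fst t) U) (snd (sub t U))"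
  have Us: "U \<subseteq> verts (fst s)" using cl by (simp add: closed_in_def)
  note clK = closed_in_contract[OF f c cl, of "snd t"]
  note fK = is_fgraph_contract[OF f c, of "snd t"]
  have vm: "vmin (comp_graph (fst t) U) v = vmin (fst t) v" if "v \<in> U" for v
    by (rule vmin_comp_graph[OF g cl' that])
  have vU: "vmin (fst t) v \<in> U \<longleftrightarrow> v \<in> U" if "v \<in> verts (fst s)" for v
    using vmin_closed[OF g cl'] that cs by simp
  have verts: "?U = vmin (comp_graph (fst t) U) ` U"
    using Us vU vm by (auto simp: s image_iff)
  have att: "vmin (fst t) (att (fst s) e) \<in> U \<longleftrightarrow> att (fst s) e \<in> U" if "e \<in> external (fst t)" for e
    using vU fg_att_in[OF f] external_hedges[OF c that] by auto
  have hedges: "{e \<in> external (fst t). vmin (fst t) (att (fst s) e) \<in> ?U} = external (comp_graph (fst t) U)"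
    using att fg_att_in[OF f] external_hedges[OF c] by (auto simp: external_comp_graph cs s)
  have eq: "comp_graph ?K ?U = ?L"
  proof (rule fgraph_eqI)
    show "is_fgraph T (comp_graph ?K ?U)" by (rule is_fgraph_comp_graph[OF fK clK])
    show "is_fgraph T ?L" by (rule is_fgraph_contract[OF fU cU])
    show "verts (comp_graph ?K ?U) = verts ?L" using verts by (simp add: sU)
    show "hedges (comp_graph ?K ?U) = hedges ?L"
      unfolding sU(2) hedges[symmetric] by (auto simp: s)
    fix e assume "e \<in> hedges ?L"
    then have e: "e \<in> external (fst t)" "att (fst s) e \<in> U" "e \<in> external (comp_graph (fst t) U)"
      by (auto simp: sU external_comp_graph cs)
    have h: "e \<in> hedges (fst s)" by (rule external_hedges[OF c e(1)])
    have a: "att ?K e \<in> ?U" using e hedges by (auto simp: s)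
    have h': "e \<in> hedges ?K" using e by (simp add: s)
    show "invol (comp_graph ?K ?U) e = invol ?L e" "att (comp_graph ?K ?U) e = att ?L e"
      "htype (comp_graph ?K ?U) e = htype ?L e"
      using e h a h' by (simp_all add: s sU vm)
  next
    fix a assume "a \<in> verts ?L"
    then obtain v where v: "v \<in> U" "a = vmin (fst t) v" by (auto simp: sU vm)
    have "a \<in> ?U" using v vU Us by (auto simp: s)
    then have "vidx (comp_graph ?K ?U) a = vidx ?K a" by (rule comp_graph_simps(6))
    also have "\<dots> = snd t (gcomp (fst t) v)" using v Us s(6)[of v "snd t"] by auto
    finally have "vidx (comp_graph ?K ?U) a = snd t (gcomp (fst t) v)" .
    moreover have "vidx ?L a = snd (sub t U) (gcomp (comp_graph (fst t) U) v)"
      using sU(6)[of v] v by (simp add: vm)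
    ultimately show "vidx (comp_graph ?K ?U) a = vidx ?L a"
      by (simp add: snd_sub[OF g cl' v(1)])
  qed
  have fs: "fst (spec_contract s t) = ?K" "fst (spec_contract (sub s U) (sub t U)) = ?L"
    by (simp_all add: fst_spec_contract)
  show ?thesis
  proof (rule sgraph_eqI)
    show "fst (sub (spec_contract s t) (U \<inter> verts (fst (spec_contract s t)))) =
        fst (spec_contract (sub s U) (sub t U))"
      using eq by (simp add: fs)
    show "snd (spec_contract (sub s U) (sub t U))
        \<in> extensional (gcomps (fst (spec_contract (sub s U) (sub t U))))"
      by (rule snd_spec_contract_ext)
    show "snd (sub (spec_contract s t) (U \<inter> verts (fst (spec_contract s t))))
        \<in> extensional (gcomps (fst (spec_contract (sub s U) (sub t U))))"
      unfolding sub_def[of "spec_contract s t"] using eq by (simp add: fs)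
    fix a assume a: "a \<in> verts (fst (spec_contract (sub s U) (sub t U)))"
    then have aU: "a \<in> ?U" unfolding fs using verts by (simp add: sU)
    have "snd (sub (spec_contract s t) ?U) (gcomp (comp_graph (fst (spec_contract s t)) ?U) a)
        = snd s (gcomp (fst s) a)"
      using snd_sub[of T "spec_contract s t", unfolded fs, OF fK clK aU]
        snd_spec_contract[OF f c, of a] aU by (simp add: fs)
    moreover have "snd (spec_contract (sub s U) (sub t U))
        (gcomp (fst (spec_contract (sub s U) (sub t U))) a) = snd s (gcomp (fst s) a)"
      using snd_spec_contract[of T "sub s U" "sub t U" a] a fU cU aU snd_sub[OF f cl, of a] by simp
    ultimately show "snd (sub (spec_contract s t) (U \<inter> verts (fst (spec_contract s t))))
        (gcomp (fst (spec_contract (sub s U) (sub t U))) a) =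
      snd (spec_contract (sub s U) (sub t U)) (gcomp (fst (spec_contract (sub s U) (sub t U))) a)"
      by (simp add: fs eq)
  qed
qed

subsection \<open>The union of two graphs\<close>

lemma gunion_simps [simp]:
  "verts (gunion \<Gamma> \<Gamma>') = verts \<Gamma> \<union> verts \<Gamma>'" "hedges (gunion \<Gamma> \<Gamma>') = hedges \<Gamma> \<union> hedges \<Gamma>'"
  "invol (gunion \<Gamma> \<Gamma>') e = (if e \<in> hedges \<Gamma> then invol \<Gamma> e else invol \<Gamma>' e)"
  "att (gunion \<Gamma> \<Gamma>') e = (if e \<in> hedges \<Gamma> then att \<Gamma> e else att \<Gamma>' e)"
  "htype (gunion \<Gamma> \<Gamma>') e = (if e \<in> hedges \<Gamma> then htype \<Gamma> e else htype \<Gamma>' e)"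
  "vidx (gunion \<Gamma> \<Gamma>') v = (if v \<in> verts \<Gamma> then vidx \<Gamma> v else vidx \<Gamma>' v)"
  by (auto simp: gunion_def)

lemma gdisjoint_sym: "gdisjoint \<Gamma> \<Gamma>' \<Longrightarrow> gdisjoint \<Gamma>' \<Gamma>"
  by (auto simp: gdisjoint_def)

lemma is_fgraph_gunion:
  assumes "is_fgraph T \<Gamma>" "is_fgraph T \<Gamma>'" "gdisjoint \<Gamma> \<Gamma>'"
  shows "is_fgraph T (gunion \<Gamma> \<Gamma>')"
proof (rule is_fgraphI)
  note f = is_fgraphD[OF assms(1)] and f' = is_fgraphD[OF assms(2)]
  show "finite (verts (gunion \<Gamma> \<Gamma>'))" "finite (hedges (gunion \<Gamma> \<Gamma>'))" using f f' by auto
  show "invol (gunion \<Gamma> \<Gamma>') \<in> extensional (hedges (gunion \<Gamma> \<Gamma>'))"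
    "att (gunion \<Gamma> \<Gamma>') \<in> extensional (hedges (gunion \<Gamma> \<Gamma>'))"
    "htype (gunion \<Gamma> \<Gamma>') \<in> extensional (hedges (gunion \<Gamma> \<Gamma>'))"
    "vidx (gunion \<Gamma> \<Gamma>') \<in> extensional (verts (gunion \<Gamma> \<Gamma>'))"
    using f(8-11) f'(8-11) by (auto simp: extensional_def)
  fix e assume "e \<in> hedges (gunion \<Gamma> \<Gamma>')"
  then consider "e \<in> hedges \<Gamma>" | "e \<in> hedges \<Gamma>'" "e \<notin> hedges \<Gamma>" by auto
  then show "invol (gunion \<Gamma> \<Gamma>') e \<in> hedges (gunion \<Gamma> \<Gamma>')"
    "invol (gunion \<Gamma> \<Gamma>') (invol (gunion \<Gamma> \<Gamma>') e) = e"
    "att (gunion \<Gamma> \<Gamma>') e \<in> verts (gunion \<Gamma> \<Gamma>')" "htype (gunion \<Gamma> \<Gamma>') e \<in> etypes T"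
    "htype (gunion \<Gamma> \<Gamma>') (invol (gunion \<Gamma> \<Gamma>') e) = htype (gunion \<Gamma> \<Gamma>') e"
    using assms(3) f f'(3)[of e] f'(4-7)[of e] by (atomize(full), cases) (auto simp: gdisjoint_def)
qed

text \<open>Turns each statement on the first part of a union into one on the second part.\<close>

lemma gunion_commute:
  assumes "is_fgraph T \<Gamma>" "is_fgraph T \<Gamma>'" "gdisjoint \<Gamma> \<Gamma>'"
  shows "gunion \<Gamma> \<Gamma>' = gunion \<Gamma>' \<Gamma>"
  by (rule fgraph_eqI[OF is_fgraph_gunion[OF assms] is_fgraph_gunion[OF assms(2,1) gdisjoint_sym[OF assms(3)]]])
    (use assms(3) in \<open>auto simp: gdisjoint_def\<close>)

lemma closed_in_gunion:
  assumes "is_fgraph T \<Gamma>" "is_fgraph T \<Gamma>'" "gdisjoint \<Gamma> \<Gamma>'"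
  shows "closed_in (gunion \<Gamma> \<Gamma>') (verts \<Gamma>)"
  unfolding closed_in_def using assms(3) fg_att_in[OF assms(1)] fg_att_in[OF assms(2)] fg_invol_in[OF assms(1)]
  by (auto simp: gdisjoint_def)

lemma comp_graph_gunion:
  assumes "is_fgraph T \<Gamma>" "is_fgraph T \<Gamma>'" "gdisjoint \<Gamma> \<Gamma>'"
  shows "comp_graph (gunion \<Gamma> \<Gamma>') (verts \<Gamma>) = \<Gamma>"
proof (rule fgraph_eqI[OF is_fgraph_comp_graph[OF is_fgraph_gunion[OF assms] closed_in_gunion[OF assms]] assms(1)])
  show "hedges (comp_graph (gunion \<Gamma> \<Gamma>') (verts \<Gamma>)) = hedges \<Gamma>"
    using assms(3) fg_att_in[OF assms(1)] fg_att_in[OF assms(2)] by (auto simp: gdisjoint_def)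
qed (use assms(3) fg_att_in[OF assms(1)] in auto)

lemma comp_graph_gunion2:
  assumes "is_fgraph T \<Gamma>" "is_fgraph T \<Gamma>'" "gdisjoint \<Gamma> \<Gamma>'"
  shows "closed_in (gunion \<Gamma> \<Gamma>') (verts \<Gamma>')" "comp_graph (gunion \<Gamma> \<Gamma>') (verts \<Gamma>') = \<Gamma>'"
  using comp_graph_gunion[OF assms(2,1) gdisjoint_sym[OF assms(3)]]
    closed_in_gunion[OF assms(2,1) gdisjoint_sym[OF assms(3)]]
  by (simp_all add: gunion_commute[OF assms])

lemma gunion_comp_graph:
  assumes "is_fgraph T \<Gamma>" "closed_in \<Gamma> U"
  shows "gunion (comp_graph \<Gamma> U) (comp_graph \<Gamma> (verts \<Gamma> - U)) = \<Gamma>"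
    "gdisjoint (comp_graph \<Gamma> U) (comp_graph \<Gamma> (verts \<Gamma> - U))"
proof -
  note f = is_fgraph_comp_graph[OF assms] is_fgraph_comp_graph[OF assms(1) closed_in_compl[OF assms]]
  show d: "gdisjoint (comp_graph \<Gamma> U) (comp_graph \<Gamma> (verts \<Gamma> - U))" by (auto simp: gdisjoint_def)
  have U: "U \<subseteq> verts \<Gamma>" using assms(2) by (simp add: closed_in_def)
  show "gunion (comp_graph \<Gamma> U) (comp_graph \<Gamma> (verts \<Gamma> - U)) = \<Gamma>"
    by (rule fgraph_eqI[OF is_fgraph_gunion[OF f d] assms(1)])
      (use U fg_att_in[OF assms(1)] in auto)
qed

lemma fst_sunion [simp]: "fst (sunion s s') = gunion (fst s) (fst s')"
  by (cases s; cases s') (simp add: sunion_def)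

lemma snd_sunion: "snd (sunion s s') C = (if C \<in> gcomps (fst s) then snd s C else snd s' C)"
  by (cases s; cases s') (simp add: sunion_def)

lemma gcomp_gunion:
  assumes "is_fgraph T \<Gamma>" "is_fgraph T \<Gamma>'" "gdisjoint \<Gamma> \<Gamma>'"
  shows "v \<in> verts \<Gamma> \<Longrightarrow> gcomp (gunion \<Gamma> \<Gamma>') v = gcomp \<Gamma> v"
    "v \<in> verts \<Gamma>' \<Longrightarrow> gcomp (gunion \<Gamma> \<Gamma>') v = gcomp \<Gamma>' v"
    "v \<in> verts \<Gamma>' \<Longrightarrow> gcomp \<Gamma>' v \<notin> gcomps \<Gamma>"
proof -
  show "gcomp (gunion \<Gamma> \<Gamma>') v = gcomp \<Gamma> v" if "v \<in> verts \<Gamma>" for v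
    using gcomp_comp_graph[OF is_fgraph_gunion[OF assms] closed_in_gunion[OF assms] that]
      comp_graph_gunion[OF assms] by simp
  show "gcomp (gunion \<Gamma> \<Gamma>') v = gcomp \<Gamma>' v" if "v \<in> verts \<Gamma>'" for v
    using gcomp_comp_graph[OF is_fgraph_gunion[OF assms] comp_graph_gunion2(1)[OF assms] that]
      comp_graph_gunion2(2)[OF assms] by simp
  show "gcomp \<Gamma>' v \<notin> gcomps \<Gamma>" if "v \<in> verts \<Gamma>'" for v
    using gcomp_self[OF that] gcomp_subset[of \<Gamma>] assms(3) that
    by (fastforce simp: gcomps_eq gdisjoint_def)
qed

lemma snd_sunion_gcomp:
  assumes "is_fgraph T (fst s)" "is_fgraph T (fst s')" "gdisjoint (fst s) (fst s')"
  shows "v \<in> verts (fst s) \<Longrightarrow> snd (sunion s s') (gcomp (fst (sunion s s')) v) = snd s (gcomp (fst s) v)"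
    "v \<in> verts (fst s') \<Longrightarrow> snd (sunion s s') (gcomp (fst (sunion s s')) v) = snd s' (gcomp (fst s') v)"
  using gcomp_gunion[OF assms] by (auto simp: snd_sunion gcomps_eq)

lemma gcomps_gunion:
  assumes "is_fgraph T \<Gamma>" "is_fgraph T \<Gamma>'" "gdisjoint \<Gamma> \<Gamma>'"
  shows "gcomps (gunion \<Gamma> \<Gamma>') = gcomps \<Gamma> \<union> gcomps \<Gamma>'"
  using gcomp_gunion(1,2)[OF assms] by (auto simp: gcomps_eq image_iff) blast+

text \<open>Every requirement concerns a single vertex, edge or component, so it is checked in the
  restriction to one of the two parts.\<close>

lemma specified_sunion:
  assumes T: "valid_theory T" and s: "specified T s" "specified T s'" and d: "gdisjoint (fst s) (fst s')"
  shows "specified T (sunion s s')"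
proof (rule specifiedI[OF T])
  note f = sp_fgraph[OF T s(1)] and f' = sp_fgraph[OF T s(2)]
  note fu = is_fgraph_gunion[OF f f' d]
  let ?G = "gunion (fst s) (fst s')"
  note cl = closed_in_gunion[OF f f' d] comp_graph_gunion2(1)[OF f f' d]
  note cg = comp_graph_gunion[OF f f' d] comp_graph_gunion2(2)[OF f f' d]
  show "is_fgraph T (fst (sunion s s'))" using fu by simp
  show "in_theory T (fst (sunion s s'))"
    using in_theory_comp_graph[of "verts (fst s)" ?G T] in_theory_comp_graph[of "verts (fst s')" ?G T]
      sp_in_theory[OF T s(1)] sp_in_theory[OF T s(2)] cg by (auto simp: in_theory_def[of T ?G])
  have "\<forall>e\<in>hedges ?G. att ?G e \<in> verts (fst s) \<union> verts (fst s')" using fg_att_in[OF fu] by simp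
  then show "bridgeless (fst (sunion s s'))"
    using bridgeless_comp_graph[OF fu cl(1)] bridgeless_comp_graph[OF fu cl(2)]
      sp_bridgeless[OF T s(1)] sp_bridgeless[OF T s(2)] unfolding cg fst_sunion bridgeless_def[of ?G]
    by blast
  show "snd (sunion s s') \<in> extensional (gcomps (fst (sunion s s')))"
    using sp_ext[OF T s(1)] sp_ext[OF T s(2)] gcomps_gunion[OF f f' d]
    by (auto simp: extensional_def snd_sunion)
  fix v
  show "(rtype (fst (sunion s s')) v, snd (sunion s s') (gcomp (fst (sunion s s')) v)) \<in> rvtypes T"
    if "v \<in> verts (fst (sunion s s'))"
  proof (cases "v \<in> verts (fst s)")
    case True
    then show ?thesis
      using sp_rtype[OF T s(1) True] snd_sunion_gcomp(1)[OF f f' d True]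
        rtype_comp_graph[OF fu cl(1) True] cg by simp
  next
    case False
    then have v: "v \<in> verts (fst s')" using that by simp
    show ?thesis
      using sp_rtype[OF T s(2) v] snd_sunion_gcomp(2)[OF f f' d v]
        rtype_comp_graph[OF fu cl(2) v] cg by simp
  qed
  show "snd (sunion s s') (gcomp (fst (sunion s s')) v) = vidx (fst (sunion s s')) v"
    if n: "v \<in> naked (fst (sunion s s'))"
  proof (cases "v \<in> verts (fst s)")
    case True
    then have "v \<in> naked (fst s)" using n naked_comp_graph[of "verts (fst s)" ?G] cg by auto
    then show ?thesis using sp_naked[OF T s(1)] snd_sunion_gcomp(1)[OF f f' d True] True by simp
  next
    case False
    then have v: "v \<in> verts (fst s')" using n by (simp add: naked_def)
    have "v \<in> naked (fst s')" using v n naked_comp_graph[of "verts (fst s')" ?G] cg by auto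
    then show ?thesis using sp_naked[OF T s(2)] snd_sunion_gcomp(2)[OF f f' d v] False by simp
  qed
qed

lemma sub_sunion:
  assumes T: "valid_theory T" and s: "specified T s" "specified T s'" and d: "gdisjoint (fst s) (fst s')"
  shows "sub (sunion s s') (verts (fst s)) = s" "sub (sunion s s') (verts (fst s')) = s'"
proof -
  note f = sp_fgraph[OF T s(1)] and f' = sp_fgraph[OF T s(2)]
  note cl = closed_in_gunion[OF f f' d] comp_graph_gunion2(1)[OF f f' d]
  note cg = comp_graph_gunion[OF f f' d] comp_graph_gunion2(2)[OF f f' d]
  note sp = specified_sunion[OF T s d]
  note fu = sp_fgraph[OF T sp]
  show "sub (sunion s s') (verts (fst s)) = s"
  proof (rule sgraph_eqI)
    show "fst (sub (sunion s s') (verts (fst s))) = fst s" by (simp add: cg)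
    show "snd (sub (sunion s s') (verts (fst s))) \<in> extensional (gcomps (fst s))"
      by (simp add: sub_def cg)
    show "snd s \<in> extensional (gcomps (fst s))" by (rule sp_ext[OF T s(1)])
    show "snd (sub (sunion s s') (verts (fst s))) (gcomp (fst s) v) = snd s (gcomp (fst s) v)"
      if "v \<in> verts (fst s)" for v
      using snd_sub[OF fu, of "verts (fst s)" v] cl that snd_sunion_gcomp(1)[OF f f' d that]
      by (simp add: cg)
  qed
  show "sub (sunion s s') (verts (fst s')) = s'"
  proof (rule sgraph_eqI)
    show "fst (sub (sunion s s') (verts (fst s'))) = fst s'" by (simp add: cg)
    show "snd (sub (sunion s s') (verts (fst s'))) \<in> extensional (gcomps (fst s'))"
      by (simp add: sub_def cg)
    show "snd s' \<in> extensional (gcomps (fst s'))" by (rule sp_ext[OF T s(2)])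
    show "snd (sub (sunion s s') (verts (fst s'))) (gcomp (fst s') v) = snd s' (gcomp (fst s') v)"
      if "v \<in> verts (fst s')" for v
      using snd_sub[OF fu, of "verts (fst s')" v] cl that snd_sunion_gcomp(2)[OF f f' d that]
      by (simp add: cg)
  qed
qed

lemma sunion_sub:
  assumes T: "valid_theory T" and s: "specified T s" and cl: "closed_in (fst s) U"
  shows "sunion (sub s U) (sub s (verts (fst s) - U)) = s"
proof -
  note f = sp_fgraph[OF T s]
  note cl' = closed_in_compl[OF f cl]
  note u = gunion_comp_graph[OF f cl]
  note s12 = specified_sub[OF T s cl] specified_sub[OF T s cl']
  have sp: "specified T (sunion (sub s U) (sub s (verts (fst s) - U)))"
    by (rule specified_sunion[OF T s12]) (use u in simp)
  show ?thesis
  proof (rule sgraph_eqI)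
    show eq: "fst (sunion (sub s U) (sub s (verts (fst s) - U))) = fst s" using u by simp
    show "snd (sunion (sub s U) (sub s (verts (fst s) - U))) \<in> extensional (gcomps (fst s))"
      using sp_ext[OF T sp] eq by simp
    show "snd s \<in> extensional (gcomps (fst s))" by (rule sp_ext[OF T s])
    fix v assume v: "v \<in> verts (fst s)"
    note ss = snd_sunion_gcomp[of T "sub s U" "sub s (verts (fst s) - U)" v]
    show "snd (sunion (sub s U) (sub s (verts (fst s) - U))) (gcomp (fst s) v) = snd s (gcomp (fst s) v)"
      using ss sp_fgraph[OF T s12(1)] sp_fgraph[OF T s12(2)] u v snd_sub[OF f cl, of v] snd_sub[OF f cl', of v]
      by (cases "v \<in> U") simp_all
  qed
qed

lemma Cov_sunion:
  assumes T: "valid_theory T" and t: "spec_covering T t s" "spec_covering T t' s'"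
    and d: "gdisjoint (fst s) (fst s')"
  shows "spec_covering T (sunion t t') (sunion s s')"
proof -
  note c = cov_cov[OF t(1)] and c' = cov_cov[OF t(2)]
  note cs = covering_simps[OF c] and cs' = covering_simps[OF c']
  note s = cov_sp2[OF t(1)] cov_sp2[OF t(2)]
  note tt = cov_sp1[OF t(1)] cov_sp1[OF t(2)]
  have dt: "gdisjoint (fst t) (fst t')" using d by (simp add: gdisjoint_def cs cs')
  note sps = specified_sunion[OF T s d] and spt = specified_sunion[OF T tt dt]
  note f = sp_fgraph[OF T s(1)] sp_fgraph[OF T s(2)] and g = sp_fgraph[OF T tt(1)] sp_fgraph[OF T tt(2)]
  have cov: "covering (fst (sunion t t')) (fst (sunion s s'))"
    unfolding covering_iff[OF sp_fgraph[OF T sps]]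
    using sp_fgraph[OF T spt] covering_invol[OF c] covering_invol[OF c'] cs cs'
    by (auto simp: gunion_def fun_eq_iff)
  note cl = closed_in_gunion[OF f d] comp_graph_gunion2(1)[OF f d]
  note cg = comp_graph_gunion[OF f d] comp_graph_gunion2(2)[OF f d]
  note cgt = comp_graph_gunion[OF g dt] comp_graph_gunion2(2)[OF g dt]
  note fu = sp_fgraph[OF T sps]
  have full1: "full (fst t) (fst s) v \<longleftrightarrow> full (fst (sunion t t')) (fst (sunion s s')) v"
    if "v \<in> verts (fst s)" for v
    using full_comp_graph[OF fu cov, of "verts (fst s)" v] cl that cg cgt by (simp add: cs)
  have full2: "full (fst t') (fst s') v \<longleftrightarrow> full (fst (sunion t t')) (fst (sunion s s')) v"
    if "v \<in> verts (fst s')" for v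
    using full_comp_graph[OF fu cov, of "verts (fst s')" v] cl that cg cgt by (simp add: cs')
  have "snd (sunion t t') (gcomp (fst (sunion t t')) v) = snd (sunion s s') (gcomp (fst (sunion s s')) v)"
    if v: "v \<in> verts (fst (sunion s s'))" "full (fst (sunion t t')) (fst (sunion s s')) v" for v
  proof (cases "v \<in> verts (fst s)")
    case True
    then show ?thesis
      using snd_sunion_gcomp(1)[OF f d True] snd_sunion_gcomp(1)[OF g dt, of v] full1 v cov_full[OF t(1)]
      by (simp add: cs)
  next
    case False
    then have v': "v \<in> verts (fst s')" using v by simp
    show ?thesis
      using snd_sunion_gcomp(2)[OF f d v'] snd_sunion_gcomp(2)[OF g dt, of v] full2[OF v'] v v' cov_full[OF t(2)]
      by (simp add: cs')
  qed
  then show ?thesis using sps spt cov by (simp add: spec_covering_iff)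
qed

text \<open>No edge joins the two parts, so a covering of the union is recovered from its
  restrictions to their vertex sets.\<close>

lemma bij_betw_Cov_sunion:
  assumes T: "valid_theory T" and s: "specified T s" "specified T s'" and d: "gdisjoint (fst s) (fst s')"
  shows "bij_betw (\<lambda>(t, t'). sunion t t') (Cov T s \<times> Cov T s') (Cov T (sunion s s'))"
proof -
  let ?u = "sunion s s'"
  note f = sp_fgraph[OF T s(1)] and f' = sp_fgraph[OF T s(2)]
  note sp = specified_sunion[OF T s d]
  have cl: "closed_in (fst ?u) (verts (fst s))" "closed_in (fst ?u) (verts (fst s'))"
    using closed_in_gunion[OF f f' d] comp_graph_gunion2(1)[OF f f' d] by simp_all
  note sub = sub_sunion[OF T s d]
  have co: "verts (fst ?u) - verts (fst s) = verts (fst s')" using d by (auto simp: gdisjoint_def)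
  show ?thesis
  proof (rule bij_betw_byWitness[where f' = "\<lambda>t. (sub t (verts (fst s)), sub t (verts (fst s')))"])
    have "sub (sunion t t') (verts (fst s)) = t \<and> sub (sunion t t') (verts (fst s')) = t'"
      if t: "spec_covering T t s" "spec_covering T t' s'" for t t'
    proof -
      have "verts (fst t) = verts (fst s)" "verts (fst t') = verts (fst s')"
        "hedges (fst t) = hedges (fst s)" "hedges (fst t') = hedges (fst s')"
        using covering_simps[OF cov_cov[OF t(1)]] covering_simps[OF cov_cov[OF t(2)]] by auto
      then show ?thesis
        using sub_sunion[OF T cov_sp1[OF t(1)] cov_sp1[OF t(2)]] d by (simp add: gdisjoint_def)
    qed
    then show "\<forall>a\<in>Cov T s \<times> Cov T s'. (sub (case a of (t, t') \<Rightarrow> sunion t t') (verts (fst s)),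
        sub (case a of (t, t') \<Rightarrow> sunion t t') (verts (fst s'))) = a"
      by auto
    have "sunion (sub t (verts (fst s))) (sub t (verts (fst s'))) = t" if t: "spec_covering T t ?u" for t
      using sunion_sub[OF T cov_sp1[OF t] closed_in_covering[OF cov_cov[OF t] cl(1)]]
        covering_simps(1)[OF cov_cov[OF t]] co by simp
    then show "\<forall>t\<in>Cov T ?u. (case (sub t (verts (fst s)), sub t (verts (fst s'))) of (t, t') \<Rightarrow> sunion t t') = t"
      by simp
    show "(\<lambda>(t, t'). sunion t t') ` (Cov T s \<times> Cov T s') \<subseteq> Cov T ?u"
      using Cov_sunion[OF T _ _ d] by auto
    show "(\<lambda>t. (sub t (verts (fst s)), sub t (verts (fst s')))) ` Cov T ?u \<subseteq> Cov T s \<times> Cov T s'"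
      using Cov_sub[OF T _ cl(1)] Cov_sub[OF T _ cl(2)] by (auto simp: sub)
  qed
qed

text \<open>The contraction of the union splits along the vertices of s, and
  \<open>sub_spec_contract\<close> identifies each of the two pieces.\<close>

lemma spec_contract_sunion:
  assumes T: "valid_theory T" and t: "spec_covering T t s" "spec_covering T t' s'"
    and d: "gdisjoint (fst s) (fst s')"
  shows "spec_contract (sunion s s') (sunion t t') = sunion (spec_contract s t) (spec_contract s' t')"
    "gdisjoint (fst (spec_contract s t)) (fst (spec_contract s' t'))"
proof -
  let ?u = "sunion s s'" and ?t = "sunion t t'"
  let ?K = "spec_contract ?u ?t"
  note s = cov_sp2[OF t(1)] cov_sp2[OF t(2)] and tt = cov_sp1[OF t(1)] cov_sp1[OF t(2)]
  note f = sp_fgraph[OF T s(1)] and f' = sp_fgraph[OF T s(2)]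
  note C = Cov_sunion[OF T t d]
  note sp = specified_sunion[OF T s d]
  note fu = sp_fgraph[OF T sp]
  have spK: "specified T ?K"
    using specified_spec_contract_iff[OF T cov_sp1[OF C] sp cov_cov[OF C]] C by simp
  have cl: "closed_in (fst ?u) (verts (fst s))" "closed_in (fst ?u) (verts (fst s'))"
    using closed_in_gunion[OF f f' d] comp_graph_gunion2(1)[OF f f' d] by simp_all
  have clK: "closed_in (fst ?K) (verts (fst s) \<inter> verts (fst ?K))"
    unfolding fst_spec_contract by (rule closed_in_contract[OF fu cov_cov[OF C] cl(1)])
  have "verts (fst ?K) \<subseteq> verts (fst s) \<union> verts (fst s')"
    unfolding fst_spec_contract using contract_verts_subset[OF fu cov_cov[OF C]] by simp
  then have co: "verts (fst ?K) - verts (fst s) \<inter> verts (fst ?K) = verts (fst s') \<inter> verts (fst ?K)"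
    using d by (auto simp: gdisjoint_def)
  have dt: "gdisjoint (fst t) (fst t')"
    using d covering_simps[OF cov_cov[OF t(1)]] covering_simps[OF cov_cov[OF t(2)]]
    by (simp add: gdisjoint_def)
  have sub: "sub ?t (verts (fst s)) = t" "sub ?t (verts (fst s')) = t'"
    using sub_sunion[OF T tt dt] covering_simps(1)[OF cov_cov[OF t(1)]]
      covering_simps(1)[OF cov_cov[OF t(2)]] by simp_all
  show "?K = sunion (spec_contract s t) (spec_contract s' t')"
    using sunion_sub[OF T spK clK] sub_spec_contract[OF T C cl(1)] sub_spec_contract[OF T C cl(2)]
    by (simp add: co sub sub_sunion[OF T s d])
  have "verts (fst (spec_contract s t)) \<subseteq> verts (fst s)" "hedges (fst (spec_contract s t)) \<subseteq> hedges (fst s)"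
    "verts (fst (spec_contract s' t')) \<subseteq> verts (fst s')" "hedges (fst (spec_contract s' t')) \<subseteq> hedges (fst s')"
    using contract_verts_subset[OF f cov_cov[OF t(1)]] contract_verts_subset[OF f' cov_cov[OF t(2)]]
      external_hedges[OF cov_cov[OF t(1)]] external_hedges[OF cov_cov[OF t(2)]]
    by (auto simp: fst_spec_contract contract_simps[OF f cov_cov[OF t(1)]]
        contract_simps[OF f' cov_cov[OF t(2)]] simp del: contract_simps(1))
  then show "gdisjoint (fst (spec_contract s t)) (fst (spec_contract s' t'))"
    using d unfolding gdisjoint_def by blast
qed

section \<open>Chains of coverings and iterated contraction\<close>

section \<open>The poset of coverings\<close>

text \<open>If no further edge is cut, every component is full and inherits its index: the uncut
  covering carries only one specification.\<close>

lemma Cov_eqI: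
  assumes T: "valid_theory T" and t: "spec_covering T t s" and ext: "external (fst t) = external (fst s)"
  shows "t = s"
proof (rule sgraph_eqI)
  note f = sp_fgraph[OF T cov_sp2[OF t]]
  show 1: "fst t = fst s" by (rule covering_eqI[OF f cov_cov[OF t] covering_refl ext])
  show "snd t \<in> extensional (gcomps (fst s))" using sp_ext[OF T cov_sp1[OF t]] 1 by simp
  show "snd s \<in> extensional (gcomps (fst s))" by (rule sp_ext[OF T cov_sp2[OF t]])
  show "snd t (gcomp (fst s) v) = snd s (gcomp (fst s) v)" if "v \<in> verts (fst s)" for v
    using cov_full[OF t that] 1 by (simp add: full_def)
qed

lemma Cov_no_internal:
  assumes T: "valid_theory T" and s: "specified T s" and n: "no_internal (fst s)"
  shows "{t. spec_covering T t s} = {s}"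
proof -
  have "t = s" if t: "spec_covering T t s" for t
    using covering_external[OF cov_cov[OF t]] external_hedges[OF cov_cov[OF t]] n
    by (intro Cov_eqI[OF T t]) (auto simp: no_internal_def)
  then show ?thesis using Cov_refl[OF s] by blast
qed

text \<open>A proper covering must cut an edge, since \<open>Cov_eqI\<close> identifies any other
  with s. This decrease drives the recursion for the inverse.\<close>

lemma card_internal_less:
  assumes T: "valid_theory T" and t: "spec_covering T t s" and ne: "t \<noteq> s"
  shows "card (hedges (fst t) - external (fst t)) < card (hedges (fst s) - external (fst s))"
proof (rule psubset_card_mono)
  note f = sp_fgraph[OF T cov_sp2[OF t]] and c = cov_cov[OF t]
  show "finite (hedges (fst s) - external (fst s))" using fg_finite_hedges[OF f] by simp
  have "external (fst s) \<subset> external (fst t)"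
    using covering_external[OF c] Cov_eqI[OF T t] ne by auto
  then show "hedges (fst t) - external (fst t) \<subset> hedges (fst s) - external (fst s)"
    using external_hedges[OF c] covering_simps(2)[OF c] by auto
qed

text \<open>Cut sets are subsets of a finite set, and a specification chooses one of the finitely
  many indices that \<open>valid_theory\<close> allows for each residue type.\<close>

lemma finite_Cov:
  assumes T: "valid_theory T"
  shows "finite (Cov T s)"
proof (cases "specified T s")
  case True
  note f = sp_fgraph[OF T True]
  let ?J = "\<lambda>\<gamma>. Pi\<^sub>E (gcomps \<gamma>) (\<lambda>C. {k. (res_type \<gamma> C, k) \<in> rvtypes T})"
  have k: "finite {k. (t, k) \<in> rvtypes T}" for t
  proof (cases "t \<in> vtypes T")
    case False
    then have "{k. (t, k) \<in> rvtypes T} = {}" using T by (auto simp: valid_theory_def)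
    then show ?thesis by simp
  qed (use T in \<open>simp add: valid_theory_def\<close>)
  have "{\<gamma>. covering \<gamma> (fst s)} \<subseteq> cut (fst s) ` Pow (hedges (fst s))"
    by (auto simp: covering_def)
  then have "finite {\<gamma>. covering \<gamma> (fst s)}"
    using fg_finite_hedges[OF f] by (meson finite_Pow_iff finite_imageI finite_subset)
  moreover have "finite (?J \<gamma>)" if "\<gamma> \<in> {\<gamma>. covering \<gamma> (fst s)}" for \<gamma>
    using that covering_is_fgraph[OF f] finite_gcomps k by (intro finite_PiE) auto
  ultimately have "finite (Sigma {\<gamma>. covering \<gamma> (fst s)} ?J)" by (rule finite_SigmaI)
  moreover have "Cov T s \<subseteq> Sigma {\<gamma>. covering \<gamma> (fst s)} ?J"
    by (auto simp: spec_covering_def specified_def PiE_def)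
  ultimately show ?thesis by (meson finite_subset)
next
  case False
  then have "Cov T s = {}" using cov_sp2 by blast
  then show ?thesis by (simp only: finite.emptyI)
qed

lemma specified_spec_contract:
  assumes T: "valid_theory T" and t: "spec_covering T t s"
  shows "specified T (spec_contract s t)"
  using specified_spec_contract_iff[OF T cov_sp1[OF t] cov_sp2[OF t] cov_cov[OF t]] t by simp

text \<open>The half-edges of the contraction are those free in t, its external ones are those of s;
  both sets agree only for the trivial covering.\<close>

lemma no_internal_contract:
  assumes T: "valid_theory T" and t: "spec_covering T t s"
  shows "no_internal (fst (spec_contract s t)) \<longleftrightarrow> t = s"
proof -
  note f = sp_fgraph[OF T cov_sp2[OF t]] and c = cov_cov[OF t]
  have "no_internal (fst (spec_contract s t)) \<longleftrightarrow> external (fst s) = external (fst t)"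
    by (simp add: no_internal_def fst_spec_contract external_contract[OF f c] contract_simps[OF f c])
  then show ?thesis using Cov_eqI[OF T t] by auto
qed

subsection \<open>The finest covering\<close>

text \<open>With every edge cut, each component is a bare vertex, whose index is forced to be the
  vertex index; \<open>Min C\<close> extracts the vertex of the singleton C.\<close>

definition bottom :: "'e sgraph \<Rightarrow> 'e sgraph" where
  "bottom s = (cut (fst s) (hedges (fst s)),
     \<lambda>C\<in>gcomps (cut (fst s) (hedges (fst s))). vidx (fst s) (Min C))"

context
  fixes T :: "'e ftheory" and s :: "'e sgraph"
  assumes T: "valid_theory T" and s: "specified T s"
begin

private lemma f: "is_fgraph T (fst s)" by (rule sp_fgraph[OF T s])

private lemma cov: "covering (fst (bottom s)) (fst s)"
  unfolding covering_def bottom_def using fg_invol_in[OF f] by auto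

private lemma fb: "is_fgraph T (fst (bottom s))"
  by (rule covering_is_fgraph[OF f cov])

private lemma bot: "naked (fst (bottom s)) = verts (fst s)" "external (fst (bottom s)) = hedges (fst s)"
  by (auto simp: naked_def external_def bottom_def)

private lemma gb: "v \<in> verts (fst s) \<Longrightarrow> gcomp (fst (bottom s)) v = {v}"
  using gcomp_naked[OF fb] bot by simp

private lemma vb: "v \<in> verts (fst s) \<Longrightarrow> vmin (fst (bottom s)) v = v"
  by (simp add: vmin_def gb)

private lemma snd_bottom: "v \<in> verts (fst s) \<Longrightarrow> snd (bottom s) {v} = vidx (fst s) v"
  using gb[of v] by (auto simp: bottom_def gcomps_eq)

lemma Cov_bottom: "spec_covering T (bottom s) s"
proof -
  note c = covering_simps[OF cov]
  have "specified T (bottom s)"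
  proof (rule specifiedI[OF T fb])
    show "in_theory T (fst (bottom s))" using in_theory_covering[OF cov] sp_in_theory[OF T s] by simp
    show "bridgeless (fst (bottom s))" by (auto simp: bridgeless_def bottom_def)
    show "snd (bottom s) \<in> extensional (gcomps (fst (bottom s)))" by (simp add: bottom_def)
    fix v
    show "(rtype (fst (bottom s)) v, snd (bottom s) (gcomp (fst (bottom s)) v)) \<in> rvtypes T"
      if "v \<in> verts (fst (bottom s))"
    proof -
      have v: "v \<in> verts (fst s)" using that c by simp
      \<comment> \<open>The residue of a bare vertex is its star, so membership of s in the theory
        gives an admissible index.\<close>
      have "rtype (fst (bottom s)) v = vtype (fst s) v"
        using v by (simp add: rtype_def vtype_def star_def bot gb c)
      then show ?thesis
        using sp_in_theory[OF T s] v by (simp add: in_theory_def gb snd_bottom)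
    qed
    show "snd (bottom s) (gcomp (fst (bottom s)) v) = vidx (fst (bottom s)) v"
      if "v \<in> naked (fst (bottom s))"
      using that by (simp add: bot gb snd_bottom c)
  qed
  moreover have "snd (bottom s) (gcomp (fst (bottom s)) v) = snd s (gcomp (fst s) v)"
    if v: "v \<in> verts (fst s)" and full: "full (fst (bottom s)) (fst s) v" for v
  proof -
    \<comment> \<open>Agreement with the fully cut graph at v means that s has no internal edge
      there.\<close>
    have "v \<in> naked (fst s)"
      using v full gb[OF v] by (auto simp: naked_def full_def bottom_def)
    then show ?thesis using sp_naked[OF T s] v by (simp add: gb snd_bottom)
  qed
  ultimately show ?thesis using s cov by (simp add: spec_covering_iff)
qed

lemma spec_contract_bottom: "spec_contract s (bottom s) = s"
proof (rule sgraph_eqI)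
  note cs = contract_simps[OF f cov]
  show 1: "fst (spec_contract s (bottom s)) = fst s"
    unfolding fst_spec_contract
  proof (rule fgraph_eqI[OF is_fgraph_contract[OF f cov] f])
    fix v assume v: "v \<in> verts (fst s)"
    show "vidx (contract (fst s) (fst (bottom s)) (snd (bottom s))) v = vidx (fst s) v"
      using cs(6)[OF v] v by (simp add: vb gb snd_bottom)
  qed (use vb fg_att_in[OF f] in \<open>auto simp: cs bot\<close>)
  show "snd (spec_contract s (bottom s)) \<in> extensional (gcomps (fst s))"
    using snd_spec_contract_ext[of s "bottom s"] 1 by simp
  show "snd s \<in> extensional (gcomps (fst s))" by (rule sp_ext[OF T s])
  show "snd (spec_contract s (bottom s)) (gcomp (fst s) v) = snd s (gcomp (fst s) v)"
    if "v \<in> verts (fst s)" for v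
    using snd_spec_contract[OF f cov, of v] that 1 by simp
qed

lemma no_internal_Cov:
  assumes t: "spec_covering T t s" and n: "no_internal (fst t)"
  shows "t = bottom s"
proof (rule sgraph_eqI)
  note c = covering_simps[OF cov_cov[OF t]]
  show 1: "fst t = fst (bottom s)"
    by (rule covering_eqI[OF f cov_cov[OF t] cov]) (use n in \<open>simp add: no_internal_def bot c\<close>)
  show "snd t \<in> extensional (gcomps (fst (bottom s)))" using sp_ext[OF T cov_sp1[OF t]] 1 by simp
  show "snd (bottom s) \<in> extensional (gcomps (fst (bottom s)))" by (simp add: bottom_def)
  show "snd t (gcomp (fst (bottom s)) v) = snd (bottom s) (gcomp (fst (bottom s)) v)"
    if "v \<in> verts (fst (bottom s))" for v
    using sp_naked[OF T cov_sp1[OF t], of v] that 1 c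
      sp_naked[OF T cov_sp1[OF Cov_bottom], of v] covering_simps[OF cov] by (simp add: bot)
qed

lemma no_internal_bottom: "no_internal (fst (bottom s))"
  by (simp add: no_internal_def bot covering_simps[OF cov])

end

subsection \<open>Intervals of coverings\<close>

lemma Cov_trans:
  assumes T: "valid_theory T" and r: "spec_covering T r t" and t: "spec_covering T t s"
  shows "spec_covering T r s"
proof -
  note f = sp_fgraph[OF T cov_sp2[OF t]] and g = sp_fgraph[OF T cov_sp1[OF t]]
  note c = covering_trans[OF f cov_cov[OF t] cov_cov[OF r]]
  have "snd r (gcomp (fst r) v) = snd s (gcomp (fst s) v)"
    if v: "v \<in> verts (fst s)" and full: "full (fst r) (fst s) v" for v
  proof -
    have v': "v \<in> verts (fst t)" using v covering_simps[OF cov_cov[OF t]] by simp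
    \<comment> \<open>Cutting is irreversible: if r still agrees with s at e, the intermediate t
      cannot have cut e.\<close>
    have e: "invol (fst t) e = invol (fst s) e \<and> invol (fst r) e = invol (fst t) e"
      if "e \<in> hedges (fst s)" "att (fst s) e \<in> gcomp (fst r) v" for e
      using full that covering_invol[OF cov_cov[OF t], of e] covering_invol[OF cov_cov[OF r], of e]
      unfolding full_def by metis
    have 1: "full (fst r) (fst t) v"
      using e covering_simps[OF cov_cov[OF t]] by (simp add: full_def)
    have "gcomp (fst r) v = gcomp (fst t) v" by (rule full_gcomp[OF g cov_cov[OF r] 1 v'])
    then have "full (fst t) (fst s) v" using e by (simp add: full_def)
    then show ?thesis using cov_full[OF t v] cov_full[OF r v' 1] by simp
  qed
  then show ?thesis using c cov_sp1[OF r] cov_sp2[OF t] by (simp add: spec_covering_iff)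
qed

context
  fixes T :: "'e ftheory" and r t s :: "'e sgraph"
  assumes T: "valid_theory T" and r: "spec_covering T r t" and t: "spec_covering T t s"
begin

private lemma fs: "is_fgraph T (fst s)" and ft: "is_fgraph T (fst t)" and fr: "is_fgraph T (fst r)"
  using sp_fgraph[OF T] cov_sp2[OF t] cov_sp1[OF t] cov_sp1[OF r] by auto

private lemma rs: "spec_covering T r s" by (rule Cov_trans[OF T r t])

private lemma ct: "verts (fst t) = verts (fst s)" "hedges (fst t) = hedges (fst s)"
  "att (fst t) = att (fst s)" "htype (fst t) = htype (fst s)"
  using covering_simps[OF cov_cov[OF t]] by auto

private lemma ks: "fst (spec_contract t r) = contract (fst t) (fst r) (snd r)"
  "fst (spec_contract s r) = contract (fst s) (fst r) (snd r)"
  by (simp_all add: fst_spec_contract)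

private lemma kv: "verts (fst (spec_contract t r)) = vmin (fst r) ` verts (fst s)"
  "verts (fst (spec_contract s r)) = vmin (fst r) ` verts (fst s)"
  by (simp_all add: ks contract_simps[OF ft cov_cov[OF r]] contract_simps[OF fs cov_cov[OF rs]] ct)

text \<open>Full components of the contracted covering come from full components of t: half-edges
  free in r survive in the contraction and are compared there, while the remaining ones are cut
  neither in t nor in s.\<close>

lemma Cov_spec_contract: "spec_covering T (spec_contract t r) (spec_contract s r)"
proof -
  let ?K = "spec_contract s r" and ?L = "spec_contract t r"
  note spK = specified_spec_contract[OF T rs] and spL = specified_spec_contract[OF T r]
  note sk = contract_simps[OF fs cov_cov[OF rs]] and sl = contract_simps[OF ft cov_cov[OF r]]
  have cov: "covering (fst ?L) (fst ?K)"
    unfolding covering_iff[OF sp_fgraph[OF T spK]]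
  proof (intro conjI ballI)
    show "is_fgraph T (fst ?L)" by (rule sp_fgraph[OF T spL])
    show "invol (fst ?L) e = e \<or> invol (fst ?L) e = invol (fst ?K) e" if "e \<in> hedges (fst ?K)" for e
      using that covering_invol[OF cov_cov[OF t], of e] by (simp add: ks sk sl)
  qed (simp_all add: ks contract_def ct)
  have "snd ?L (gcomp (fst ?L) a) = snd ?K (gcomp (fst ?K) a)"
    if a: "a \<in> verts (fst ?K)" and full: "full (fst ?L) (fst ?K) a" for a
  proof -
    have aL: "a \<in> verts (fst ?L)" using a kv by simp
    have aS: "a \<in> verts (fst s)" using a contract_verts_subset[OF fs cov_cov[OF rs]] by (auto simp: ks)
    have "invol (fst t) e = invol (fst s) e"
      if e: "e \<in> hedges (fst s)" "att (fst s) e \<in> gcomp (fst t) a" for e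
    proof (cases "e \<in> external (fst r)")
      case True
      have "(a, att (fst s) e) \<in> conn (fst t)" using e(2) by (simp add: gcomp_iff)
      then have "(a, vmin (fst r) (att (fst s) e)) \<in> conn (fst t)"
        using vmin_conn_covering[OF ft cov_cov[OF r], of "att (fst s) e"] fg_att_in[OF fs e(1)] ct(1)
          conn_trans by metis
      then have "att (fst ?K) e \<in> gcomp (fst ?L) a"
        using a aL True e(1) fg_att_in[OF fs e(1)] kv(1)
        by (simp add: ks(1) gcomp_contract[OF ft cov_cov[OF r] aL[unfolded ks]] gcomp_iff)
           (simp add: ks sk sl ct)
      then have "invol (fst ?L) e = invol (fst ?K) e" using full True by (simp add: full_def ks sk)
      then show ?thesis using True by (simp add: ks sk sl)
    next
      case False
      then show ?thesis using covering_invol[OF cov_cov[OF r]] covering_invol[OF cov_cov[OF rs]] by metis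
    qed
    then have "full (fst t) (fst s) a" by (simp add: full_def)
    then show ?thesis
      using snd_spec_contract[OF ft cov_cov[OF r] aL] snd_spec_contract[OF fs cov_cov[OF rs] a]
        cov_full[OF t aS] by simp
  qed
  then show ?thesis using spK spL cov by (simp add: spec_covering_iff)
qed

lemma spec_contract_spec_contract:
  "spec_contract (spec_contract s r) (spec_contract t r) = spec_contract s t"
proof (rule sgraph_eqI)
  let ?K = "spec_contract s r" and ?L = "spec_contract t r"
  note C = Cov_spec_contract
  note spK = cov_sp2[OF C]
  note fK = sp_fgraph[OF T spK]
  note sk = contract_simps[OF fs cov_cov[OF rs]]
  note skl = contract_simps[OF fK cov_cov[OF C]] and st = contract_simps[OF fs cov_cov[OF t]]
  have ext: "external (fst ?L) = external (fst t)"
    by (simp add: ks external_contract[OF ft cov_cov[OF r]])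
  have extr: "external (fst t) \<subseteq> external (fst r)" by (rule covering_external[OF cov_cov[OF r]])
  \<comment> \<open>The labels agree on the nose, which makes the iterated contraction equal to the
    direct one.\<close>
  have vv: "vmin (fst ?L) (vmin (fst r) v) = vmin (fst t) v" if "v \<in> verts (fst s)" for v
    using vmin_contract[OF ft cov_cov[OF r]] that by (simp add: ks ct)
  show 1: "fst (spec_contract ?K ?L) = fst (spec_contract s t)"
    unfolding fst_spec_contract[of ?K ?L] fst_spec_contract[of s t]
  proof (rule fgraph_eqI[OF is_fgraph_contract[OF fK cov_cov[OF C]] is_fgraph_contract[OF fs cov_cov[OF t]]])
    show "verts (contract (fst ?K) (fst ?L) (snd ?L)) = verts (contract (fst s) (fst t) (snd t))"
      unfolding skl st kv image_image using vv by (intro image_cong) auto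
    show "hedges (contract (fst ?K) (fst ?L) (snd ?L)) = hedges (contract (fst s) (fst t) (snd t))"
      by (simp add: skl st ext)
    fix e assume "e \<in> hedges (contract (fst s) (fst t) (snd t))"
    then have e: "e \<in> external (fst t)" "e \<in> external (fst ?L)" "e \<in> external (fst r)" "e \<in> hedges (fst s)"
      using extr external_hedges[OF cov_cov[OF t]] by (auto simp: st ext)
    show "invol (contract (fst ?K) (fst ?L) (snd ?L)) e = invol (contract (fst s) (fst t) (snd t)) e"
      "htype (contract (fst ?K) (fst ?L) (snd ?L)) e = htype (contract (fst s) (fst t) (snd t)) e"
      using e by (simp_all add: skl st) (simp_all add: ks sk)
    show "att (contract (fst ?K) (fst ?L) (snd ?L)) e = att (contract (fst s) (fst t) (snd t)) e"
      using e vv[OF fg_att_in[OF fs e(4)]] by (simp add: skl st) (simp add: ks sk)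
  next
    fix a assume "a \<in> verts (contract (fst s) (fst t) (snd t))"
    then obtain v where v: "v \<in> verts (fst s)" "a = vmin (fst t) v" by (auto simp: st)
    have vK: "vmin (fst r) v \<in> verts (fst ?K)" "vmin (fst r) v \<in> verts (fst ?L)" using v kv by auto
    have "vidx (contract (fst ?K) (fst ?L) (snd ?L)) a = snd ?L (gcomp (fst ?L) (vmin (fst r) v))"
      using skl(6)[OF vK(1), of "snd ?L"] vv[OF v(1)] v(2) by simp
    also have "\<dots> = snd t (gcomp (fst t) v)"
      using snd_spec_contract[OF ft cov_cov[OF r] vK(2)] gcomp_vmin_covering[OF ft cov_cov[OF r], of v] v
      by (simp add: ct)
    also have "\<dots> = vidx (contract (fst s) (fst t) (snd t)) a" using v by (simp add: st)
    finally show "vidx (contract (fst ?K) (fst ?L) (snd ?L)) a = vidx (contract (fst s) (fst t) (snd t)) a" .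
  qed
  show "snd (spec_contract ?K ?L) \<in> extensional (gcomps (fst (spec_contract s t)))"
    using snd_spec_contract_ext[of ?K ?L] 1 by simp
  show "snd (spec_contract s t) \<in> extensional (gcomps (fst (spec_contract s t)))"
    by (rule snd_spec_contract_ext)
  fix a assume a: "a \<in> verts (fst (spec_contract s t))"
  then have a1: "a \<in> verts (fst (spec_contract ?K ?L))" using 1 by simp
  then have a2: "a \<in> verts (fst ?K)"
    using contract_verts_subset[OF fK cov_cov[OF C]] by (auto simp: fst_spec_contract[of ?K ?L])
  show "snd (spec_contract ?K ?L) (gcomp (fst (spec_contract s t)) a) =
      snd (spec_contract s t) (gcomp (fst (spec_contract s t)) a)"
    using snd_spec_contract[OF fK cov_cov[OF C] a1] snd_spec_contract[OF fs cov_cov[OF rs] a2]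
      snd_spec_contract[OF fs cov_cov[OF t] a] 1 by simp
qed

end

text \<open>Both the cut set of t and its specification can be read off from the contraction: the
  former as its external half-edges, the latter as its second component.\<close>

lemma spec_contract_inj:
  assumes T: "valid_theory T" and r: "spec_covering T r t" "spec_covering T r t'"
    and t: "spec_covering T t s" "spec_covering T t' s"
    and eq: "spec_contract t r = spec_contract t' r"
  shows "t = t'"
proof (rule sgraph_eqI)
  note fs = sp_fgraph[OF T cov_sp2[OF t(1)]]
  note ft = sp_fgraph[OF T cov_sp1[OF t(1)]] and ft' = sp_fgraph[OF T cov_sp1[OF t(2)]]
  have "external (fst t) = external (fst t')"
    using eq external_contract[OF ft cov_cov[OF r(1)]] external_contract[OF ft' cov_cov[OF r(2)]]
      fst_spec_contract by metis
  then show 1: "fst t = fst t'" by (rule covering_eqI[OF fs cov_cov[OF t(1)] cov_cov[OF t(2)]])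
  show "snd t \<in> extensional (gcomps (fst t'))" "snd t' \<in> extensional (gcomps (fst t'))"
    using sp_ext[OF T cov_sp1[OF t(1)]] sp_ext[OF T cov_sp1[OF t(2)]] 1 by simp_all
  fix v assume v: "v \<in> verts (fst t')"
  let ?a = "vmin (fst r) v"
  have "?a \<in> verts (fst (spec_contract t' r))"
    using v by (simp add: fst_spec_contract contract_simps[OF ft' cov_cov[OF r(2)]])
  then show "snd t (gcomp (fst t') v) = snd t' (gcomp (fst t') v)"
    using snd_spec_contract[OF ft cov_cov[OF r(1)], of ?a] snd_spec_contract[OF ft' cov_cov[OF r(2)], of ?a]
      gcomp_vmin_covering[OF ft' cov_cov[OF r(2)] v] eq 1 by simp
qed

text \<open>The half-edges of the contraction are half-edges of s, so the cut of t' can be made in s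
  itself; since it only involves half-edges free in r, the covering r remains below the
  result.\<close>

lemma spec_contract_surj:
  assumes T: "valid_theory T" and r: "spec_covering T r s" and t': "spec_covering T t' (spec_contract s r)"
  shows "\<exists>t. spec_covering T r t \<and> spec_covering T t s \<and> spec_contract t r = t'"
proof -
  note fs = sp_fgraph[OF T cov_sp2[OF r]] and fr = sp_fgraph[OF T cov_sp1[OF r]]
  note cr = cov_cov[OF r]
  let ?K = "spec_contract s r"
  have K: "fst ?K = contract (fst s) (fst r) (snd r)" by (rule fst_spec_contract)
  note fK = sp_fgraph[OF T cov_sp2[OF t']] and ft' = sp_fgraph[OF T cov_sp1[OF t']]
  note sk = contract_simps[OF fs cr]
  note ct' = covering_simps[OF cov_cov[OF t']]
  let ?E = "external (fst t')"
  let ?\<gamma> = "cut (fst s) ?E"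
  \<comment> \<open>The cut set is that of t'. The index of a component is the one t' gives to the
    component of the contraction that contains the image of its least vertex.\<close>
  define t where "t = (?\<gamma>, \<lambda>C\<in>gcomps ?\<gamma>. snd t' (gcomp (fst t') (vmin (fst r) (Min C))))"
  have ft: "fst t = ?\<gamma>" by (simp add: t_def)
  have E: "?E \<subseteq> external (fst r)"
    using external_hedges[OF cov_cov[OF t']] by (auto simp: K sk)
  have inE: "invol (fst s) e \<in> ?E" if "e \<in> ?E" for e
    using covering_invol_external[OF fK cov_cov[OF t'] that] E that by (auto simp: K sk)
  have cts: "covering (fst t) (fst s)"
    unfolding ft covering_def
  proof (intro exI conjI)
    show "?E \<subseteq> hedges (fst s)" using E external_hedges[OF cr] by auto
    show "invol (fst s) ` ?E \<subseteq> ?E" using inE by auto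
  qed simp
  note fgt = covering_is_fgraph[OF fs cts]
  note c = covering_simps[OF cts] and crs = covering_simps[OF cr]
  have ext: "external (fst t) = ?E"
  proof -
    have "external (fst s) \<subseteq> ?E"
      using covering_external[OF cov_cov[OF t']] external_contract[OF fs cr] by (simp add: K)
    then show ?thesis using E external_hedges[OF cr] by (auto simp: ft external_def)
  qed
  have crt: "covering (fst r) (fst t)"
    unfolding covering_iff[OF fgt] using fr c crs covering_invol[OF cr] covering_invol[OF cts] E ext
    by auto
  have K': "contract (fst t) (fst r) (snd r) = fst t'"
  proof (rule fgraph_eqI[OF is_fgraph_contract[OF fgt crt] ft'])
    note st = contract_simps[OF fgt crt]
    show "verts (contract (fst t) (fst r) (snd r)) = verts (fst t')" by (simp add: st ct' K sk c)
    show "hedges (contract (fst t) (fst r) (snd r)) = hedges (fst t')" by (simp add: st ct' K sk)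
    fix e assume "e \<in> hedges (fst t')"
    then have e: "e \<in> external (fst r)" by (simp add: ct' K sk)
    show "invol (contract (fst t) (fst r) (snd r)) e = invol (fst t') e"
      using e covering_invol[OF cov_cov[OF t'], of e] by (simp add: st covering_invol[OF cts] ext K sk)
    show "att (contract (fst t) (fst r) (snd r)) e = att (fst t') e"
      "htype (contract (fst t) (fst r) (snd r)) e = htype (fst t') e"
      using e by (simp_all add: st ct' K sk c)
  next
    fix a assume "a \<in> verts (fst t')"
    then obtain v where "v \<in> verts (fst s)" "a = vmin (fst r) v" by (auto simp: ct' K sk)
    then show "vidx (contract (fst t) (fst r) (snd r)) a = vidx (fst t') a"
      by (simp add: contract_simps[OF fgt crt] ct' K sk c)
  qed
  \<comment> \<open>The definition evaluates at the least vertex only; it is connected to v in t,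
    hence their images are connected in t' and have the same index.\<close>
  have sndt: "snd t (gcomp (fst t) v) = snd t' (gcomp (fst t') (vmin (fst r) v))"
    if v: "v \<in> verts (fst s)" for v
  proof -
    let ?w = "vmin (fst t) v"
    have vw: "(v, ?w) \<in> conn (fst t)" using vmin_conn[OF fgt] v c by simp
    then have w: "?w \<in> verts (fst t)" by (rule conn_in)
    have "(v, vmin (fst r) v) \<in> conn (fst t)" "(?w, vmin (fst r) ?w) \<in> conn (fst t)"
      using vmin_conn_covering[OF fgt crt] v w c by auto
    then have "(vmin (fst r) v, vmin (fst r) ?w) \<in> conn (fst t)"
      using vw conn_sym[OF fgt] conn_trans by metis
    then have "(vmin (fst r) v, vmin (fst r) ?w) \<in> conn (fst t')"
      using v w c conn_contract[OF fgt crt, of "snd r"] contract_simps(1)[OF fgt crt, of "snd r"]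
      by (simp add: K')
    then have "gcomp (fst t') (vmin (fst r) v) = gcomp (fst t') (vmin (fst r) ?w)"
      by (rule gcomp_eqI[OF ft'])
    moreover have "gcomp ?\<gamma> v \<in> gcomps ?\<gamma>" using v by (simp add: gcomps_eq)
    ultimately show ?thesis by (simp add: t_def vmin_def)
  qed
  \<comment> \<open>A component that r does not split is a bare vertex of t', whose index is the
    vertex index, that is, the index given by r.\<close>
  have fullK: "snd t (gcomp (fst t) v) = snd r (gcomp (fst r) v)"
    if v: "v \<in> verts (fst s)" and full: "full (fst r) (fst t) v" for v
  proof -
    have n: "vmin (fst r) v \<in> naked (fst t')"
      using naked_contract[OF fgt crt, of v "snd r"] v full c by (simp add: K')
    have "snd t (gcomp (fst t) v) = vidx (fst t') (vmin (fst r) v)"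
      using sndt[OF v] sp_naked[OF T cov_sp1[OF t'] n] by simp
    then show ?thesis using v by (simp add: ct' K sk)
  qed
  have spt: "specified T t"
  proof (rule specifiedI[OF T fgt])
    show "in_theory T (fst t)"
      using in_theory_covering[OF cts] sp_in_theory[OF T cov_sp2[OF r]] by simp
    show "bridgeless (fst t)"
      by (rule bridgeless_extension[OF fgt crt sp_bridgeless[OF T cov_sp1[OF r]], of "snd r"])
        (use sp_bridgeless[OF T cov_sp1[OF t']] in \<open>simp add: K'\<close>)
    show "snd t \<in> extensional (gcomps (fst t))" by (simp add: t_def)
    fix v
    show "(rtype (fst t) v, snd t (gcomp (fst t) v)) \<in> rvtypes T" if "v \<in> verts (fst t)"
    proof -
      have a: "vmin (fst r) v \<in> verts (fst t')" using that by (simp add: ct' K sk c)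
      show ?thesis
        using rtype_contract[OF fgt crt that, of "snd r"] sp_rtype[OF T cov_sp1[OF t'] a] sndt that
        by (simp add: K' c)
    qed
    show "snd t (gcomp (fst t) v) = vidx (fst t) v" if n: "v \<in> naked (fst t)"
    proof -
      have v: "v \<in> verts (fst s)" using n c by (simp add: naked_def)
      \<comment> \<open>A bare vertex of t is also bare in the finer r and a full component there,
        so its index is inherited from r.\<close>
      have "gcomp (fst r) v \<subseteq> {v}" using gcomp_mono[OF fgt crt, of v] gcomp_naked[OF fgt n] by simp
      then have 1: "full (fst r) (fst t) v"
        using n covering_invol[OF crt] unfolding full_def naked_def by auto
      have 2: "v \<in> naked (fst r)"
        using n covering_invol[OF crt] crs c unfolding naked_def by auto
      show ?thesis using fullK[OF v 1] sp_naked[OF T cov_sp1[OF r] 2] crs c by simp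
    qed
  qed
  have 1: "spec_covering T r t"
    using spt cov_sp1[OF r] crt fullK c by (simp add: spec_covering_iff)
  have 2: "spec_covering T t s"
  proof -
    have "snd t (gcomp (fst t) v) = snd s (gcomp (fst s) v)"
      if v: "v \<in> verts (fst s)" and full: "full (fst t) (fst s) v" for v
    proof -
      let ?a = "vmin (fst r) v"
      have a: "?a \<in> verts (fst ?K)" "?a \<in> verts (contract (fst t) (fst r) (snd r))"
        using v by (auto simp: K sk contract_simps[OF fgt crt] c)
      \<comment> \<open>Fullness descends: a half-edge of the contraction attached to the component
        of \<open>?a\<close> is attached in s to the component of v in t.\<close>
      have "invol (fst t') e = invol (fst ?K) e"
        if e: "e \<in> hedges (fst ?K)" "att (fst ?K) e \<in> gcomp (fst t') ?a" for e
      proof -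
        have er: "e \<in> external (fst r)" using e by (simp add: K sk)
        have h: "e \<in> hedges (fst s)" by (rule external_hedges[OF cr er])
        have "vmin (fst r) (att (fst s) e) \<in> gcomp (fst t) v"
          using e(2) gcomp_contract[OF fgt crt a(2)] gcomp_vmin_covering[OF fgt crt, of v] v c er
          by (simp add: K' K sk)
        then have "att (fst s) e \<in> gcomp (fst t) v"
          using vmin_conn_covering[OF fgt crt, of "att (fst s) e"] fg_att_in[OF fs h] c
            conn_sym[OF fgt] conn_trans unfolding gcomp_iff by metis
        then have "invol (fst t) e = invol (fst s) e" using full h by (simp add: full_def)
        then show ?thesis using er contract_simps(3)[OF fgt crt er, of "snd r"] by (simp add: K' K sk)
      qed
      then have "full (fst t') (fst ?K) ?a" by (simp add: full_def)
      then show ?thesis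
        using cov_full[OF t' a(1)] sndt[OF v] snd_spec_contract[OF fs cr a(1)]
          gcomp_vmin_covering[OF fs cr v] by simp
    qed
    then show ?thesis using spt cov_sp2[OF r] cts by (simp add: spec_covering_iff)
  qed
  have 3: "spec_contract t r = t'"
  proof (rule sgraph_eqI)
    show f: "fst (spec_contract t r) = fst t'" by (simp add: fst_spec_contract K')
    show "snd (spec_contract t r) \<in> extensional (gcomps (fst t'))"
      using snd_spec_contract_ext[of t r] f by simp
    show "snd t' \<in> extensional (gcomps (fst t'))" by (rule sp_ext[OF T cov_sp1[OF t']])
    fix a assume a: "a \<in> verts (fst t')"
    then have a1: "a \<in> verts (fst (spec_contract t r))" using f by simp
    have a2: "vmin (fst r) a = a" "a \<in> verts (fst s)"
      using vmin_idem[OF fs cr, of a "snd r"] contract_verts_subset[OF fs cr] a by (auto simp: ct' K)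
    show "snd (spec_contract t r) (gcomp (fst t') a) = snd t' (gcomp (fst t') a)"
      using snd_spec_contract[OF fgt crt a1] sndt[OF a2(2)] a2(1) f by simp
  qed
  show ?thesis using 1 2 3 by blast
qed

lemma bij_betw_assoc:
  assumes T: "valid_theory T"
  shows "bij_betw (\<lambda>(t, r). (r, spec_contract t r)) (SIGMA t:Cov T s. Cov T t)
    (SIGMA r:Cov T s. Cov T (spec_contract s r))"
  unfolding bij_betw_def
proof
  show "inj_on (\<lambda>(t, r). (r, spec_contract t r)) (SIGMA t:Cov T s. Cov T t)"
  proof (rule inj_onI)
    fix x y assume x: "x \<in> (SIGMA t:Cov T s. Cov T t)" and y: "y \<in> (SIGMA t:Cov T s. Cov T t)"
      and eq: "(case x of (t, r) \<Rightarrow> (r, spec_contract t r)) = (case y of (t, r) \<Rightarrow> (r, spec_contract t r))"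
    obtain t r where xt: "x = (t, r)" "spec_covering T t s" "spec_covering T r t"
      using x by (elim SigmaE) simp
    obtain t' r' where yt: "y = (t', r')" "spec_covering T t' s" "spec_covering T r' t'"
      using y by (elim SigmaE) simp
    have "(r, spec_contract t r) = (r', spec_contract t' r')" using eq unfolding xt(1) yt(1) prod.case .
    then have "r' = r" "spec_contract t r = spec_contract t' r" by (metis prod.inject)+
    then show "x = y" using spec_contract_inj[OF T xt(3) _ xt(2) yt(2)] yt(3) by (simp add: xt(1) yt(1))
  qed
  show "(\<lambda>(t, r). (r, spec_contract t r)) ` (SIGMA t:Cov T s. Cov T t) =
      (SIGMA r:Cov T s. Cov T (spec_contract s r))"
  proof (intro equalityI subsetI)
    fix x assume "x \<in> (\<lambda>(t, r). (r, spec_contract t r)) ` (SIGMA t:Cov T s. Cov T t)"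
    then obtain t r where x: "x = (r, spec_contract t r)"
      and c: "spec_covering T t s" "spec_covering T r t"
      by (elim imageE SigmaE) simp
    show "x \<in> (SIGMA r:Cov T s. Cov T (spec_contract s r))"
      using Cov_trans[OF T c(2,1)] Cov_spec_contract[OF T c(2,1)] by (simp add: x)
  next
    fix x assume "x \<in> (SIGMA r:Cov T s. Cov T (spec_contract s r))"
    then obtain r t' where x: "x = (r, t')"
      and c: "spec_covering T r s" "spec_covering T t' (spec_contract s r)"
      by (elim SigmaE) simp
    obtain t where "spec_covering T r t" "spec_covering T t s" "spec_contract t r = t'"
      using spec_contract_surj[OF T c] by blast
    then show "x \<in> (\<lambda>(t, r). (r, spec_contract t r)) ` (SIGMA t:Cov T s. Cov T t)"
      by (intro image_eqI[of _ _ "(t, r)"]) (simp_all add: x)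
  qed
qed

subsection \<open>Splitting off vertices without internal edges\<close>

lemma closed_in_naked: "closed_in \<Gamma> (naked \<Gamma>)"
  by (auto simp: closed_in_def naked_def)

lemma no_internal_naked: "no_internal (comp_graph \<Gamma> (naked \<Gamma>))"
  by (auto simp: no_internal_def external_def naked_def)

text \<open>A weak isomorphism matches all indices away from bare vertices, so on that part it is an
  isomorphism to which invariance applies.\<close>

lemma graph_iso_naked_compl:
  assumes "is_fgraph T \<Gamma>" "is_fgraph T \<Gamma>'" "weak_iso f g \<Gamma> \<Gamma>'"
  shows "graph_iso f g (comp_graph \<Gamma> (verts \<Gamma> - naked \<Gamma>)) (comp_graph \<Gamma>' (verts \<Gamma>' - naked \<Gamma>'))"
proof -
  have si: "shape_iso f g \<Gamma> \<Gamma>'" and vi: "\<And>v. v \<in> verts \<Gamma> - naked \<Gamma> \<Longrightarrow> vidx \<Gamma>' (f v) = vidx \<Gamma> v"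
    using assms(3) by (auto simp: weak_iso_def)
  note s = shape_isoD[OF si]
  let ?U = "verts \<Gamma> - naked \<Gamma>" and ?U' = "verts \<Gamma>' - naked \<Gamma>'"
  note n = naked_shape_iso[OF assms(1) si]
  have fU: "f ` ?U = ?U'" using n by (auto simp: s(3))
  have fv: "f v \<in> ?U' \<longleftrightarrow> v \<in> ?U" if "v \<in> verts \<Gamma>" for v using n that s(1) by auto
  let ?H = "{e \<in> hedges \<Gamma>. att \<Gamma> e \<in> ?U}"
  have H: "g ` ?H = {e \<in> hedges \<Gamma>'. att \<Gamma>' e \<in> ?U'}"
    using fv fg_att_in[OF assms(1)] s(8) unfolding s(4) by (auto simp: image_iff) blast+
  have "shape_iso f g (comp_graph \<Gamma> ?U) (comp_graph \<Gamma>' ?U')"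
    unfolding shape_iso_def
  proof (intro conjI ballI)
    show "bij_betw f (verts (comp_graph \<Gamma> ?U)) (verts (comp_graph \<Gamma>' ?U'))"
      using fU inj_on_subset[OF s(5), of ?U] by (simp add: bij_betw_def)
    show "bij_betw g (hedges (comp_graph \<Gamma> ?U)) (hedges (comp_graph \<Gamma>' ?U'))"
      using H inj_on_subset[OF s(6), of ?H] by (auto simp: bij_betw_def)
    fix e assume "e \<in> hedges (comp_graph \<Gamma> ?U)"
    then have e: "e \<in> hedges \<Gamma>" "att \<Gamma> e \<in> ?U" by auto
    then have ge: "g e \<in> hedges \<Gamma>'" "att \<Gamma>' (g e) \<in> ?U'"
      using s(2)[OF e(1)] fv[OF fg_att_in[OF assms(1) e(1)]] s(8)[OF e(1)] by metis+
    show "g (invol (comp_graph \<Gamma> ?U) e) = invol (comp_graph \<Gamma>' ?U') (g e)"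
      "f (att (comp_graph \<Gamma> ?U) e) = att (comp_graph \<Gamma>' ?U') (g e)"
      "htype (comp_graph \<Gamma>' ?U') (g e) = htype (comp_graph \<Gamma> ?U) e"
      unfolding comp_graph_simps(3-5)[OF e] comp_graph_simps(3-5)[OF ge] using s e by simp_all
  qed
  moreover have "vidx (comp_graph \<Gamma>' ?U') (f v) = vidx (comp_graph \<Gamma> ?U) v" if "v \<in> ?U" for v
  proof -
    have "f v \<in> ?U'" using that fU by blast
    then show ?thesis
      using vi[OF that] comp_graph_simps(6)[of "f v" ?U' \<Gamma>'] comp_graph_simps(6)[OF that, of \<Gamma>] by metis
  qed
  ultimately show ?thesis by (simp add: graph_iso_iff)
qed

section \<open>Conservation of momentum and spaces of smooth functions\<close>

section \<open>Momentum spaces\<close>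

lemma W_iff: "p \<in> W \<Gamma> \<longleftrightarrow> (\<forall>e. e \<notin> hedges \<Gamma> \<longrightarrow> p e = 0) \<and>
     (\<forall>v\<in>verts \<Gamma>. (\<Sum>e\<in>star \<Gamma> v. p e) = 0) \<and>
     (\<forall>e\<in>hedges \<Gamma>. e \<noteq> invol \<Gamma> e \<longrightarrow> p e + p (invol \<Gamma> e) = 0)"
  by (simp add: W_def)

lemma mom_restrict_mom_restrict: "mom_restrict E (mom_restrict F p) = mom_restrict (E \<inter> F) p"
  by (auto simp: mom_restrict_def fun_eq_iff)

lemma mom_restrict_W: "p \<in> W \<Gamma> \<Longrightarrow> mom_restrict (hedges \<Gamma>) p = p"
  by (auto simp: mom_restrict_def fun_eq_iff W_iff)

lemma star_comp_graph: "v \<in> U \<Longrightarrow> star (comp_graph \<Gamma> U) v = star \<Gamma> v"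
  by (auto simp: star_def)

lemma W_comp_graph:
  assumes "is_fgraph T \<Gamma>" "closed_in \<Gamma> U" "p \<in> W \<Gamma>"
  shows "mom_restrict (hedges (comp_graph \<Gamma> U)) p \<in> W (comp_graph \<Gamma> U)"
proof -
  have "(\<Sum>e\<in>star (comp_graph \<Gamma> U) v. mom_restrict (hedges (comp_graph \<Gamma> U)) p e) = 0" if "v \<in> U" for v
  proof -
    have "(\<Sum>e\<in>star (comp_graph \<Gamma> U) v. mom_restrict (hedges (comp_graph \<Gamma> U)) p e) = (\<Sum>e\<in>star \<Gamma> v. p e)"
      unfolding star_comp_graph[OF that]
      using that by (intro sum.cong) (auto simp: mom_restrict_def star_def)
    then show ?thesis using assms(2,3) that by (auto simp: W_iff closed_in_def)
  qed
  then show ?thesis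
    using assms fg_invol_in[OF assms(1)] by (auto simp: W_iff mom_restrict_def closed_in_def)
qed

text \<open>Momenta are extended by 0, so momenta of a part already are momenta of the whole graph:
  conservation is trivial outside U, and no edge leaves U.\<close>

lemma W_comp_graph_subset:
  assumes "is_fgraph T \<Gamma>" "closed_in \<Gamma> U"
  shows "W (comp_graph \<Gamma> U) \<subseteq> W \<Gamma>"
proof
  fix q assume q: "q \<in> W (comp_graph \<Gamma> U)"
  have z: "q e = 0" if "att \<Gamma> e \<notin> U \<or> e \<notin> hedges \<Gamma>" for e
    using q that by (auto simp: W_iff)
  have "(\<Sum>e\<in>star \<Gamma> v. q e) = 0" if "v \<in> verts \<Gamma>" for v
  proof (cases "v \<in> U")
    case True
    then show ?thesis using q star_comp_graph[OF True, of \<Gamma>] by (auto simp: W_iff)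
  next
    case False
    then show ?thesis using z by (intro sum.neutral) (auto simp: star_def)
  qed
  moreover have "q e + q (invol \<Gamma> e) = 0" if e: "e \<in> hedges \<Gamma>" "e \<noteq> invol \<Gamma> e" for e
    using q z closed_in_iff[OF assms e(1)] e by (cases "att \<Gamma> e \<in> U") (auto simp: W_iff)
  ultimately show "q \<in> W \<Gamma>" using z by (simp add: W_iff)
qed

lemma W_covering:
  assumes "covering \<gamma> \<Gamma>"
  shows "W \<Gamma> \<subseteq> W \<gamma>"
  using covering_simps[OF assms] covering_invol[OF assms] by (auto simp: W_iff star_def)

text \<open>Adding the conservation laws at all vertices of a component of \<gamma> leaves the sum
  over its external half-edges, which are the half-edges at the contracted vertex.\<close>

lemma W_contract:
  fixes p :: "('d::finite) momenta"
  assumes "is_fgraph T \<Gamma>" "covering \<gamma> \<Gamma>" "p \<in> W \<Gamma>"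
  shows "mom_restrict (external \<gamma>) p \<in> W (contract \<Gamma> \<gamma> j)"
proof -
  note s = contract_simps[OF assms(1,2)] and c = covering_simps[OF assms(2)]
  note g = covering_is_fgraph[OF assms(1,2)]
  let ?K = "contract \<Gamma> \<gamma> j"
  have p: "p \<in> W \<gamma>" using W_covering[OF assms(2)] assms(3) by auto
  have fin: "finite (hedges \<gamma>)" by (rule fg_finite_hedges[OF g])
  have "(\<Sum>e\<in>star ?K (vmin \<gamma> v). mom_restrict (external \<gamma>) p e) = 0" if v: "v \<in> verts \<Gamma>" for v
  proof -
    let ?A = "{e \<in> hedges \<gamma>. att \<gamma> e \<in> gcomp \<gamma> v}"
    let ?I = "{e \<in> hedges \<gamma>. att \<gamma> e \<in> gcomp \<gamma> v \<and> invol \<gamma> e \<noteq> e}"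
    let ?X = "{e \<in> external \<gamma>. att \<gamma> e \<in> gcomp \<gamma> v}"
    have "(\<Sum>e\<in>?A. p e) = (\<Sum>w\<in>gcomp \<gamma> v. \<Sum>e\<in>{e \<in> ?A. att \<gamma> e = w}. p e)"
      using fin gcomp_finite[OF g] by (intro sum.group[symmetric]) auto
    also have "\<dots> = 0"
    proof (rule sum.neutral, rule ballI)
      fix w assume w: "w \<in> gcomp \<gamma> v"
      then have "{e \<in> ?A. att \<gamma> e = w} = star \<gamma> w" by (auto simp: star_def)
      then show "(\<Sum>e\<in>{e \<in> ?A. att \<gamma> e = w}. p e) = 0"
        using p gcomp_subset[of \<gamma> v] w by (auto simp: W_iff)
    qed
    finally have A: "(\<Sum>e\<in>?A. p e) = 0" .
    have clI: "att \<gamma> (invol \<gamma> e) \<in> gcomp \<gamma> v \<longleftrightarrow> att \<gamma> e \<in> gcomp \<gamma> v" if "e \<in> hedges \<gamma>" for e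
      by (rule closed_in_iff[OF g closed_in_gcomp[OF g] that])
    text \<open>The internal half-edges cancel in pairs.\<close>
    have "(\<Sum>e\<in>?I. p e) = (\<Sum>e\<in>?I. p (invol \<gamma> e))"
    proof (rule sum.reindex_bij_witness[of _ "invol \<gamma>" "invol \<gamma>"])
      fix e assume e: "e \<in> ?I"
      then have i: "invol \<gamma> e \<in> hedges \<gamma>" "invol \<gamma> (invol \<gamma> e) = e"
        using fg_invol_in[OF g] fg_invol_invol[OF g] by auto
      then show "invol \<gamma> e \<in> ?I" "invol \<gamma> e \<in> ?I" using e clI by auto
      show "invol \<gamma> (invol \<gamma> e) = e" "invol \<gamma> (invol \<gamma> e) = e" by (fact i)+
      show "p (invol \<gamma> (invol \<gamma> e)) = p e" by (simp add: i)
    qed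
    also have "\<dots> = (\<Sum>e\<in>?I. - p e)"
      using p by (intro sum.cong refl) (auto simp: W_iff eq_neg_iff_add_eq_0 add.commute)
    finally have "(\<Sum>e\<in>?I. p e) = - (\<Sum>e\<in>?I. p e)" by (simp add: sum_negf)
    then have "(\<Sum>e\<in>?I. p e) + (\<Sum>e\<in>?I. p e) = 0" by (simp only: eq_neg_iff_add_eq_0)
    then have "2 *\<^sub>R (\<Sum>e\<in>?I. p e) = 0" by (simp only: scaleR_2)
    then have I: "(\<Sum>e\<in>?I. p e) = 0" by simp
    have "?A = ?X \<union> ?I" "?X \<inter> ?I = {}" by (auto simp: external_def)
    then have "(\<Sum>e\<in>?A. p e) = (\<Sum>e\<in>?X. p e) + (\<Sum>e\<in>?I. p e)"
      using fin by (simp add: sum.union_disjoint external_def)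
    then have X: "(\<Sum>e\<in>?X. p e) = 0" using A I by simp
    have "star ?K (vmin \<gamma> v) = ?X"
      using vmin_eq_iff[OF g, of v] v fg_att_in[OF g] c
      by (auto simp: star_def s gcomp_iff external_def) metis+
    then show ?thesis using X by (simp add: mom_restrict_def cong: sum.cong_simp)
  qed
  moreover have "mom_restrict (external \<gamma>) p e + mom_restrict (external \<gamma>) p (invol \<Gamma> e) = 0"
    if "e \<in> external \<gamma>" "e \<noteq> invol \<Gamma> e" for e
    using that covering_invol_external[OF assms(1,2) that(1)] external_hedges[OF assms(2)] assms(3)
    by (auto simp: mom_restrict_def W_iff)
  moreover have "mom_restrict (external \<gamma>) p e = 0" if "e \<notin> external \<gamma>" for e
    using that by (simp add: mom_restrict_def)
  ultimately show ?thesis by (auto simp: W_iff s)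
qed

text \<open>Pullback of momenta along an isomorphism. It depends on the half-edge map alone, so the
  vertex maps of graphs and of their contractions may differ.\<close>

definition pull :: "(nat \<Rightarrow> nat) \<Rightarrow> 'e fgraph \<Rightarrow> ('d::finite) momenta \<Rightarrow> 'd momenta" where
  "pull g \<Gamma> p = mom_restrict (hedges \<Gamma>) (p \<circ> g)"

lemma W_pull:
  assumes "is_fgraph T \<Gamma>" "shape_iso f g \<Gamma> \<Gamma>'" "p \<in> W \<Gamma>'"
  shows "pull g \<Gamma> p \<in> W \<Gamma>"
proof -
  note s = shape_isoD[OF assms(2)]
  have "(\<Sum>e\<in>star \<Gamma> v. pull g \<Gamma> p e) = 0" if v: "v \<in> verts \<Gamma>" for v
  proof -
    have "f (att \<Gamma> e) = f v \<longleftrightarrow> att \<Gamma> e = v" if "e \<in> hedges \<Gamma>" for e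
      by (rule inj_on_eq_iff[OF s(5) fg_att_in[OF assms(1) that] v])
    then have st: "star \<Gamma>' (f v) = g ` star \<Gamma> v" using s(8) by (auto simp: star_def s(4))
    have "(\<Sum>e\<in>star \<Gamma> v. pull g \<Gamma> p e) = (\<Sum>e\<in>star \<Gamma> v. p (g e))"
      by (intro sum.cong) (auto simp: pull_def mom_restrict_def star_def)
    also have "\<dots> = (\<Sum>e\<in>star \<Gamma>' (f v). p e)"
      unfolding st using inj_on_subset[OF s(6), of "star \<Gamma> v"]
      by (subst sum.reindex) (auto simp: star_def)
    also have "\<dots> = 0" using assms(3) s(1)[OF v] by (simp add: W_iff)
    finally show ?thesis .
  qed
  moreover have "pull g \<Gamma> p e + pull g \<Gamma> p (invol \<Gamma> e) = 0"
    if e: "e \<in> hedges \<Gamma>" "e \<noteq> invol \<Gamma> e" for e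
  proof -
    have ie: "invol \<Gamma> e \<in> hedges \<Gamma>" by (rule fg_invol_in[OF assms(1) e(1)])
    have "g e \<noteq> g (invol \<Gamma> e)" using inj_on_eq_iff[OF s(6) e(1) ie] e(2) by simp
    then show ?thesis
      using assms(3) s(2)[OF e(1)] s(7)[OF e(1)] e ie by (auto simp: W_iff pull_def mom_restrict_def)
  qed
  ultimately show ?thesis by (auto simp: W_iff) (simp add: pull_def mom_restrict_def)
qed

section \<open>Smooth functions\<close>

lemma Ck_on_continuous: "Ck_on n X f \<Longrightarrow> continuous_on X f"
  by (cases n) auto

lemma Ck_on_Suc_imp: "Ck_on (Suc n) X f \<Longrightarrow> Ck_on n X f"
proof (induction n arbitrary: f)
  case (Suc n)
  have "\<exists>g. (\<forall>p\<in>X. ((\<lambda>t. f (\<lambda>e. p e + t *\<^sub>R w e)) has_vector_derivative g p) (at 0)) \<and> Ck_on n X g"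
    if w: "w \<in> X" for w
  proof -
    obtain g where g: "\<forall>p\<in>X. ((\<lambda>t. f (\<lambda>e. p e + t *\<^sub>R w e)) has_vector_derivative g p) (at 0)"
      "Ck_on (Suc n) X g"
      using Suc.prems w unfolding Ck_on.simps(2)[of "Suc n"] by blast
    show ?thesis using g(1) Suc.IH[OF g(2)] by blast
  qed
  then show ?case using Ck_on_continuous[OF Suc.prems] by simp
qed simp

lemma Ck_on_const: "Ck_on n X (\<lambda>_. c)"
proof (induction n arbitrary: c)
  case (Suc n)
  then show ?case using has_vector_derivative_const by fastforce
qed simp

lemma Ck_on_add: "Ck_on n X f \<Longrightarrow> Ck_on n X g \<Longrightarrow> Ck_on n X (\<lambda>p. f p + g p)"
proof (induction n arbitrary: f g)
  case 0
  then show ?case by (simp add: continuous_on_add)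
next
  case (Suc n)
  have "\<exists>h. (\<forall>p\<in>X. ((\<lambda>t. f (\<lambda>e. p e + t *\<^sub>R w e) + g (\<lambda>e. p e + t *\<^sub>R w e)) has_vector_derivative h p) (at 0))
      \<and> Ck_on n X h" if w: "w \<in> X" for w
  proof -
    obtain f' g' where f': "\<forall>p\<in>X. ((\<lambda>t. f (\<lambda>e. p e + t *\<^sub>R w e)) has_vector_derivative f' p) (at 0)" "Ck_on n X f'"
      and g': "\<forall>p\<in>X. ((\<lambda>t. g (\<lambda>e. p e + t *\<^sub>R w e)) has_vector_derivative g' p) (at 0)" "Ck_on n X g'"
      using Suc.prems w by (simp only: Ck_on.simps) blast
    show ?thesis
      by (rule exI[of _ "\<lambda>p. f' p + g' p"])
        (use f' g' Suc.IH in \<open>auto intro!: has_vector_derivative_add\<close>)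
  qed
  then show ?case using Suc.prems by (simp add: continuous_on_add)
qed

text \<open>In the Leibniz rule the undifferentiated factors are known to order \<open>Suc n\<close>
  but enter to order n, whence \<open>Ck_on_Suc_imp\<close>.\<close>

lemma Ck_on_mult: "Ck_on n X f \<Longrightarrow> Ck_on n X g \<Longrightarrow> Ck_on n X (\<lambda>p. f p * g p)"
proof (induction n arbitrary: f g)
  case 0
  then show ?case by (simp add: continuous_on_mult)
next
  case (Suc n)
  have "\<exists>h. (\<forall>p\<in>X. ((\<lambda>t. f (\<lambda>e. p e + t *\<^sub>R w e) * g (\<lambda>e. p e + t *\<^sub>R w e)) has_vector_derivative h p) (at 0))
      \<and> Ck_on n X h" if w: "w \<in> X" for w
  proof -
    obtain f' g' where f': "\<forall>p\<in>X. ((\<lambda>t. f (\<lambda>e. p e + t *\<^sub>R w e)) has_vector_derivative f' p) (at 0)" "Ck_on n X f'"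
      and g': "\<forall>p\<in>X. ((\<lambda>t. g (\<lambda>e. p e + t *\<^sub>R w e)) has_vector_derivative g' p) (at 0)" "Ck_on n X g'"
      using Suc.prems w by (simp only: Ck_on.simps) blast
    have "((\<lambda>t. f (\<lambda>e. p e + t *\<^sub>R w e) * g (\<lambda>e. p e + t *\<^sub>R w e)) has_vector_derivative
        (f p * g' p + f' p * g p)) (at 0)" if "p \<in> X" for p
      using has_vector_derivative_mult[OF f'(1)[rule_format, OF that] g'(1)[rule_format, OF that]] by simp
    moreover have "Ck_on n X (\<lambda>p. f p * g' p + f' p * g p)"
      using Suc.prems f'(2) g'(2) by (intro Ck_on_add Suc.IH) (auto intro: Ck_on_Suc_imp simp del: Ck_on.simps)
    ultimately show ?thesis by (intro exI[of _ "\<lambda>p. f p * g' p + f' p * g p"]) simp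
  qed
  then show ?case using Suc.prems by (simp add: continuous_on_mult)
qed

lemma continuous_on_mom_restrict: "continuous_on X (mom_restrict E)"
proof (rule continuous_on_coordinatewise_then_product)
  show "continuous_on X (\<lambda>p. mom_restrict E p i)" for i
    by (cases "i \<in> E")
      (auto simp: mom_restrict_def intro: continuous_on_subset[OF continuous_on_product_coordinates])
qed

text \<open>\<open>mom_restrict\<close> is linear, so the derivative along w is the pullback of the
  derivative along the restricted direction, and the induction continues with that pullback.\<close>

lemma Ck_on_mom_restrict:
  assumes "mom_restrict E ` X \<subseteq> Y"
  shows "Ck_on n Y f \<Longrightarrow> Ck_on n X (\<lambda>p. f (mom_restrict E p))"
proof (induction n arbitrary: f)
  case 0
  then show ?case
    using continuous_on_compose2[OF _ continuous_on_mom_restrict assms] by simp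
next
  case (Suc n)
  have lin: "mom_restrict E (\<lambda>e. p e + t *\<^sub>R w e) = (\<lambda>e. mom_restrict E p e + t *\<^sub>R mom_restrict E w e)"
    for p w :: "nat \<Rightarrow> real ^ 'a" and t
    by (auto simp: mom_restrict_def)
  have "\<exists>h. (\<forall>p\<in>X. ((\<lambda>t. f (mom_restrict E (\<lambda>e. p e + t *\<^sub>R w e))) has_vector_derivative h p) (at 0))
      \<and> Ck_on n X h" if w: "w \<in> X" for w
  proof -
    obtain f' where "\<forall>p\<in>Y. ((\<lambda>t. f (\<lambda>e. p e + t *\<^sub>R mom_restrict E w e)) has_vector_derivative f' p) (at 0)"
      "Ck_on n Y f'"
      using Suc.prems w assms by (simp only: Ck_on.simps) blast
    then show ?thesis
      using Suc.IH assms by (intro exI[of _ "\<lambda>p. f' (mom_restrict E p)"]) (auto simp: lin)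
  qed
  moreover have "continuous_on X (\<lambda>p. f (mom_restrict E p))"
    by (rule continuous_on_compose2[OF Ck_on_continuous[OF Suc.prems] continuous_on_mom_restrict assms])
  ultimately show ?case by simp
qed

lemma smooth_on_const: "smooth_on X (\<lambda>_. c)"
  by (simp add: smooth_on_def Ck_on_const)

lemma smooth_on_mult: "smooth_on X f \<Longrightarrow> smooth_on X g \<Longrightarrow> smooth_on X (\<lambda>p. f p * g p)"
  by (simp add: smooth_on_def Ck_on_mult)

lemma smooth_on_prod:
  assumes "\<And>a. a \<in> A \<Longrightarrow> smooth_on X (f a)"
  shows "smooth_on X (\<lambda>p. \<Prod>a\<in>A. f a p)"
  using assms by (induction A rule: infinite_finite_induct) (auto intro: smooth_on_const smooth_on_mult)

lemma smooth_on_mom_restrict: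
  assumes "mom_restrict E ` X \<subseteq> Y" "smooth_on Y f"
  shows "smooth_on X (\<lambda>p. f (mom_restrict E p))"
  using assms(2) Ck_on_mom_restrict[OF assms(1)] by (simp add: smooth_on_def)

section \<open>The function spaces\<close>

text \<open>An elementary tensor, evaluated as a function of all momenta; \<open>V\<close> consists
  of the finite combinations of these.\<close>

definition tensor ::
  "'e fgraph \<Rightarrow> (nat set \<Rightarrow> ('d::finite) momenta \<Rightarrow> complex) \<Rightarrow> 'd momenta \<Rightarrow> complex" where
  "tensor \<Gamma> u p = (\<Prod>C\<in>gcomps \<Gamma>. u C (mom_restrict (hedges (comp_graph \<Gamma> C)) p))"

definition smooth_family :: "'e fgraph \<Rightarrow> (nat set \<Rightarrow> ('d::finite) momenta \<Rightarrow> complex) \<Rightarrow> bool" where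
  "smooth_family \<Gamma> u \<longleftrightarrow> (\<forall>C\<in>gcomps \<Gamma>. smooth_on (W (comp_graph \<Gamma> C)) (u C))"

lemma V_iff: "v \<in> V \<Gamma> \<longleftrightarrow> (\<exists>(n::nat) c u. (\<forall>k<n. smooth_family \<Gamma> (u k)) \<and>
    v = on_W \<Gamma> (\<lambda>p. \<Sum>k<n. c k * tensor \<Gamma> (u k) p))"
  unfolding V_def smooth_family_def tensor_def by blast

lemma V_zero: "(\<lambda>_. 0) \<in> V \<Gamma>"
  unfolding V_iff by (rule exI[of _ 0]) (auto simp: on_W_def)

lemma V_tensor:
  assumes "smooth_family \<Gamma> u"
  shows "on_W \<Gamma> (\<lambda>p. c * tensor \<Gamma> u p) \<in> V \<Gamma>"
  unfolding V_iff using assms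
  by (intro exI[of _ "Suc 0"] exI[of _ "\<lambda>_. c"] exI[of _ "\<lambda>_. u"]) auto

lemma V_add:
  assumes "v \<in> V \<Gamma>" "v' \<in> V \<Gamma>"
  shows "(\<lambda>p. v p + v' p) \<in> V \<Gamma>"
proof -
  obtain n c u where 1: "\<forall>k<n. smooth_family \<Gamma> (u k)"
      "v = on_W \<Gamma> (\<lambda>p. \<Sum>k<(n::nat). c k * tensor \<Gamma> (u k) p)"
    using assms(1) unfolding V_iff by blast
  obtain n' c' u' where 2: "\<forall>k<n'. smooth_family \<Gamma> (u' k)"
      "v' = on_W \<Gamma> (\<lambda>p. \<Sum>k<(n'::nat). c' k * tensor \<Gamma> (u' k) p)"
    using assms(2) unfolding V_iff by blast
  let ?c = "\<lambda>k. if k < n then c k else c' (k - n)" and ?u = "\<lambda>k. if k < n then u k else u' (k - n)"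
  have sp: "(\<Sum>k<n+n'. ?c k * tensor \<Gamma> (?u k) p) =
      (\<Sum>k<n. c k * tensor \<Gamma> (u k) p) + (\<Sum>k<n'. c' k * tensor \<Gamma> (u' k) p)" for p
    unfolding lessThan_atLeast0 sum.atLeastLessThan_concat[of 0 n "n + n'", simplified, symmetric]
    by (simp add: sum.shift_bounds_nat_ivl[of _ 0 n n', simplified add.commute[of n' n] add_0])
  show ?thesis
    unfolding V_iff
  proof (intro exI conjI)
    show "\<forall>k<n+n'. smooth_family \<Gamma> (?u k)" using 1(1) 2(1) by auto
    show "(\<lambda>p. v p + v' p) = on_W \<Gamma> (\<lambda>p. \<Sum>k<n+n'. ?c k * tensor \<Gamma> (?u k) p)"
      unfolding sp 1(2) 2(2) by (auto simp: on_W_def)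
  qed
qed

text \<open>One elementary tensor is split off at a time, so statements stable under addition reduce
  to elementary tensors.\<close>

lemma V_induct [consumes 1, case_names zero add]:
  assumes "v \<in> V \<Gamma>" "P (\<lambda>_. 0)"
    "\<And>c u w. smooth_family \<Gamma> u \<Longrightarrow> w \<in> V \<Gamma> \<Longrightarrow> P w \<Longrightarrow>
      P (\<lambda>p. w p + on_W \<Gamma> (\<lambda>p. c * tensor \<Gamma> u p) p)"
  shows "P v"
proof -
  obtain n c u where u: "\<forall>k<n. smooth_family \<Gamma> (u k)"
      "v = on_W \<Gamma> (\<lambda>p. \<Sum>k<(n::nat). c k * tensor \<Gamma> (u k) p)"
    using assms(1) unfolding V_iff by blast
  have "m \<le> n \<Longrightarrow> on_W \<Gamma> (\<lambda>p. \<Sum>k<m. c k * tensor \<Gamma> (u k) p) \<in> V \<Gamma> \<and>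
      P (on_W \<Gamma> (\<lambda>p. \<Sum>k<m. c k * tensor \<Gamma> (u k) p))" for m
  proof (induction m)
    case 0
    then show ?case using assms(2) V_zero[of \<Gamma>] by (simp add: on_W_def)
  next
    case (Suc m)
    have eq: "on_W \<Gamma> (\<lambda>p. \<Sum>k<Suc m. c k * tensor \<Gamma> (u k) p) =
        (\<lambda>p. on_W \<Gamma> (\<lambda>p. \<Sum>k<m. c k * tensor \<Gamma> (u k) p) p + on_W \<Gamma> (\<lambda>p. c m * tensor \<Gamma> (u m) p) p)"
      by (auto simp: on_W_def)
    have sm: "smooth_family \<Gamma> (u m)" using Suc.prems u(1) by simp
    show ?case unfolding eq
      using Suc assms(3)[OF sm] V_add[OF _ V_tensor[OF sm]] by auto
  qed
  then show ?thesis using u(2) by blast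
qed

lemma V_off: "v \<in> V \<Gamma> \<Longrightarrow> p \<notin> W \<Gamma> \<Longrightarrow> v p = 0"
  unfolding V_iff by (auto simp: on_W_def)

lemma V_scale:
  assumes "v \<in> V \<Gamma>"
  shows "(\<lambda>p. a * v p) \<in> V \<Gamma>"
  using assms
proof (induction rule: V_induct)
  case zero
  then show ?case using V_zero[of \<Gamma>] by simp
next
  case (add c u w)
  have "(\<lambda>p. a * (w p + on_W \<Gamma> (\<lambda>p. c * tensor \<Gamma> u p) p)) =
      (\<lambda>p. a * w p + on_W \<Gamma> (\<lambda>p. (a * c) * tensor \<Gamma> u p) p)"
    by (auto simp: on_W_def algebra_simps)
  then show ?case using V_add[OF add(3) V_tensor[OF add(1)]] by simp
qed

lemma V_sum:
  assumes "\<And>a. a \<in> A \<Longrightarrow> f a \<in> V \<Gamma>"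
  shows "(\<lambda>p. \<Sum>a\<in>A. f a p) \<in> V \<Gamma>"
  using assms by (induction A rule: infinite_finite_induct) (auto intro: V_zero V_add)

text \<open>Elementary tensors over the same components multiply factor by factor; bilinearity
  reduces to this case by one induction for each argument.\<close>

lemma V_mult:
  assumes "v \<in> V \<Gamma>" "v' \<in> V \<Gamma>"
  shows "(\<lambda>p. v p * v' p) \<in> V \<Gamma>"
  using assms(1)
proof (induction rule: V_induct)
  case zero
  then show ?case using V_zero[of \<Gamma>] by simp
next
  case (add c u w)
  have "(\<lambda>p. on_W \<Gamma> (\<lambda>p. c * tensor \<Gamma> u p) p * v' p) \<in> V \<Gamma>"
    using assms(2)
  proof (induction rule: V_induct)
    case zero
    then show ?case using V_zero[of \<Gamma>] by simp
  next
    case (add c' u' w')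
    have "smooth_family \<Gamma> (\<lambda>C p. u C p * u' C p)"
      using \<open>smooth_family \<Gamma> u\<close> add(1) by (simp add: smooth_family_def smooth_on_mult)
    from V_add[OF add(3) V_tensor[OF this, of "c * c'"]]
    show ?case by (simp add: on_W_def tensor_def prod.distrib algebra_simps if_distrib cong: if_cong)
  qed
  from V_add[OF add(3) this] show ?case by (simp add: algebra_simps)
qed

lemma Vone_in_V: "Vone \<Gamma> \<in> V \<Gamma>"
  using V_tensor[of \<Gamma> "\<lambda>_ _. 1" 1] by (simp add: Vone_def tensor_def smooth_family_def smooth_on_const)

text \<open>Components of \<open>\<Delta>\<close> lie in components of \<open>\<Gamma>\<close>, so pullback regroups the factors of a tensor.\<close>

lemma V_pullback:
  fixes v :: "('d::finite) momenta \<Rightarrow> complex"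
  assumes f: "is_fgraph T \<Gamma>" "is_fgraph T \<Delta>" and vs: "verts \<Delta> \<subseteq> verts \<Gamma>" and cn: "conn \<Delta> \<subseteq> conn \<Gamma>"
    and hs: "hedges \<Delta> \<subseteq> hedges \<Gamma>" and at: "\<And>e. e \<in> hedges \<Delta> \<Longrightarrow> (att \<Gamma> e, att \<Delta> e) \<in> conn \<Gamma>"
    and W: "\<And>p::'d momenta. p \<in> W \<Gamma> \<Longrightarrow> mom_restrict (hedges \<Delta>) p \<in> W \<Delta>"
    and v: "v \<in> V \<Delta>"
  shows "on_W \<Gamma> (\<lambda>p. v (mom_restrict (hedges \<Delta>) p)) \<in> V \<Gamma>"
  using v
proof (induction rule: V_induct)
  case zero
  then show ?case using V_zero[of \<Gamma>] by (simp add: on_W_def)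
next
  case (add c u w)
  \<comment> \<open>The component of \<Gamma> that contains the component D of \<Delta>, written as
    a union to avoid choosing a vertex.\<close>
  define k where "k D = (\<Union>x\<in>D. gcomp \<Gamma> x)" for D
  have k: "k (gcomp \<Delta> a) = gcomp \<Gamma> a" if "a \<in> verts \<Delta>" for a
  proof -
    have "gcomp \<Gamma> x = gcomp \<Gamma> a" if "x \<in> gcomp \<Delta> a" for x
      using that cn gcomp_eqI[OF f(1)] by (auto simp: gcomp_iff)
    then have "k (gcomp \<Delta> a) = (\<Union>x\<in>gcomp \<Delta> a. gcomp \<Gamma> a)" unfolding k_def by (intro SUP_cong refl)
    also have "\<dots> = gcomp \<Gamma> a" using gcomp_self[OF that] by (intro UN_constant_eq) auto
    finally show ?thesis .
  qed
  have kD: "k D \<in> gcomps \<Gamma>" if "D \<in> gcomps \<Delta>" for D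
    using that k vs by (auto simp: gcomps_eq)
  have hD: "hedges (comp_graph \<Delta> D) \<subseteq> hedges (comp_graph \<Gamma> (k D))" if D: "D \<in> gcomps \<Delta>" for D
  proof
    fix e assume e: "e \<in> hedges (comp_graph \<Delta> D)"
    obtain a where a: "a \<in> verts \<Delta>" "D = gcomp \<Delta> a" using D by (auto simp: gcomps_eq)
    have "(a, att \<Delta> e) \<in> conn \<Gamma>" using e a cn by (auto simp: gcomp_iff)
    moreover have "(att \<Delta> e, att \<Gamma> e) \<in> conn \<Gamma>" using e conn_sym[OF f(1) at] by auto
    ultimately have "att \<Gamma> e \<in> gcomp \<Gamma> a" using conn_trans by (metis gcomp_iff)
    then show "e \<in> hedges (comp_graph \<Gamma> (k D))" using e hs k[OF a(1)] a(2) by auto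
  qed
  \<comment> \<open>The factor at C collects the factors of all components of \<Delta> lying over
    C.\<close>
  define u' where "u' C q = (\<Prod>D\<in>{D \<in> gcomps \<Delta>. k D = C}. u D (mom_restrict (hedges (comp_graph \<Delta> D)) q))"
    for C q
  have "smooth_family \<Gamma> u'"
    unfolding smooth_family_def u'_def
  proof (intro ballI smooth_on_prod, clarify)
    fix D assume D: "D \<in> gcomps \<Delta>" "k D \<in> gcomps \<Gamma>"
    have "mom_restrict (hedges (comp_graph \<Delta> D)) ` W (comp_graph \<Gamma> (k D)) \<subseteq>
        (W (comp_graph \<Delta> D) :: 'd momenta set)"
    proof clarify
      fix q :: "'d momenta" assume "q \<in> W (comp_graph \<Gamma> (k D))"
      \<comment> \<open>The hypothesis on momenta concerns all of \<Gamma>, so q is first extended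
        by 0 from the component to \<Gamma>.\<close>
      then have "q \<in> W \<Gamma>"
        using W_comp_graph_subset[OF f(1) closed_in_gcomps[OF f(1) D(2)]] by auto
      then have "mom_restrict (hedges (comp_graph \<Delta> D)) (mom_restrict (hedges \<Delta>) q) \<in> W (comp_graph \<Delta> D)"
        by (intro W_comp_graph[OF f(2) closed_in_gcomps[OF f(2) D(1)]] W)
      moreover have "hedges (comp_graph \<Delta> D) \<inter> hedges \<Delta> = hedges (comp_graph \<Delta> D)" by auto
      ultimately show "mom_restrict (hedges (comp_graph \<Delta> D)) q \<in> W (comp_graph \<Delta> D)"
        unfolding mom_restrict_mom_restrict by simp
    qed
    then show "smooth_on (W (comp_graph \<Gamma> (k D))) (\<lambda>q. u D (mom_restrict (hedges (comp_graph \<Delta> D)) q))"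
      using add(1) D(1) by (intro smooth_on_mom_restrict) (auto simp: smooth_family_def)
  qed
  moreover have "tensor \<Delta> u (mom_restrict (hedges \<Delta>) p) = tensor \<Gamma> u' p" for p
  proof -
    have "tensor \<Gamma> u' p = (\<Prod>C\<in>gcomps \<Gamma>. \<Prod>D\<in>{D \<in> gcomps \<Delta>. k D = C}.
        u D (mom_restrict (hedges (comp_graph \<Delta> D)) p))"
      unfolding tensor_def u'_def
    proof (intro prod.cong refl, clarify)
      fix D assume D: "D \<in> gcomps \<Delta>"
      show "u D (mom_restrict (hedges (comp_graph \<Delta> D)) (mom_restrict (hedges (comp_graph \<Gamma> (k D))) p)) =
          u D (mom_restrict (hedges (comp_graph \<Delta> D)) p)"
        using hD[OF D] by (simp only: mom_restrict_mom_restrict Int_absorb2)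
    qed
    also have "\<dots> = (\<Prod>D\<in>gcomps \<Delta>. u D (mom_restrict (hedges (comp_graph \<Delta> D)) p))"
      using kD finite_gcomps[OF f(1)] finite_gcomps[OF f(2)] by (intro prod.group) auto
    also have "\<dots> = tensor \<Delta> u (mom_restrict (hedges \<Delta>) p)"
      unfolding tensor_def mom_restrict_mom_restrict
    proof (intro prod.cong refl)
      fix D
      have "hedges (comp_graph \<Delta> D) \<inter> hedges \<Delta> = hedges (comp_graph \<Delta> D)" by auto
      then show "u D (mom_restrict (hedges (comp_graph \<Delta> D)) p) =
          u D (mom_restrict (hedges (comp_graph \<Delta> D) \<inter> hedges \<Delta>) p)" by (simp only:)
    qed
    finally show ?thesis by simp
  qed
  ultimately have "on_W \<Gamma> (\<lambda>p. c * tensor \<Delta> u (mom_restrict (hedges \<Delta>) p)) \<in> V \<Gamma>"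
    using V_tensor[of \<Gamma> u' c] by simp
  from V_add[OF add(3) this] show ?case
    using W by (auto simp: on_W_def if_distrib cong: if_cong)
qed

lemma V_covering:
  fixes v :: "('d::finite) momenta \<Rightarrow> complex"
  assumes "is_fgraph T \<Gamma>" "covering \<gamma> \<Gamma>" "v \<in> V \<gamma>"
  shows "on_W \<Gamma> v \<in> V \<Gamma>"
proof -
  note c = covering_simps[OF assms(2)]
  have "on_W \<Gamma> (\<lambda>p. v (mom_restrict (hedges \<gamma>) p)) \<in> V \<Gamma>"
  proof (rule V_pullback[OF assms(1) covering_is_fgraph[OF assms(1,2)]])
    show "mom_restrict (hedges \<gamma>) p \<in> W \<gamma>" if "p \<in> W \<Gamma>" for p :: "'d momenta"
      using that mom_restrict_W[OF that] W_covering[OF assms(2)] by (auto simp: c)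
  qed (use assms c conn_mono[OF assms(1,2)] fg_att_in[OF assms(1)] in \<open>auto intro: conn_refl\<close>)
  moreover have "on_W \<Gamma> (\<lambda>p. v (mom_restrict (hedges \<gamma>) p)) = on_W \<Gamma> v"
    by (auto simp: on_W_def fun_eq_iff c mom_restrict_W)
  ultimately show ?thesis by simp
qed

lemma V_contract:
  fixes v :: "('d::finite) momenta \<Rightarrow> complex"
  assumes "is_fgraph T \<Gamma>" "covering \<gamma> \<Gamma>" "v \<in> V (contract \<Gamma> \<gamma> j)"
  shows "on_W \<Gamma> (\<lambda>p. v (mom_restrict (external \<gamma>) p)) \<in> V \<Gamma>"
proof -
  note s = contract_simps[OF assms(1,2)]
  have "on_W \<Gamma> (\<lambda>p. v (mom_restrict (hedges (contract \<Gamma> \<gamma> j)) p)) \<in> V \<Gamma>"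
  proof (rule V_pullback[OF assms(1) is_fgraph_contract[OF assms(1,2)]])
    show "mom_restrict (hedges (contract \<Gamma> \<gamma> j)) p \<in> W (contract \<Gamma> \<gamma> j)" if "p \<in> W \<Gamma>" for p :: "'d momenta"
      using W_contract[OF assms(1,2) that] by (simp add: s)
    show "(att \<Gamma> e, att (contract \<Gamma> \<gamma> j) e) \<in> conn \<Gamma>" if "e \<in> hedges (contract \<Gamma> \<gamma> j)" for e
      using that vmin_conn_covering[OF assms(1,2)] fg_att_in[OF assms(1)] external_hedges[OF assms(2)]
      by (simp add: s)
    show "verts (contract \<Gamma> \<gamma> j) \<subseteq> verts \<Gamma>" by (rule contract_verts_subset[OF assms(1,2)])
    show "conn (contract \<Gamma> \<gamma> j) \<subseteq> conn \<Gamma>" using conn_contract[OF assms(1,2)] by blast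
    show "hedges (contract \<Gamma> \<gamma> j) \<subseteq> hedges \<Gamma>" using external_hedges[OF assms(2)] by (auto simp: s)
  qed fact
  then show ?thesis by (simp add: s)
qed

section \<open>Characters as functions on specified graphs, and their convolution\<close>

section \<open>Multiplicative functions on specified graphs\<close>

type_synonym ('e, 'd) gfun = "'e sgraph \<Rightarrow> 'd momenta \<Rightarrow> complex"

text \<open>The elements of \<open>Gset\<close> stripped of linearity. The value at the empty graph
  is a case of the normalisation, and independence of the specification is invariance under the
  identity isomorphism.\<close>

definition gchars :: "'e ftheory \<Rightarrow> ('e, 'd::finite) gfun set" where
  "gchars T = {F. (\<forall>s. specified T s \<longrightarrow> F s \<in> V (fst s)) \<and>
     (\<forall>s. specified T s \<longrightarrow> no_internal (fst s) \<longrightarrow> F s = Vone (fst s)) \<and>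
     (\<forall>s s' f g. specified T s \<longrightarrow> specified T s' \<longrightarrow> graph_iso f g (fst s) (fst s') \<longrightarrow>
        (\<forall>p\<in>W (fst s'). F s' p = F s (pull g (fst s) p))) \<and>
     (\<forall>s s'. specified T s \<longrightarrow> specified T s' \<longrightarrow> gdisjoint (fst s) (fst s') \<longrightarrow>
        F (sunion s s') = concat (fst s) (fst s') (F s) (F s'))}"

lemma gcharsD:
  assumes "F \<in> gchars T"
  shows gc_V: "specified T s \<Longrightarrow> F s \<in> V (fst s)"
    and gc_one: "specified T s \<Longrightarrow> no_internal (fst s) \<Longrightarrow> F s = Vone (fst s)"
    and gc_iso: "specified T s \<Longrightarrow> specified T s' \<Longrightarrow> graph_iso f g (fst s) (fst s') \<Longrightarrow>
      p \<in> W (fst s') \<Longrightarrow> F s' p = F s (pull g (fst s) p)"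
    and gc_mult: "specified T s \<Longrightarrow> specified T s' \<Longrightarrow> gdisjoint (fst s) (fst s') \<Longrightarrow>
      F (sunion s s') = concat (fst s) (fst s') (F s) (F s')"
  using assms unfolding gchars_def by blast+

lemma gcharsI:
  assumes "\<And>s. specified T s \<Longrightarrow> F s \<in> V (fst s)"
    "\<And>s. specified T s \<Longrightarrow> no_internal (fst s) \<Longrightarrow> F s = Vone (fst s)"
    "\<And>s s' f g p. specified T s \<Longrightarrow> specified T s' \<Longrightarrow> graph_iso f g (fst s) (fst s') \<Longrightarrow>
      p \<in> W (fst s') \<Longrightarrow> F s' p = F s (pull g (fst s) p)"
    "\<And>s s'. specified T s \<Longrightarrow> specified T s' \<Longrightarrow> gdisjoint (fst s) (fst s') \<Longrightarrow>
      F (sunion s s') = concat (fst s) (fst s') (F s) (F s')"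
  shows "F \<in> gchars T"
  using assms unfolding gchars_def by blast

lemma on_W_in: "p \<in> W \<Gamma> \<Longrightarrow> on_W \<Gamma> v p = v p"
  by (simp add: on_W_def)

lemma on_W_sum: "on_W \<Gamma> (\<lambda>p. \<Sum>a\<in>A. f a p) = (\<lambda>p. \<Sum>a\<in>A. on_W \<Gamma> (f a) p)"
  by (auto simp: on_W_def)

lemma Vone_in: "p \<in> W \<Gamma> \<Longrightarrow> Vone \<Gamma> p = 1"
  by (simp add: Vone_def on_W_def)

lemma concat_in:
  "p \<in> W (gunion \<Gamma> \<Gamma>') \<Longrightarrow> concat \<Gamma> \<Gamma>' v v' p = v (mom_restrict (hedges \<Gamma>) p) * v' (mom_restrict (hedges \<Gamma>') p)"
  by (simp add: concat_def on_W_def)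

lemma concat_off: "p \<notin> W (gunion \<Gamma> \<Gamma>') \<Longrightarrow> concat \<Gamma> \<Gamma>' v v' p = 0"
  by (simp add: concat_def on_W_def)

lemma W_gunion:
  assumes "is_fgraph T \<Gamma>" "is_fgraph T \<Gamma>'" "gdisjoint \<Gamma> \<Gamma>'" "p \<in> W (gunion \<Gamma> \<Gamma>')"
  shows "mom_restrict (hedges \<Gamma>) p \<in> W \<Gamma>" "mom_restrict (hedges \<Gamma>') p \<in> W \<Gamma>'"
  using W_comp_graph[OF is_fgraph_gunion[OF assms(1-3)] closed_in_gunion[OF assms(1-3)] assms(4)]
    W_comp_graph[OF is_fgraph_gunion[OF assms(1-3)] comp_graph_gunion2(1)[OF assms(1-3)] assms(4)]
  unfolding comp_graph_gunion[OF assms(1-3)] comp_graph_gunion2(2)[OF assms(1-3)] .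

text \<open>The bare vertices form a disjoint part without internal edges, where F is 1;
  multiplicativity leaves the value on the remaining part.\<close>

lemma gchars_naked_compl:
  assumes T: "valid_theory T" and F: "F \<in> gchars T" and s: "specified T s" and p: "p \<in> W (fst s)"
  shows "F s p = F (sub s (verts (fst s) - naked (fst s)))
    (mom_restrict (hedges (comp_graph (fst s) (verts (fst s) - naked (fst s)))) p)"
proof -
  let ?N = "naked (fst s)" and ?R = "verts (fst s) - naked (fst s)"
  note f = sp_fgraph[OF T s]
  note cl = closed_in_naked[of "fst s"]
  note cl' = closed_in_compl[OF f cl]
  note g = gunion_comp_graph[OF f cl]
  note sp = specified_sub[OF T s cl] specified_sub[OF T s cl']
  have "F s = F (sunion (sub s ?N) (sub s ?R))" by (simp add: sunion_sub[OF T s cl])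
  also have "\<dots> = concat (fst (sub s ?N)) (fst (sub s ?R)) (F (sub s ?N)) (F (sub s ?R))"
    by (rule gc_mult[OF F sp]) (use g(2) in simp)
  also have "F (sub s ?N) = Vone (fst (sub s ?N))"
    by (rule gc_one[OF F sp(1)]) (simp add: no_internal_naked)
  finally show ?thesis
    using p W_comp_graph[OF f cl p] g(1) by (simp add: concat_in Vone_in)
qed

text \<open>After the bare vertices are dropped on both sides, the weak isomorphism is a genuine
  one.\<close>

lemma gchars_weak_iso:
  assumes T: "valid_theory T" and F: "F \<in> gchars T" and s: "specified T s" "specified T s'"
    and wi: "weak_iso f g (fst s) (fst s')" and p: "p \<in> W (fst s')"
  shows "F s' p = F s (pull g (fst s) p)"
proof -
  let ?R = "verts (fst s) - naked (fst s)" and ?R' = "verts (fst s') - naked (fst s')"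
  let ?H = "hedges (comp_graph (fst s) ?R)" and ?H' = "hedges (comp_graph (fst s') ?R')"
  note f = sp_fgraph[OF T s(1)] and f' = sp_fgraph[OF T s(2)]
  note cl = closed_in_compl[OF f closed_in_naked] and cl' = closed_in_compl[OF f' closed_in_naked]
  have si: "shape_iso f g (fst s) (fst s')" using wi by (simp add: weak_iso_def)
  note gi = graph_iso_naked_compl[OF f f' wi]
  have "g e \<in> ?H'" if "e \<in> ?H" for e
    using gi that si_g[of f g "comp_graph (fst s) ?R" "comp_graph (fst s') ?R'" e]
    unfolding graph_iso_iff by blast
  moreover have "e \<in> hedges (fst s)" if "e \<in> ?H" for e using that by simp
  ultimately have eq: "pull g (comp_graph (fst s) ?R) (mom_restrict ?H' p) = mom_restrict ?H (pull g (fst s) p)"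
    unfolding pull_def mom_restrict_def by (intro ext) (auto simp del: comp_graph_simps(2))
  have "F s' p = F (sub s' ?R') (mom_restrict ?H' p)"
    by (rule gchars_naked_compl[OF T F s(2) p])
  also have "\<dots> = F (sub s ?R) (pull g (fst (sub s ?R)) (mom_restrict ?H' p))"
    by (rule gc_iso[OF F specified_sub[OF T s(1) cl] specified_sub[OF T s(2) cl']])
      (use gi W_comp_graph[OF f' cl' p] in auto)
  also have "\<dots> = F s (pull g (fst s) p)"
    using gchars_naked_compl[OF T F s(1) W_pull[OF f si p]] eq by simp
  finally show ?thesis .
qed

section \<open>Convolution\<close>

text \<open>A summand of the convolution with both pullbacks written out; the restriction to momenta
  in \<open>W\<close> is imposed once, in \<open>gconv\<close>.\<close>

definition cterm :: "('e, 'd::finite) gfun \<Rightarrow> ('e, 'd) gfun \<Rightarrow> 'e sgraph \<Rightarrow> 'e sgraph \<Rightarrow> 'd momenta \<Rightarrow> complex" where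
  "cterm F G s t p = F t p * G (spec_contract s t) (mom_restrict (external (fst t)) p)"

definition gconv :: "'e ftheory \<Rightarrow> ('e, 'd::finite) gfun \<Rightarrow> ('e, 'd) gfun \<Rightarrow> ('e, 'd) gfun" where
  "gconv T F G s = on_W (fst s) (\<lambda>p. \<Sum>t\<in>Cov T s. cterm F G s t p)"

text \<open>The counit of the bialgebra, with values in constant functions.\<close>

definition gunit :: "('e, 'd::finite) gfun" where
  "gunit s = (if no_internal (fst s) then Vone (fst s) else (\<lambda>_. 0))"

context
  fixes T :: "'e ftheory"
  assumes T: "valid_theory T"
begin

lemma W_spec_contract:
  fixes p :: "('d::finite) momenta"
  assumes "spec_covering T t s" "p \<in> W (fst s)"
  shows "mom_restrict (external (fst t)) p \<in> W (fst (spec_contract s t))"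
  unfolding fst_spec_contract
  by (rule W_contract[OF sp_fgraph[OF T cov_sp2[OF assms(1)]] cov_cov[OF assms(1)] assms(2)])

text \<open>The residue has no internal edges, so normalisation makes the right factor equal to
  1.\<close>

lemma cterm_top:
  assumes G: "G \<in> gchars T" and s: "specified T s" and p: "p \<in> W (fst s)"
  shows "cterm F G s s p = F s p"
proof -
  have "G (spec_contract s s) = Vone (fst (spec_contract s s))"
    using gc_one[OF G specified_spec_contract[OF T Cov_refl[OF s]]] no_internal_contract[OF T Cov_refl[OF s]]
    by simp
  then show ?thesis
    using W_spec_contract[OF Cov_refl[OF s] p] by (simp add: cterm_def Vone_in)
qed

lemma cterm_V:
  assumes "spec_covering T t s" "F t \<in> V (fst t)" "G (spec_contract s t) \<in> V (fst (spec_contract s t))"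
  shows "on_W (fst s) (cterm F G s t) \<in> V (fst s)"
proof -
  note f = sp_fgraph[OF T cov_sp2[OF assms(1)]] and c = cov_cov[OF assms(1)]
  have "on_W (fst s) (cterm F G s t) = (\<lambda>p. on_W (fst s) (F t) p *
      on_W (fst s) (\<lambda>p. G (spec_contract s t) (mom_restrict (external (fst t)) p)) p)"
    by (auto simp: on_W_def cterm_def)
  then show ?thesis
    using V_mult[OF V_covering[OF f c assms(2)] V_contract[OF f c, of "G (spec_contract s t)" "snd t"]]
      assms(3) by (simp add: fst_spec_contract)
qed

text \<open>Invariance of F is asked for on the set A only, because the inductive treatment of the
  inverse knows its left factor only on proper coverings.\<close>

lemma sum_cterm_transfer:
  assumes G: "G \<in> gchars T" and s: "specified T s" "specified T s'"
    and iso: "graph_iso f g (fst s) (fst s')" and p: "p \<in> W (fst s')" and A: "A \<subseteq> Cov T s"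
    and F: "\<And>t. t \<in> A \<Longrightarrow> F (cov_transfer f g s s' t) p = F t (pull g (fst t) p)"
  shows "(\<Sum>t\<in>cov_transfer f g s s' ` A. cterm F G s' t p) = (\<Sum>t\<in>A. cterm F G s t (pull g (fst s) p))"
proof -
  have "inj_on (cov_transfer f g s s') A"
    using bij_betw_Cov[OF T s iso] A by (meson bij_betw_imp_inj_on inj_on_subset)
  then have "(\<Sum>t\<in>cov_transfer f g s s' ` A. cterm F G s' t p) = (\<Sum>t\<in>A. cterm F G s' (cov_transfer f g s s' t) p)"
    by (simp add: sum.reindex)
  also have "\<dots> = (\<Sum>t\<in>A. cterm F G s t (pull g (fst s) p))"
  proof (rule sum.cong[OF refl])
    fix t assume "t \<in> A"
    then have t: "spec_covering T t s" and Ft: "F (cov_transfer f g s s' t) p = F t (pull g (fst t) p)"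
      using A F by auto
    let ?t' = "cov_transfer f g s s' t"
    note C = Cov_transfer[OF T s iso t]
    note e = external_transfer[OF T s iso t]
    obtain f' where wi: "weak_iso f' g (fst (spec_contract s t)) (fst (spec_contract s' ?t'))"
      using weak_iso_transfer[OF T s iso t] by blast
    have "F ?t' p = F t (pull g (fst s) p)"
      using Ft covering_simps[OF cov_cov[OF t]] by (simp add: pull_def)
    \<comment> \<open>The two contractions may carry different indices at bare vertices, so
      invariance under weak isomorphisms is required of G.\<close>
    moreover have "G (spec_contract s' ?t') (mom_restrict (external (fst ?t')) p) =
        G (spec_contract s t) (pull g (fst (spec_contract s t)) (mom_restrict (external (fst ?t')) p))"
      by (rule gchars_weak_iso[OF T G specified_spec_contract[OF T t] specified_spec_contract[OF T C] wi
            W_spec_contract[OF C p]])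
    moreover have "pull g (fst (spec_contract s t)) (mom_restrict (external (fst ?t')) p) =
        mom_restrict (external (fst t)) (pull g (fst s) p)"
      using external_hedges[OF cov_cov[OF t]]
      by (auto simp: pull_def mom_restrict_def e fst_spec_contract fun_eq_iff
          contract_simps(2)[OF sp_fgraph[OF T s(1)] cov_cov[OF t]])
    ultimately show "cterm F G s' ?t' p = cterm F G s t (pull g (fst s) p)" by (simp add: cterm_def)
  qed
  finally show ?thesis .
qed

text \<open>Only the value of F at this one union has to factorise, so the lemma also applies inside
  the induction for the inverse. Restricting momenta in stages is harmless, since free half-edges of
  each part stay in that part.\<close>

lemma cterm_sunion:
  assumes G: "G \<in> gchars T" and t: "spec_covering T t s" "spec_covering T t' s'"
    and d: "gdisjoint (fst s) (fst s')" and p: "p \<in> W (gunion (fst s) (fst s'))"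
    and F: "F (sunion t t') = concat (fst t) (fst t') (F t) (F t')"
  shows "cterm F G (sunion s s') (sunion t t') p =
    cterm F G s t (mom_restrict (hedges (fst s)) p) * cterm F G s' t' (mom_restrict (hedges (fst s')) p)"
proof -
  let ?p = "mom_restrict (hedges (fst s)) p" and ?p' = "mom_restrict (hedges (fst s')) p"
  let ?q = "mom_restrict (external (fst (sunion t t'))) p"
  let ?K = "spec_contract s t" and ?K' = "spec_contract s' t'"
  note C = Cov_sunion[OF T t d]
  note c = covering_simps[OF cov_cov[OF t(1)]] and c' = covering_simps[OF cov_cov[OF t(2)]]
  note K = spec_contract_sunion[OF T t d]
  have pt: "p \<in> W (gunion (fst t) (fst t'))"
    using W_covering[OF cov_cov[OF C]] p by auto
  have Ft: "F (sunion t t') p = F t ?p * F t' ?p'"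
    unfolding F concat_in[OF pt] by (simp add: c c')
  have q: "?q \<in> W (gunion (fst ?K) (fst ?K'))"
    using W_spec_contract[OF C, of p] p by (simp add: K(1))
  have h: "hedges (fst ?K) = external (fst t)" "hedges (fst ?K') = external (fst t')"
    using contract_simps(2)[OF sp_fgraph[OF T cov_sp2[OF t(1)]] cov_cov[OF t(1)]]
      contract_simps(2)[OF sp_fgraph[OF T cov_sp2[OF t(2)]] cov_cov[OF t(2)]]
    by (simp_all add: fst_spec_contract)
  have d': "hedges (fst t) \<inter> hedges (fst t') = {}" using d by (simp add: gdisjoint_def c c')
  have e: "external (fst t) \<subseteq> external (fst (sunion t t'))" "external (fst t') \<subseteq> external (fst (sunion t t'))"
    using d' by (auto simp: external_def)
  have e': "external (fst t) \<subseteq> hedges (fst s)" "external (fst t') \<subseteq> hedges (fst s')"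
    using external_hedges[OF cov_cov[OF t(1)]] external_hedges[OF cov_cov[OF t(2)]] by auto
  have "G (spec_contract (sunion s s') (sunion t t')) ?q =
      G ?K (mom_restrict (external (fst t)) ?q) * G ?K' (mom_restrict (external (fst t')) ?q)"
    using gc_mult[OF G specified_spec_contract[OF T t(1)] specified_spec_contract[OF T t(2)] K(2)] q
    by (simp add: K(1) concat_in h)
  also have "\<dots> = G ?K (mom_restrict (external (fst t)) ?p) * G ?K' (mom_restrict (external (fst t')) ?p')"
    using e e' by (simp only: mom_restrict_mom_restrict Int_absorb2)
  finally show ?thesis unfolding cterm_def Ft by simp
qed

lemma sum_cterm_sunion:
  assumes s: "specified T s" "specified T s'" and d: "gdisjoint (fst s) (fst s')"
    and A: "A \<subseteq> Cov T s \<times> Cov T s'"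
  shows "(\<Sum>u\<in>(\<lambda>(t, t'). sunion t t') ` A. cterm F G (sunion s s') u p) =
    (\<Sum>(t, t')\<in>A. cterm F G (sunion s s') (sunion t t') p)"
proof -
  have "inj_on (\<lambda>(t, t'). sunion t t') A"
    using bij_betw_Cov_sunion[OF T s d] A by (meson bij_betw_imp_inj_on inj_on_subset)
  then show ?thesis by (simp add: sum.reindex case_prod_unfold)
qed

lemma gconv_gchars:
  fixes F G :: "('e, 'd::finite) gfun"
  assumes F: "F \<in> gchars T" and G: "G \<in> gchars T"
  shows "gconv T F G \<in> gchars T"
proof (rule gcharsI)
  fix s :: "'e sgraph" assume s: "specified T s"
  show "gconv T F G s \<in> V (fst s)"
    unfolding gconv_def on_W_sum
    by (rule V_sum) (use cterm_V gc_V[OF F] gc_V[OF G] cov_sp1 specified_spec_contract[OF T] in blast)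
  assume n: "no_internal (fst s)"
  show "gconv T F G s = Vone (fst s)"
    using cterm_top[OF G s] gc_one[OF F s n] Cov_no_internal[OF T s n] by (auto simp: gconv_def on_W_def Vone_def)
next
  fix s s' :: "'e sgraph" and f g and p :: "'d momenta"
  assume s: "specified T s" "specified T s'" and iso: "graph_iso f g (fst s) (fst s')" and p: "p \<in> W (fst s')"
  have si: "shape_iso f g (fst s) (fst s')" using iso by (simp add: graph_iso_iff)
  have "(\<Sum>t\<in>cov_transfer f g s s' ` Cov T s. cterm F G s' t p) = (\<Sum>t\<in>Cov T s. cterm F G s t (pull g (fst s) p))"
  proof (rule sum_cterm_transfer[OF G s iso p subset_refl])
    fix t assume "t \<in> Cov T s"
    then have t: "spec_covering T t s" by simp
    note C = Cov_transfer[OF T s iso t]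
    show "F (cov_transfer f g s s' t) p = F t (pull g (fst t) p)"
      by (rule gc_iso[OF F cov_sp1[OF t] cov_sp1[OF C] iso_transfer[OF T s iso t]])
        (use p W_covering[OF cov_cov[OF C]] in auto)
  qed
  moreover have "cov_transfer f g s s' ` Cov T s = Cov T s'"
    using bij_betw_Cov[OF T s iso] by (simp add: bij_betw_def)
  ultimately show "gconv T F G s' p = gconv T F G s (pull g (fst s) p)"
    using p W_pull[OF sp_fgraph[OF T s(1)] si p] by (simp add: gconv_def on_W_in)
next
  fix s s' :: "'e sgraph"
  assume s: "specified T s" "specified T s'" and d: "gdisjoint (fst s) (fst s')"
  note f = sp_fgraph[OF T s(1)] and f' = sp_fgraph[OF T s(2)]
  show "gconv T F G (sunion s s') = concat (fst s) (fst s') (gconv T F G s) (gconv T F G s')"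
  proof
    fix p :: "'d momenta"
    show "gconv T F G (sunion s s') p = concat (fst s) (fst s') (gconv T F G s) (gconv T F G s') p"
    proof (cases "p \<in> W (gunion (fst s) (fst s'))")
      case True
      let ?p = "mom_restrict (hedges (fst s)) p" and ?p' = "mom_restrict (hedges (fst s')) p"
      have "(\<lambda>(t, t'). sunion t t') ` (Cov T s \<times> Cov T s') = Cov T (sunion s s')"
        using bij_betw_Cov_sunion[OF T s d] by (simp add: bij_betw_def)
      then have "gconv T F G (sunion s s') p =
          (\<Sum>(t, t')\<in>Cov T s \<times> Cov T s'. cterm F G (sunion s s') (sunion t t') p)"
        using True sum_cterm_sunion[OF s d subset_refl, of F G p] by (simp add: gconv_def on_W_in)
      also have "\<dots> = (\<Sum>(t, t')\<in>Cov T s \<times> Cov T s'. cterm F G s t ?p * cterm F G s' t' ?p')"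
      proof (intro sum.cong refl, clarify)
        fix t j t' j' assume t: "spec_covering T (t, j) s" "spec_covering T (t', j') s'"
        have "gdisjoint (fst (t, j)) (fst (t', j'))"
          using d covering_simps[OF cov_cov[OF t(1)]] covering_simps[OF cov_cov[OF t(2)]] by (simp add: gdisjoint_def)
        from gc_mult[OF F cov_sp1[OF t(1)] cov_sp1[OF t(2)] this]
        show "cterm F G (sunion s s') (sunion (t, j) (t', j')) p = cterm F G s (t, j) ?p * cterm F G s' (t', j') ?p'"
          by (rule cterm_sunion[OF G t d True])
      qed
      also have "\<dots> = (\<Sum>t\<in>Cov T s. cterm F G s t ?p) * (\<Sum>t'\<in>Cov T s'. cterm F G s' t' ?p')"
        by (simp add: sum_product sum.cartesian_product)
      also have "\<dots> = concat (fst s) (fst s') (gconv T F G s) (gconv T F G s') p"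
        using W_gunion[OF f f' d True] by (simp add: concat_in[OF True] gconv_def on_W_in)
      finally show ?thesis .
    qed (simp add: concat_off gconv_def on_W_def)
  qed
qed

lemma gunit_sunion:
  fixes p :: "('d::finite) momenta"
  assumes s: "specified T s" "specified T s'" and d: "gdisjoint (fst s) (fst s')"
    and p: "p \<in> W (gunion (fst s) (fst s'))"
  shows "gunit (sunion s s') p =
    gunit s (mom_restrict (hedges (fst s)) p) * gunit s' (mom_restrict (hedges (fst s')) p)"
proof -
  have "no_internal (gunion (fst s) (fst s')) \<longleftrightarrow> no_internal (fst s) \<and> no_internal (fst s')"
    using d unfolding no_internal_def external_def gdisjoint_def by auto
  then show ?thesis
    using W_gunion[OF sp_fgraph[OF T s(1)] sp_fgraph[OF T s(2)] d p] p by (simp add: gunit_def Vone_in)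
qed

lemma gunit_iso:
  fixes p :: "('d::finite) momenta"
  assumes s: "specified T s" and iso: "graph_iso f g (fst s) (fst s')" and p: "p \<in> W (fst s')"
  shows "gunit s' p = gunit s (pull g (fst s) p)"
proof -
  have si: "shape_iso f g (fst s) (fst s')" using iso by (simp add: graph_iso_iff)
  note f = sp_fgraph[OF T s]
  have "external (fst s) \<subseteq> hedges (fst s)" by (auto simp: external_def)
  then have "no_internal (fst s') \<longleftrightarrow> no_internal (fst s)"
    unfolding no_internal_def external_shape_iso[OF f si] si_g_surj[OF si]
    by (rule inj_on_image_eq_iff[OF si_g_inj[OF si] _ subset_refl])
  then show ?thesis using W_pull[OF f si p] p by (simp add: gunit_def Vone_in)
qed

lemma gunit_gchars: "(gunit :: ('e, 'd::finite) gfun) \<in> gchars T"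
proof (rule gcharsI)
  fix s s' :: "'e sgraph"
  assume s: "specified T s" "specified T s'" and d: "gdisjoint (fst s) (fst s')"
  have "gunit (sunion s s') p = 0" if "p \<notin> W (gunion (fst s) (fst s'))" for p :: "'d momenta"
    using that by (simp add: gunit_def Vone_def on_W_def)
  then show "(gunit (sunion s s') :: 'd momenta \<Rightarrow> complex) = concat (fst s) (fst s') (gunit s) (gunit s')"
    using gunit_sunion[OF s d] by (auto simp: concat_def on_W_def fun_eq_iff)
next
  fix s s' :: "'e sgraph" and f g and p :: "'d momenta"
  assume "specified T s" "graph_iso f g (fst s) (fst s')" "p \<in> W (fst s')"
  then show "gunit s' p = gunit s (pull g (fst s) p)" by (rule gunit_iso)
qed (auto simp: gunit_def Vone_in_V V_zero)

text \<open>The unit vanishes on every covering with an internal edge, which leaves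
  \<open>bottom s\<close>; contracting that one gives back s.\<close>

lemma gconv_unit_left:
  fixes F :: "('e, 'd::finite) gfun"
  assumes F: "F \<in> gchars T" and s: "specified T s"
  shows "gconv T gunit F s = F s"
proof
  fix p :: "'d momenta"
  show "gconv T gunit F s p = F s p"
  proof (cases "p \<in> W (fst s)")
    case True
    note B = Cov_bottom[OF T s]
    have "(\<Sum>t\<in>Cov T s. cterm gunit F s t p) = (\<Sum>t\<in>{bottom s}. cterm gunit F s t p)"
      using finite_Cov[OF T, of s] B no_internal_Cov[OF T s]
      by (intro sum.mono_neutral_right) (auto simp: cterm_def gunit_def)
    also have "\<dots> = F s (mom_restrict (hedges (fst s)) p)"
    proof -
      have "p \<in> W (fst (bottom s))" using W_covering[OF cov_cov[OF B]] True by auto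
      moreover have "external (fst (bottom s)) = hedges (fst s)"
        using no_internal_bottom[OF T s] covering_simps[OF cov_cov[OF B]] by (simp add: no_internal_def)
      ultimately show ?thesis
        by (simp add: cterm_def gunit_def no_internal_bottom[OF T s] spec_contract_bottom[OF T s] Vone_in)
    qed
    finally show ?thesis using True by (simp add: gconv_def on_W_in mom_restrict_W)
  qed (use V_off[OF gc_V[OF F s]] in \<open>simp add: gconv_def on_W_def\<close>)
qed

lemma gconv_assoc:
  fixes F G H :: "('e, 'd::finite) gfun"
  assumes s: "specified T s"
  shows "gconv T (gconv T F G) H s = gconv T F (gconv T G H) s"
proof
  fix p :: "'d momenta"
  show "gconv T (gconv T F G) H s p = gconv T F (gconv T G H) s p"
  proof (cases "p \<in> W (fst s)")
    case True
    let ?m = "\<lambda>t. mom_restrict (external (fst t)) p"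
    have fin: "finite (Cov T s)" for s :: "'e sgraph" by (rule finite_Cov[OF T])
    have "gconv T (gconv T F G) H s p =
        (\<Sum>t\<in>Cov T s. \<Sum>r\<in>Cov T t. F r p * G (spec_contract t r) (?m r) * H (spec_contract s t) (?m t))"
      unfolding gconv_def[of T "gconv T F G"] on_W_in[OF True]
    proof (intro sum.cong refl, clarify)
      fix \<gamma> j assume t: "spec_covering T (\<gamma>, j) s"
      have "p \<in> W (fst (\<gamma>, j))" using W_covering[OF cov_cov[OF t]] True by auto
      then show "cterm (gconv T F G) H s (\<gamma>, j) p = (\<Sum>r\<in>Cov T (\<gamma>, j). F r p * G (spec_contract (\<gamma>, j) r) (?m r) *
          H (spec_contract s (\<gamma>, j)) (?m (\<gamma>, j)))"
        by (simp add: cterm_def gconv_def on_W_in sum_distrib_right)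
    qed
    also have "\<dots> = (\<Sum>(t, r)\<in>(SIGMA t:Cov T s. Cov T t).
        F r p * G (spec_contract t r) (?m r) * H (spec_contract s t) (?m t))"
      using fin by (intro sum.Sigma) blast+
    also have "\<dots> = (\<Sum>(r, t')\<in>(SIGMA r:Cov T s. Cov T (spec_contract s r)).
        F r p * G t' (?m r) * H (spec_contract (spec_contract s r) t') (mom_restrict (external (fst t')) (?m r)))"
    proof -
      let ?h = "\<lambda>(r, t'). F r p * G t' (?m r) * H (spec_contract (spec_contract s r) t') (mom_restrict (external (fst t')) (?m r))"
      have "?h (case x of (t, r) \<Rightarrow> (r, spec_contract t r)) = (case x of (t, r) \<Rightarrow> F r p * G (spec_contract t r) (?m r) * H (spec_contract s t) (?m t))"
        if x: "x \<in> (SIGMA t:Cov T s. Cov T t)" for x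
      proof -
        obtain t r where xt: "x = (t, r)" and t: "spec_covering T t s" and r: "spec_covering T r t"
          using x by (elim SigmaE) simp
        \<comment> \<open>The contracted covering has the same free half-edges as t, so restricting
          momenta in two stages amounts to restricting them once.\<close>
        have e: "external (fst (spec_contract t r)) = external (fst t)"
          using external_contract[OF sp_fgraph[OF T cov_sp2[OF r]] cov_cov[OF r]] by (simp add: fst_spec_contract)
        show ?thesis
          using covering_external[OF cov_cov[OF r]]
          by (simp add: xt spec_contract_spec_contract[OF T r t] e mom_restrict_mom_restrict Int_absorb2)
      qed
      then show ?thesis
        using sum.reindex_bij_betw[OF bij_betw_assoc[OF T, of s], of ?h] by simp
    qed
    also have "\<dots> = (\<Sum>r\<in>Cov T s. \<Sum>t'\<in>Cov T (spec_contract s r).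
        F r p * G t' (?m r) * H (spec_contract (spec_contract s r) t') (mom_restrict (external (fst t')) (?m r)))"
      using fin by (intro sum.Sigma[symmetric]) blast+
    also have "\<dots> = gconv T F (gconv T G H) s p"
      unfolding gconv_def[of T F] on_W_in[OF True]
    proof (intro sum.cong refl, clarify)
      fix \<delta> k assume r: "spec_covering T (\<delta>, k) s"
      show "(\<Sum>t'\<in>Cov T (spec_contract s (\<delta>, k)). F (\<delta>, k) p * G t' (?m (\<delta>, k)) *
          H (spec_contract (spec_contract s (\<delta>, k)) t') (mom_restrict (external (fst t')) (?m (\<delta>, k)))) =
        cterm F (gconv T G H) s (\<delta>, k) p"
        using W_spec_contract[OF r True]
        by (simp add: cterm_def gconv_def on_W_in sum_distrib_left mult.assoc)
    qed
    finally show ?thesis .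
  qed (simp add: gconv_def on_W_def)
qed

lemma gconv_cong:
  assumes "\<And>t. specified T t \<Longrightarrow> F t = F' t" "\<And>t. specified T t \<Longrightarrow> G t = G' t"
  shows "gconv T F G s = gconv T F' G' s"
proof -
  have "cterm F G s t p = cterm F' G' s t p" if "t \<in> Cov T s" for t p
    using that assms(1)[of t] assms(2)[of "spec_contract s t"] cov_sp1[of T t s] specified_spec_contract[OF T, of t s]
    by (simp add: cterm_def)
  then show ?thesis unfolding gconv_def by (intro arg_cong[of _ _ "on_W (fst s)"] ext sum.cong refl)
qed

end

section \<open>Recursive construction of left inverses\<close>

section \<open>Inverses\<close>

text \<open>The equation \<open>linv * G = 1\<close>, solved for its term at the trivial covering; the other terms involve
  fewer internal edges.\<close>

function linv :: "'e ftheory \<Rightarrow> ('e, 'd::finite) gfun \<Rightarrow> ('e, 'd) gfun" where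
  "linv T G s = (\<lambda>p. gunit s p - on_W (fst s) (\<lambda>p.
     \<Sum>t\<in>{t. valid_theory T \<and> spec_covering T t s \<and> t \<noteq> s}.
       linv T G t p * G (spec_contract s t) (mom_restrict (external (fst t)) p)) p)"
  by pat_completeness auto
termination
  \<comment> \<open>The conjunct \<open>valid_theory T\<close> in the summation range supplies the
    premise of \<open>card_internal_less\<close>, by which each recursive argument has fewer
    internal edges.\<close>
  by (relation "Wellfounded.measure (\<lambda>(T, G, s). card (hedges (fst s) - external (fst s)))")
    (auto intro: card_internal_less)

declare linv.simps [simp del]

context
  fixes T :: "'e ftheory"
  assumes T: "valid_theory T"
begin

lemma linv_eq:
  "linv T G s = (\<lambda>p. gunit s p - on_W (fst s) (\<lambda>p. \<Sum>t\<in>Cov T s - {s}. cterm (linv T G) G s t p) p)"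
proof -
  have "{t. valid_theory T \<and> spec_covering T t s \<and> t \<noteq> s} = Cov T s - {s}" using T by blast
  then show ?thesis by (subst linv.simps) (simp only: cterm_def)
qed

text \<open>The recursion subtracts every term except that of the trivial covering, and by
  \<open>cterm_top\<close> this term is the value of \<open>linv\<close> itself.\<close>

lemma sum_cterm_linv:
  assumes G: "G \<in> gchars T" and s: "specified T s" and p: "p \<in> W (fst s)"
  shows "(\<Sum>t\<in>Cov T s. cterm (linv T G) G s t p) = gunit s p"
proof -
  have "(\<Sum>t\<in>Cov T s. cterm (linv T G) G s t p) =
      linv T G s p + (\<Sum>t\<in>Cov T s - {s}. cterm (linv T G) G s t p)"
    using finite_Cov[OF T, of s] Cov_refl[OF s] cterm_top[OF T G s p]
    by (simp add: sum.remove[of "Cov T s" s])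
  then show ?thesis by (subst (asm) linv_eq) (simp add: on_W_in[OF p])
qed

lemma gconv_linv:
  assumes G: "G \<in> gchars T" and s: "specified T s"
  shows "gconv T (linv T G) G s = gunit s"
  using sum_cterm_linv[OF G s] by (auto simp: gconv_def on_W_def gunit_def Vone_def)

lemma linv_V:
  assumes G: "G \<in> gchars T" and s: "specified T s"
  shows "linv T G s \<in> V (fst s)"
  using s
proof (induction "card (hedges (fst s) - external (fst s))" arbitrary: s rule: less_induct)
  case less
  have "on_W (fst s) (cterm (linv T G) G s t) \<in> V (fst s)" if "t \<in> Cov T s - {s}" for t
  proof -
    have t: "spec_covering T t s" "t \<noteq> s" using that by auto
    show ?thesis
    proof (rule cterm_V[OF T t(1)])
      show "linv T G t \<in> V (fst t)"
        by (rule less.hyps[OF card_internal_less[OF T t] cov_sp1[OF t(1)]])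
      show "G (spec_contract s t) \<in> V (fst (spec_contract s t))"
        by (rule gc_V[OF G specified_spec_contract[OF T t(1)]])
    qed
  qed
  then have "on_W (fst s) (\<lambda>p. \<Sum>t\<in>Cov T s - {s}. cterm (linv T G) G s t p) \<in> V (fst s)"
    unfolding on_W_sum by (rule V_sum)
  from V_add[OF gc_V[OF gunit_gchars[OF T] less.prems] V_scale[OF this, of "-1"]]
  show ?case by (subst linv_eq) simp
qed

text \<open>The transfer matches proper coverings with proper coverings, by
  \<open>cov_transfer_top\<close>; these fall under the induction hypothesis, and the unit is
  invariant.\<close>

lemma linv_iso:
  assumes G: "G \<in> gchars T" and "specified T s" "specified T s'"
    and "graph_iso f g (fst s) (fst s')" and "p \<in> W (fst s')"
  shows "linv T G s' p = linv T G s (pull g (fst s) p)"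
  using assms(2-)
proof (induction "card (hedges (fst s) - external (fst s))" arbitrary: s s' rule: less_induct)
  case less
  note s = less.prems(1,2) and iso = less.prems(3) and p = less.prems(4)
  have si: "shape_iso f g (fst s) (fst s')" using iso by (simp add: graph_iso_iff)
  note bij = bij_betw_Cov[OF T s iso]
  have "(\<Sum>t\<in>cov_transfer f g s s' ` (Cov T s - {s}). cterm (linv T G) G s' t p) =
      (\<Sum>t\<in>Cov T s - {s}. cterm (linv T G) G s t (pull g (fst s) p))"
  proof (rule sum_cterm_transfer[OF T G s iso p Diff_subset])
    fix t assume "t \<in> Cov T s - {s}"
    then have t: "spec_covering T t s" "t \<noteq> s" by auto
    note C = Cov_transfer[OF T s iso t(1)]
    show "linv T G (cov_transfer f g s s' t) p = linv T G t (pull g (fst t) p)"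
      by (rule less.hyps[OF card_internal_less[OF T t] cov_sp1[OF t(1)] cov_sp1[OF C] iso_transfer[OF T s iso t(1)]])
        (use p W_covering[OF cov_cov[OF C]] in auto)
  qed
  moreover have "cov_transfer f g s s' ` (Cov T s - {s}) = Cov T s' - {s'}"
    using bij Cov_refl[OF s(1)] cov_transfer_top[OF T s iso]
    by (subst inj_on_image_set_diff[of _ "Cov T s"]) (auto simp: bij_betw_def)
  ultimately show ?case
    using p W_pull[OF sp_fgraph[OF T s(1)] si p] gunit_iso[OF T s(1) iso p]
    by (subst (1 2) linv_eq) (simp add: on_W_in)
qed

text \<open>By the defining equations of the two factors, the double sum over pairs of coverings
  without the trivial pair is the product of the units minus the product of the inverses.
  Subtracting it from the unit of the union, which is multiplicative, leaves the latter
  product.\<close>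

lemma linv_mult:
  fixes G :: "('e, 'd::finite) gfun"
  assumes G: "G \<in> gchars T" and "specified T s" "specified T s'" and "gdisjoint (fst s) (fst s')"
  shows "linv T G (sunion s s') = concat (fst s) (fst s') (linv T G s) (linv T G s')"
  using assms(2-)
proof (induction "card (hedges (fst s) - external (fst s)) + card (hedges (fst s') - external (fst s'))"
    arbitrary: s s' rule: less_induct)
  case less
  note s = less.prems(1,2) and d = less.prems(3)
  note f = sp_fgraph[OF T s(1)] and f' = sp_fgraph[OF T s(2)]
  let ?F = "linv T G"
  note bij = bij_betw_Cov_sunion[OF T s d]
  note sp = specified_sunion[OF T s d]
  \<comment> \<open>A pair in this set may be trivial in one of its entries, so the induction has to
    run on the total number of internal edges of both parts.\<close>
  let ?A = "Cov T s \<times> Cov T s' - {(s, s')}"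
  have img: "(\<lambda>(t, t'). sunion t t') ` ?A = Cov T (sunion s s') - {sunion s s'}"
    using bij Cov_refl[OF s(1)] Cov_refl[OF s(2)]
    by (subst inj_on_image_set_diff[of _ "Cov T s \<times> Cov T s'"]) (auto simp: bij_betw_def)
  show ?case
  proof
    fix p :: "'d momenta"
    show "?F (sunion s s') p = concat (fst s) (fst s') (?F s) (?F s') p"
    proof (cases "p \<in> W (gunion (fst s) (fst s'))")
      case True
      let ?p = "mom_restrict (hedges (fst s)) p" and ?p' = "mom_restrict (hedges (fst s')) p"
      note pW = W_gunion[OF f f' d True]
      have "(\<Sum>u\<in>Cov T (sunion s s') - {sunion s s'}. cterm ?F G (sunion s s') u p) =
          (\<Sum>(t, t')\<in>?A. cterm ?F G (sunion s s') (sunion t t') p)"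
        unfolding img[symmetric] by (rule sum_cterm_sunion[OF T s d Diff_subset])
      also have "\<dots> = (\<Sum>(t, t')\<in>?A. cterm ?F G s t ?p * cterm ?F G s' t' ?p')"
      proof (rule sum.cong[OF refl])
        fix x assume "x \<in> ?A"
        then obtain t t' where x: "x = (t, t')" and t: "spec_covering T t s" "spec_covering T t' s'"
          and ne: "t \<noteq> s \<or> t' \<noteq> s'" by auto
        have dt: "gdisjoint (fst t) (fst t')"
          using d covering_simps[OF cov_cov[OF t(1)]] covering_simps[OF cov_cov[OF t(2)]] by (simp add: gdisjoint_def)
        have "card (hedges (fst t) - external (fst t)) + card (hedges (fst t') - external (fst t')) <
            card (hedges (fst s) - external (fst s)) + card (hedges (fst s') - external (fst s'))"
          using ne card_internal_less[OF T t(1)] card_internal_less[OF T t(2)]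
          by (cases "t = s"; cases "t' = s'") auto
        from less.hyps[OF this cov_sp1[OF t(1)] cov_sp1[OF t(2)] dt]
        show "(case x of (t, t') \<Rightarrow> cterm ?F G (sunion s s') (sunion t t') p) =
            (case x of (t, t') \<Rightarrow> cterm ?F G s t ?p * cterm ?F G s' t' ?p')"
          unfolding x prod.case by (rule cterm_sunion[OF T G t d True])
      qed
      also have "\<dots> = (\<Sum>t\<in>Cov T s. cterm ?F G s t ?p) * (\<Sum>t'\<in>Cov T s'. cterm ?F G s' t' ?p')
          - cterm ?F G s s ?p * cterm ?F G s' s' ?p'"
        using finite_Cov[OF T, of s] finite_Cov[OF T, of s'] Cov_refl[OF s(1)] Cov_refl[OF s(2)]
        by (simp add: sum_product sum.cartesian_product sum_diff1)
      also have "\<dots> = gunit s ?p * gunit s' ?p' - ?F s ?p * ?F s' ?p'"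
        using sum_cterm_linv[OF G s(1) pW(1)] sum_cterm_linv[OF G s(2) pW(2)]
          cterm_top[OF T G s(1) pW(1)] cterm_top[OF T G s(2) pW(2)] by simp
      finally have "?F (sunion s s') p = ?F s ?p * ?F s' ?p'"
        using gunit_sunion[OF T s d True] True by (subst linv_eq) (simp add: on_W_in)
      then show ?thesis by (simp add: concat_in[OF True])
    next
      case False
      then show ?thesis using V_off[OF linv_V[OF G sp]] by (simp add: concat_off)
    qed
  qed
qed

lemma linv_gchars:
  assumes G: "G \<in> gchars T"
  shows "linv T G \<in> gchars T"
proof (rule gcharsI)
  fix s :: "'e sgraph" assume s: "specified T s" and n: "no_internal (fst s)"
  have e: "Cov T s - {s} = {}" by (simp only: Cov_no_internal[OF T s n] Diff_cancel)
  show "linv T G s = Vone (fst s)"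
    unfolding linv_eq[of G s] e using n by (simp add: gunit_def on_W_def)
qed (rule linv_V[OF G] linv_iso[OF G] linv_mult[OF G], assumption+)+

end

section \<open>From functions on graphs to linear maps\<close>

section \<open>Linear extension\<close>

text \<open>Each part is the restriction to its own vertex set, so pairs of vertex sets bound the
  decompositions. Finiteness matters because a sum over an infinite set is 0 by convention.\<close>

lemma finite_gunion_decompositions:
  assumes "is_fgraph T \<Gamma>"
  shows "finite {(\<Gamma>1, \<Gamma>2). graph_of T \<Gamma>1 \<and> graph_of T \<Gamma>2 \<and> gdisjoint \<Gamma>1 \<Gamma>2 \<and> gunion \<Gamma>1 \<Gamma>2 = \<Gamma>}"
    (is "finite ?S")
proof (rule finite_subset)
  let ?P = "Pow (verts \<Gamma>)"
  show "?S \<subseteq> comp_graph \<Gamma> ` ?P \<times> comp_graph \<Gamma> ` ?P"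
  proof
    fix x assume "x \<in> ?S"
    then obtain \<Gamma>1 \<Gamma>2 where x: "x = (\<Gamma>1, \<Gamma>2)"
      and a: "graph_of T \<Gamma>1" "graph_of T \<Gamma>2" "gdisjoint \<Gamma>1 \<Gamma>2" "gunion \<Gamma>1 \<Gamma>2 = \<Gamma>" by auto
    then have "is_fgraph T \<Gamma>1" "is_fgraph T \<Gamma>2" by (auto simp: graph_of_def)
    from comp_graph_gunion[OF this a(3)] comp_graph_gunion2(2)[OF this a(3)]
    have "\<Gamma>1 = comp_graph \<Gamma> (verts \<Gamma>1)" "\<Gamma>2 = comp_graph \<Gamma> (verts \<Gamma>2)" by (simp_all add: a(4))
    moreover have "verts \<Gamma>1 \<in> ?P" "verts \<Gamma>2 \<in> ?P" using a(4) by auto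
    ultimately show "x \<in> comp_graph \<Gamma> ` ?P \<times> comp_graph \<Gamma> ` ?P" unfolding x by blast
  qed
  show "finite (comp_graph \<Gamma> ` ?P \<times> comp_graph \<Gamma> ` ?P)" using fg_finite_verts[OF assms] by simp
qed

text \<open>Each inclusion vanishes away from one graph, so a single decomposition contributes and
  the product is again concentrated at one graph.\<close>

lemma Bmult_Bincl:
  fixes v v' :: "('d::finite) momenta \<Rightarrow> complex"
  assumes "graph_of T \<Gamma>" "graph_of T \<Gamma>'" "gdisjoint \<Gamma> \<Gamma>'"
  shows "Bmult T (Bincl \<Gamma> v) (Bincl \<Gamma>' v') = Bincl (gunion \<Gamma> \<Gamma>') (concat \<Gamma> \<Gamma>' v v')"
proof (intro ext)
  fix \<Delta> :: "'a fgraph" and p :: "'d momenta"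
  let ?S = "{(\<Gamma>1, \<Gamma>2). graph_of T \<Gamma>1 \<and> graph_of T \<Gamma>2 \<and> gdisjoint \<Gamma>1 \<Gamma>2 \<and> gunion \<Gamma>1 \<Gamma>2 = \<Delta>}"
  let ?c = "\<lambda>(\<Gamma>1, \<Gamma>2). concat \<Gamma>1 \<Gamma>2 (Bincl \<Gamma> v \<Gamma>1) (Bincl \<Gamma>' v' \<Gamma>2) p"
  have z: "?c x = 0" if "x \<noteq> (\<Gamma>, \<Gamma>')" for x
    using that by (cases x) (auto simp: concat_def on_W_def Bincl_def)
  have f: "is_fgraph T (gunion \<Gamma> \<Gamma>')"
    using assms is_fgraph_gunion by (auto simp: graph_of_def)
  show "Bmult T (Bincl \<Gamma> v) (Bincl \<Gamma>' v') \<Delta> p = Bincl (gunion \<Gamma> \<Gamma>') (concat \<Gamma> \<Gamma>' v v') \<Delta> p"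
  proof (cases "\<Delta> = gunion \<Gamma> \<Gamma>'")
    case True
    have "sum ?c ?S = sum ?c {(\<Gamma>, \<Gamma>')}"
      using finite_gunion_decompositions[OF f] z assms True
      by (intro sum.mono_neutral_right) auto
    then show ?thesis using True by (simp add: Bmult_def Bincl_def)
  next
    case False
    have "sum ?c ?S = 0"
    proof (rule sum.neutral, rule ballI)
      fix x assume "x \<in> ?S"
      then have "x \<noteq> (\<Gamma>, \<Gamma>')" using False by auto
      then show "?c x = 0" by (rule z)
    qed
    then show ?thesis using False by (simp add: Bmult_def Bincl_def)
  qed
qed

definition lin :: "'e ftheory \<Rightarrow> ('e, 'd::finite) gfun \<Rightarrow> ('e, 'd) lmap" where
  "lin T F = (\<lambda>x\<in>Hspace T. \<lambda>\<Gamma> p.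
     \<Sum>s\<in>Poly_Mapping.keys x. Poly_Mapping.lookup x s * Bincl (fst s) (F s) \<Gamma> p)"

lemma Hspace_basis: "specified T s \<Longrightarrow> basis s \<in> Hspace T"
  by (simp add: Hspace_def)

lemma Hspace_add: "x \<in> Hspace T \<Longrightarrow> y \<in> Hspace T \<Longrightarrow> x + y \<in> Hspace T"
  using Poly_Mapping.keys_add[of x y] by (auto simp: Hspace_def)

lemma lookup_scale: "Poly_Mapping.lookup (Poly_Mapping.map ((*) c) x) s = c * Poly_Mapping.lookup x s"
  for c :: complex
  by (simp add: Poly_Mapping.map.rep_eq when_def)

lemma Hspace_scale: "x \<in> Hspace T \<Longrightarrow> Poly_Mapping.map ((*) c) x \<in> Hspace T"
  by (auto simp: Hspace_def Poly_Mapping.in_keys_iff lookup_scale)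

lemma lin_basis:
  assumes "specified T s"
  shows "lin T F (basis s) = Bincl (fst s) (F s)"
  using Hspace_basis[OF assms] by (simp add: lin_def)

lemma val_lin: "specified T s \<Longrightarrow> val (lin T F) s = F s"
  by (simp add: val_def lin_basis Bincl_def)

lemma lin_cong:
  assumes "\<And>s. specified T s \<Longrightarrow> F s = F' s"
  shows "lin T F = lin T F'"
  unfolding lin_def
  by (intro restrict_ext ext sum.cong refl) (use assms in \<open>auto simp: Hspace_def\<close>)

lemma linear_HB_lin:
  assumes F: "\<And>s. specified T s \<Longrightarrow> F s \<in> V (fst s)"
  shows "linear_HB T (lin T F)"
proof -
  let ?c = "\<lambda>s. Bincl (fst s) (F s)"
  let ?S = "\<lambda>x \<Gamma> p. \<Sum>s\<in>Poly_Mapping.keys x. Poly_Mapping.lookup x s * ?c s \<Gamma> p"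
  have eq: "lin T F x = ?S x" if "x \<in> Hspace T" for x using that by (simp add: lin_def)
  have exp: "?S x \<Gamma> p = (\<Sum>s\<in>A. Poly_Mapping.lookup x s * ?c s \<Gamma> p)"
    if "finite A" "Poly_Mapping.keys x \<subseteq> A" for x A \<Gamma> p
    using that by (intro sum.mono_neutral_left) (auto simp: Poly_Mapping.in_keys_iff)
  have 1: "?S x \<in> Bspace T" if x: "x \<in> Hspace T" for x
  proof -
    have sp: "specified T s" if "s \<in> Poly_Mapping.keys x" for s using x that by (simp add: Hspace_def)
    have "?S x \<Gamma> \<in> V \<Gamma>" for \<Gamma>
    proof (intro V_sum V_scale)
      fix s assume "s \<in> Poly_Mapping.keys x"
      then show "?c s \<Gamma> \<in> V \<Gamma>" using F[OF sp] V_zero[of \<Gamma>] by (auto simp: Bincl_def)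
    qed
    moreover have "?S x \<Gamma> = (\<lambda>_. 0)" if g: "\<not> graph_of T \<Gamma>" for \<Gamma>
    proof -
      have ne: "fst s \<noteq> \<Gamma>" if "s \<in> Poly_Mapping.keys x" for s
        using sp[OF that] g by (auto simp: specified_def)
      show ?thesis by (intro ext sum.neutral ballI) (use ne in \<open>auto simp: Bincl_def\<close>)
    qed
    ultimately show ?thesis by (simp add: Bspace_def)
  qed
  have 2: "lin T F (x + y) = (\<lambda>\<Gamma> p. lin T F x \<Gamma> p + lin T F y \<Gamma> p)"
    if x: "x \<in> Hspace T" and y: "y \<in> Hspace T" for x y
  proof -
    let ?A = "Poly_Mapping.keys x \<union> Poly_Mapping.keys y"
    have "?S (x + y) \<Gamma> p = ?S x \<Gamma> p + ?S y \<Gamma> p" for \<Gamma> p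
      using exp[of ?A "x + y" \<Gamma> p] exp[of ?A x \<Gamma> p] exp[of ?A y \<Gamma> p] Poly_Mapping.keys_add[of x y]
      by (simp add: lookup_add distrib_right sum.distrib)
    then show ?thesis by (simp add: eq x y Hspace_add)
  qed
  have 3: "lin T F (Poly_Mapping.map ((*) c) x) = (\<lambda>\<Gamma> p. c * lin T F x \<Gamma> p)" if x: "x \<in> Hspace T" for c x
  proof -
    have k: "Poly_Mapping.keys (Poly_Mapping.map ((*) c) x) \<subseteq> Poly_Mapping.keys x"
      by (auto simp: Poly_Mapping.in_keys_iff lookup_scale)
    have "?S (Poly_Mapping.map ((*) c) x) \<Gamma> p = c * ?S x \<Gamma> p" for \<Gamma> p
      using exp[OF _ k, of \<Gamma> p] by (simp add: lookup_scale sum_distrib_left mult.assoc)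
    then show ?thesis by (simp add: eq x Hspace_scale)
  qed
  have "lin T F \<in> Hspace T \<rightarrow>\<^sub>E Bspace T" using 1 eq by (auto simp: lin_def)
  then show ?thesis using 2 3 by (simp add: linear_HB_def)
qed

lemma linear_HB_expand:
  assumes lin: "linear_HB T \<phi>" and x: "x \<in> Hspace T"
  shows "\<phi> x \<Gamma> p = (\<Sum>s\<in>Poly_Mapping.keys x. Poly_Mapping.lookup x s * \<phi> (basis s) \<Gamma> p)"
proof -
  have add: "\<phi> (x + y) = (\<lambda>\<Gamma> p. \<phi> x \<Gamma> p + \<phi> y \<Gamma> p)" if "x \<in> Hspace T" "y \<in> Hspace T" for x y
    using lin that by (simp add: linear_HB_def)
  have scale: "\<phi> (Poly_Mapping.map ((*) c) x) = (\<lambda>\<Gamma> p. c * \<phi> x \<Gamma> p)" if "x \<in> Hspace T" for c x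
    using lin that by (simp add: linear_HB_def)
  have "x \<in> Hspace T \<Longrightarrow> \<phi> x \<Gamma> p = (\<Sum>s\<in>A. Poly_Mapping.lookup x s * \<phi> (basis s) \<Gamma> p)"
    if "finite A" "Poly_Mapping.keys x = A" for A x
    using that
  proof (induction A arbitrary: x rule: finite_induct)
    case empty
    \<comment> \<open>The zero vector is 0 times itself, so homogeneity alone forces the value
      0.\<close>
    then have "x = Poly_Mapping.map ((*) 0) x" by (intro poly_mapping_eqI) (simp add: lookup_scale)
    then have "\<phi> x \<Gamma> p = 0 * \<phi> x \<Gamma> p" using scale[OF empty(1), of 0] by metis
    then show ?case by simp
  next
    case (insert s A)
    let ?c = "Poly_Mapping.lookup x s"
    \<comment> \<open>Subtracting the s-coordinate leaves a vector with support A, to which the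
      induction hypothesis applies.\<close>
    let ?y = "x - Poly_Mapping.map ((*) ?c) (basis s)"
    have ly: "Poly_Mapping.lookup ?y t = (if t = s then 0 else Poly_Mapping.lookup x t)" for t
      by (simp add: lookup_minus lookup_scale lookup_single when_def)
    then have ky: "Poly_Mapping.keys ?y = A"
      using insert.hyps(2) insert.prems(2) by (auto simp: Poly_Mapping.in_keys_iff set_eq_iff split: if_splits)
    have s: "specified T s" using insert.prems by (simp add: Hspace_def)
    have yH: "?y \<in> Hspace T" using insert.prems ky unfolding Hspace_def by simp
    note bH = Hspace_basis[OF s]
    have "x = ?y + Poly_Mapping.map ((*) ?c) (basis s)" by simp
    then have "\<phi> x \<Gamma> p = \<phi> ?y \<Gamma> p + ?c * \<phi> (basis s) \<Gamma> p"
      using add[OF yH Hspace_scale[OF bH, of ?c]] scale[OF bH, of ?c] by metis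
    also have "\<phi> ?y \<Gamma> p = (\<Sum>t\<in>A. Poly_Mapping.lookup ?y t * \<phi> (basis t) \<Gamma> p)"
      by (rule insert.IH[OF yH ky])
    also have "\<dots> = (\<Sum>t\<in>A. Poly_Mapping.lookup x t * \<phi> (basis t) \<Gamma> p)"
    proof (rule sum.cong[OF refl])
      fix t assume "t \<in> A"
      then have "t \<noteq> s" using insert.hyps(2) by auto
      then show "Poly_Mapping.lookup ?y t * \<phi> (basis t) \<Gamma> p = Poly_Mapping.lookup x t * \<phi> (basis t) \<Gamma> p"
        unfolding ly by simp
    qed
    finally show ?case using insert.hyps by simp
  qed
  from this[OF Poly_Mapping.finite_keys refl x] show ?thesis .
qed

section \<open>The group\<close>

context
  fixes T :: "'e ftheory"
  assumes T: "valid_theory T"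
begin

lemma Gset_basis:
  assumes "\<phi> \<in> Gset T" "specified T s"
  shows "\<phi> (basis s) = Bincl (fst s) (val \<phi> s)"
proof -
  have "\<exists>v\<in>V \<Gamma>. \<phi> (basis (\<Gamma>, i)) = Bincl \<Gamma> v" if "specified T (\<Gamma>, i)" for \<Gamma> i
    using assms(1) that unfolding Gset_def Ltilde_def by blast
  from this[of "fst s" "snd s"] show ?thesis using assms(2) by (auto simp: val_def Bincl_def)
qed

lemma val_gchars:
  fixes \<phi> :: "('e, 'd::finite) lmap"
  assumes \<phi>: "\<phi> \<in> Gset T"
  shows "val \<phi> \<in> gchars T"
proof (rule gcharsI)
  have L: "\<phi> \<in> Ltilde T" using \<phi> by (simp add: Gset_def)
  fix s assume s: "specified T s"
  have "\<exists>v\<in>V \<Gamma>. \<phi> (basis (\<Gamma>, i)) = Bincl \<Gamma> v" if "specified T (\<Gamma>, i)" for \<Gamma> i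
    using L that unfolding Ltilde_def by blast
  from this[of "fst s" "snd s"] show "val \<phi> s \<in> V (fst s)" using s by (auto simp: val_def Bincl_def)
  show "val \<phi> s = Vone (fst s)" if "no_internal (fst s)"
  proof -
    have "\<phi> (basis (\<Gamma>, i)) = Bincl \<Gamma> (Vone \<Gamma>)" if "specified T (\<Gamma>, i)" "no_internal \<Gamma>" for \<Gamma> i
      using L that unfolding Ltilde_def by blast
    from this[of "fst s" "snd s"] show ?thesis using s that by (simp add: val_def Bincl_def)
  qed
next
  have L: "\<phi> \<in> Ltilde T" using \<phi> by (simp add: Gset_def)
  fix s s' f g and p :: "'d momenta"
  assume a: "specified T s" "specified T s'" "graph_iso f g (fst s) (fst s')" "p \<in> W (fst s')"
  have "val \<phi> (\<Gamma>', i') p = val \<phi> (\<Gamma>, i) (mom_restrict (hedges \<Gamma>) (p \<circ> g))"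
    if "specified T (\<Gamma>, i)" "specified T (\<Gamma>', i')" "graph_iso f g \<Gamma> \<Gamma>'" "p \<in> W \<Gamma>'" for \<Gamma> i \<Gamma>' i'
    using L that unfolding Ltilde_def by blast
  from this[of "fst s" "snd s" "fst s'" "snd s'"]
  show "val \<phi> s' p = val \<phi> s (pull g (fst s) p)" using a by (simp add: pull_def)
next
  fix s s' :: "'e sgraph"
  assume s: "specified T s" "specified T s'" and d: "gdisjoint (fst s) (fst s')"
  have g: "graph_of T (fst s)" "graph_of T (fst s')" using s by (auto simp: specified_def)
  have "\<phi> (basis (sunion s s')) = Bmult T (\<phi> (basis s)) (\<phi> (basis s'))"
    using \<phi> s d unfolding Gset_def by blast
  then show "val \<phi> (sunion s s') = concat (fst s) (fst s') (val \<phi> s) (val \<phi> s')"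
    unfolding Gset_basis[OF \<phi> s(1)] Gset_basis[OF \<phi> s(2)] Bmult_Bincl[OF g d]
    by (simp add: val_def[of _ "sunion s s'"] Bincl_def)
qed

lemma lin_val:
  assumes \<phi>: "\<phi> \<in> Gset T"
  shows "lin T (val \<phi>) = \<phi>"
proof (rule ext)
  have HB: "linear_HB T \<phi>" using \<phi> by (simp add: Gset_def Ltilde_def)
  fix x
  show "lin T (val \<phi>) x = \<phi> x"
  proof (cases "x \<in> Hspace T")
    case True
    have "specified T s" if "s \<in> Poly_Mapping.keys x" for s using that True by (simp add: Hspace_def)
    then show ?thesis
      using True Gset_basis[OF \<phi>] by (intro ext) (simp add: lin_def linear_HB_expand[OF HB True])
  next
    case False
    then show ?thesis using HB by (auto simp: lin_def linear_HB_def PiE_def extensional_def)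
  qed
qed

lemma specified_sempty: "specified T sempty"
proof -
  let ?E = "empty_graph :: 'e fgraph"
  have e: "verts ?E = {}" "hedges ?E = {}" "invol ?E = (\<lambda>_. undefined)" "att ?E = (\<lambda>_. undefined)"
    "htype ?E = (\<lambda>_. undefined)" "vidx ?E = (\<lambda>_. undefined)"
    by (simp_all add: empty_graph_def)
  have "gcomps ?E = {}" by (simp add: gcomps_eq e)
  then show ?thesis
    by (simp add: specified_def sempty_def graph_of_def is_fgraph_def in_theory_def locally_one_PI_def
        superficially_divergent_def extensional_def e)
qed

lemma lin_Gset:
  fixes F :: "('e, 'd::finite) gfun"
  assumes F: "F \<in> gchars T"
  shows "lin T F \<in> Gset T"
proof -
  have indep: "F (\<Gamma>, i) = F (\<Gamma>, i')" if s: "specified T (\<Gamma>, i)" "specified T (\<Gamma>, i')" for \<Gamma> i i'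
  proof
    fix p :: "'d momenta"
    \<comment> \<open>\<open>graph_iso\<close> compares graphs without their specifications, so the
      identity relates two specifications of one graph.\<close>
    have iso: "graph_iso id id (fst (\<Gamma>, i)) (fst (\<Gamma>, i'))" by (simp add: graph_iso_def)
    show "F (\<Gamma>, i) p = F (\<Gamma>, i') p"
    proof (cases "p \<in> W \<Gamma>")
      case True
      then show ?thesis using gc_iso[OF F s iso, of p] by (simp add: pull_def mom_restrict_W)
    next
      case False
      then show ?thesis using V_off[OF gc_V[OF F s(1)], of p] V_off[OF gc_V[OF F s(2)], of p] by simp
    qed
  qed
  have iso: "val (lin T F) (\<Gamma>', i') p = val (lin T F) (\<Gamma>, i) (mom_restrict (hedges \<Gamma>) (p \<circ> g))"
    if "specified T (\<Gamma>, i)" "specified T (\<Gamma>', i')" "graph_iso f g \<Gamma> \<Gamma>'" "p \<in> W \<Gamma>'" for \<Gamma> i \<Gamma>' i' f g p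
    using gc_iso[OF F that(1,2), of f g p] that by (simp add: val_lin pull_def)
  have "lin T F \<in> Ltilde T"
    unfolding Ltilde_def mem_Collect_eq
  proof (intro conjI allI impI; (elim conjE)?)
    show "linear_HB T (lin T F)" by (rule linear_HB_lin) (rule gc_V[OF F])
  next
    fix \<Gamma> i i' assume s: "specified T (\<Gamma>, i)" "specified T (\<Gamma>, i')"
    show "lin T F (basis (\<Gamma>, i)) = lin T F (basis (\<Gamma>, i'))"
      by (simp add: lin_basis s indep[OF s])
  next
    fix \<Gamma> i assume s: "specified T (\<Gamma>, i)"
    show "\<exists>v\<in>V \<Gamma>. lin T F (basis (\<Gamma>, i)) = Bincl \<Gamma> v"
      using gc_V[OF F s] by (auto simp: lin_basis[OF s])
  next
    fix \<Gamma> i assume s: "specified T (\<Gamma>, i)" and n: "no_internal \<Gamma>"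
    show "lin T F (basis (\<Gamma>, i)) = Bincl \<Gamma> (Vone \<Gamma>)"
      using gc_one[OF F s] n by (simp add: lin_basis[OF s])
  next
    fix \<Gamma> i \<Gamma>' i' f g
    assume "specified T (\<Gamma>, i)" "specified T (\<Gamma>', i')" "graph_iso f g \<Gamma> \<Gamma>'"
    then show "\<forall>p\<in>W \<Gamma>'. val (lin T F) (\<Gamma>', i') p = val (lin T F) (\<Gamma>, i) (mom_restrict (hedges \<Gamma>) (p \<circ> g))"
      using iso by blast
  qed
  moreover have "lin T F (basis (sunion s s')) = Bmult T (lin T F (basis s)) (lin T F (basis s'))"
    if s: "specified T s" "specified T s'" and d: "gdisjoint (fst s) (fst s')" for s s'
  proof -
    have "graph_of T (fst s)" "graph_of T (fst s')" using s by (auto simp: specified_def)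
    from Bmult_Bincl[OF this d, of "F s" "F s'"] show ?thesis
      using gc_mult[OF F s d] by (simp add: lin_basis s specified_sunion[OF T s d])
  qed
  moreover have "lin T F (basis sempty) = Bone"
  proof -
    have n: "no_internal (fst sempty)" by (simp add: sempty_def no_internal_def external_def empty_graph_def)
    have f: "fst sempty = (empty_graph :: 'e fgraph)" by (simp add: sempty_def)
    show ?thesis
      unfolding lin_basis[OF specified_sempty] gc_one[OF F specified_sempty n] f Bone_def ..
  qed
  ultimately show ?thesis by (simp add: Gset_def)
qed

text \<open>By \<open>specified_spec_contract\<close> all these contractions lie in the theory, so
  the sum runs over \<open>Cov T s\<close>, and the half-edges of a contraction are those free in
  t.\<close>

lemma conv_basis_eq:
  assumes s: "specified T s"
  shows "conv_basis T \<phi> \<psi> s = gconv T (val \<phi>) (val \<psi>) s"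
proof -
  have "{t. spec_covering T t s \<and> in_theory T (fst (spec_contract s t))} = Cov T s"
    using sp_in_theory[OF T specified_spec_contract[OF T]] by blast
  moreover have "pi_map (fst s) (val \<phi> t) p * i_map (fst s) (fst (spec_contract s t)) (val \<psi> (spec_contract s t)) p
      = on_W (fst s) (cterm (val \<phi>) (val \<psi>) s t) p" if t: "t \<in> Cov T s" for t p
    using t contract_simps(2)[OF sp_fgraph[OF T s], of "fst t" "snd t"] cov_cov[of T t s]
    by (simp add: pi_map_def i_map_def on_W_def cterm_def fst_spec_contract)
  ultimately show ?thesis
    unfolding conv_basis_def gconv_def on_W_sum by (intro ext) (simp cong: sum.cong_simp)
qed

lemma conv_eq_lin: "conv T \<phi> \<psi> = lin T (gconv T (val \<phi>) (val \<psi>))"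
  unfolding conv_def lin_def
  by (intro restrict_ext ext sum.cong refl) (auto simp: Hspace_def conv_basis_eq)

lemma conv_lin_left: "conv T (lin T F) \<psi> = lin T (gconv T F (val \<psi>))"
  unfolding conv_eq_lin by (intro lin_cong gconv_cong[OF T] val_lin refl)

lemma conv_lin_right: "conv T \<phi> (lin T F) = lin T (gconv T (val \<phi>) F)"
  unfolding conv_eq_lin by (intro lin_cong gconv_cong[OF T] val_lin refl)

lemma conv_Gset: "\<phi> \<in> Gset T \<Longrightarrow> \<psi> \<in> Gset T \<Longrightarrow> conv T \<phi> \<psi> \<in> Gset T"
  unfolding conv_eq_lin by (intro lin_Gset gconv_gchars[OF T] val_gchars)

text \<open>Closure, associativity, a left unit and left inverses are established for functions on
  specified graphs and carried over by \<open>lin\<close> and \<open>val\<close>, which invert each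
  other there; \<open>groupI\<close> asks for no more.\<close>

lemma group_Gset:
  "group \<lparr>carrier = (Gset T :: ('e, 'd::finite) lmap set), mult = conv T, one = lin T gunit\<rparr>"
proof (rule groupI; simp)
  fix \<phi> \<psi> \<theta> :: "('e, 'd) lmap"
  assume \<phi>: "\<phi> \<in> Gset T"
  show "conv T (lin T gunit) \<phi> = \<phi>"
    unfolding conv_lin_left using gconv_unit_left[OF T val_gchars[OF \<phi>]]
    by (simp add: lin_cong[of T _ "val \<phi>"] lin_val[OF \<phi>])
  show "\<exists>\<psi>\<in>Gset T. conv T \<psi> \<phi> = lin T gunit"
  proof
    show "conv T (lin T (linv T (val \<phi>))) \<phi> = lin T gunit"
      unfolding conv_lin_left by (intro lin_cong gconv_linv[OF T val_gchars[OF \<phi>]])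
  qed (rule lin_Gset[OF linv_gchars[OF T val_gchars[OF \<phi>]]])
  assume \<psi>: "\<psi> \<in> Gset T"
  show "conv T \<phi> \<psi> \<in> Gset T" by (rule conv_Gset[OF \<phi> \<psi>])
  show "conv T (conv T \<phi> \<psi>) \<theta> = conv T \<phi> (conv T \<psi> \<theta>)"
    unfolding conv_eq_lin[of \<phi> \<psi>] conv_eq_lin[of \<psi> \<theta>] conv_lin_left conv_lin_right
    by (intro lin_cong gconv_assoc[OF T])
qed (rule lin_Gset[OF gunit_gchars[OF T]])

end

theorem theorem4:
  fixes T :: "'e ftheory"
  assumes "valid_theory T"
  shows "(\<forall>\<phi>\<in>(Gset T :: ('e, 'd::finite) lmap set). \<forall>\<psi>\<in>Gset T. conv T \<phi> \<psi> \<in> Gset T) \<and>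
    (\<exists>e. group \<lparr>carrier = (Gset T :: ('e, 'd) lmap set), mult = conv T, one = e\<rparr>)"
  using conv_Gset[OF assms] group_Gset[OF assms] by blast

end
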